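(* Let $m\ge 2$, $q_1,\dots,q_m\in k^*$ and $1\le l<m$. There are isomorphisms of algebras in $(\mathrm{Vec}_{\mathbb{Z}_n^m},\mathcal{R}_{\rm GCA})$: $$C^{(n)}(q_1,\dots,q_m)\cong C^{(n)}(q_1,\dots,q_l)\,\widehat{\otimes}\,C^{(n)}(q_{l+1},\dots,q_m)\cong C^{(n)}(q_1)\,\widehat{\otimes}\,C^{(n)}(q_2)\,\widehat{\otimes}\cdots\widehat{\otimes}\,C^{(n)}(q_m).$$
   Context: Standing assumptions: $n\ge 2$ is an integer, $k$ is a field with $\operatorname{char}k\nmid n$, and $\omega\in k$ is a primitive $n$-th root of unity; $k^*=k\setminus\{0\}$. Generalized Clifford algebra: $C^{(n)}(p_1,\dots,p_r)$ ($p_i\in k^*$) is the associative unital $k$-algebra generated by $r$ elements $e_1,\dots,e_r$ subject to $e_i^n=p_i1$ for all $i$ and $e_ie_j=\omega e_je_i$ for all $i>j$. Category: $\mathbb{Z}_n^m$ is the direct product of $m$ copies of the cyclic group $\mathbb{Z}_n$, written additively. $\mathrm{Vec}_{\mathbb{Z}_n^m}$ is the category of finite-dimensional $\mathbb{Z}_n^m$-graded $k$-spaces with degree-preserving linear maps, usual graded tensor product and trivial associativity constraint. It is equipped with the symmetric braiding $u\otimes v\mapsto\mathcal{R}_{\rm GCA}(|u|,|v|)\,v\otimes u$ ($|u|$ is the degree of homogeneous $u$), where $$\mathcal{R}_{\rm GCA}(g,h)=\omega^{\sum_{1\le j<i\le m}(g_ih_j-g_jh_i)},\qquad g,h\in\mathbb{Z}_n^m.$$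 An algebra in this category is a finite-dimensional associative unital $k$-algebra $A=\bigoplus_gA_g$ with $A_gA_h\subseteq A_{g+h}$; isomorphisms are degree-preserving unital algebra isomorphisms. Gradings: $C^{(n)}(q_1,\dots,q_m)$ is graded by giving $e_1^{g_1}\cdots e_m^{g_m}$ degree $(g_1,\dots,g_m)$. The algebras attached to sublists of $q_1,\dots,q_m$ are viewed as algebras in $\mathrm{Vec}_{\mathbb{Z}_n^m}$ by placing their gradings in the corresponding coordinates, the other coordinates being $0$: the generator corresponding to $q_i$ has degree the $i$-th standard generator of $\mathbb{Z}_n^m$. Braided tensor product: for algebras $A_1,A_2$ in $(\mathrm{Vec}_{\mathbb{Z}_n^m},\mathcal{R}_{\rm GCA})$, $A_1\widehat{\otimes}A_2$ is the graded space $A_1\otimes A_2$ with product $(a\widehat\otimes a')(b\widehat\otimes b')=\mathcal{R}_{\rm GCA}(|a'|,|b|)\,ab\,\widehat\otimes\,a'b'$ for homogeneous $a,b\in A_1$, $a',b'\in A_2$; it is associative up to natural isomorphism, so parentheses are omitted in multiple products. *)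

theory Defs
  imports
    "HOL-Library.Poly_Mapping"
    "HOL-Algebra.Module"
    "HOL-Algebra.QuotRing"
    "HOL-Algebra.Product_Groups"
    "HOL-Algebra.Algebraic_Closure_Type"
begin

section \<open>Algebras in the category of graded vector spaces\<close>

text \<open>
  The base field is a type \<open>'k\<close> of class \<open>field\<close>; as a record it is
  \<open>ring_of_type_algebra\<close>. The field \<open>homog\<close> holds the homogeneous components.
\<close>

record ('k, 'g, 'a) graded_alg = "('k, 'a) module" +
  homog :: "'g \<Rightarrow> 'a set"

text \<open>The grading group is written multiplicatively, following HOL-Algebra, and is meant to be finite.\<close>

definition graded_algebra ::
    "('g, 'x) monoid_scheme \<Rightarrow> ('k::field, 'g, 'a) graded_alg \<Rightarrow> bool" where
  "graded_algebra G A \<longleftrightarrow>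
     ring A \<and> module (ring_of_type_algebra :: 'k ring) A \<and>
     (\<forall>c. \<forall>x\<in>carrier A. \<forall>y\<in>carrier A.
        (c \<odot>\<^bsub>A\<^esub> x) \<otimes>\<^bsub>A\<^esub> y = c \<odot>\<^bsub>A\<^esub> (x \<otimes>\<^bsub>A\<^esub> y) \<and>
        x \<otimes>\<^bsub>A\<^esub> (c \<odot>\<^bsub>A\<^esub> y) = c \<odot>\<^bsub>A\<^esub> (x \<otimes>\<^bsub>A\<^esub> y)) \<and>
     (\<exists>S. finite S \<and> S \<subseteq> carrier A \<and>
        (\<forall>a\<in>carrier A. \<exists>c :: 'a \<Rightarrow> 'k. a = (\<Oplus>\<^bsub>A\<^esub>s\<in>S. c s \<odot>\<^bsub>A\<^esub> s))) \<and>
     (\<forall>g\<in>carrier G. submodule (homog A g) (ring_of_type_algebra :: 'k ring) A) \<and>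
     (\<forall>a\<in>carrier A. \<exists>!c. c \<in> (\<Pi>\<^sub>E g\<in>carrier G. homog A g) \<and>
        a = (\<Oplus>\<^bsub>A\<^esub>g\<in>carrier G. c g)) \<and>
     (\<forall>g\<in>carrier G. \<forall>h\<in>carrier G. \<forall>a\<in>homog A g. \<forall>b\<in>homog A h.
        a \<otimes>\<^bsub>A\<^esub> b \<in> homog A (g \<otimes>\<^bsub>G\<^esub> h))"

definition graded_alg_iso ::
    "('g, 'x) monoid_scheme \<Rightarrow> ('k::field, 'g, 'a) graded_alg \<Rightarrow> ('k, 'g, 'b) graded_alg \<Rightarrow> bool" where
  "graded_alg_iso G A B \<longleftrightarrow>
     graded_algebra G A \<and> graded_algebra G B \<and>
     (\<exists>f\<in>ring_iso A B.
        (\<forall>c. \<forall>a\<in>carrier A. f (c \<odot>\<^bsub>A\<^esub> a) = c \<odot>\<^bsub>B\<^esub> f a) \<and>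
        (\<forall>g\<in>carrier G. f ` homog A g \<subseteq> homog B g))"


section \<open>Braided tensor product\<close>

text \<open>The homogeneous part of degree \<open>g\<close> of an arbitrary element.\<close>

definition homog_part ::
    "('g, 'x) monoid_scheme \<Rightarrow> ('k::field, 'g, 'a) graded_alg \<Rightarrow> 'g \<Rightarrow> 'a \<Rightarrow> 'a" where
  "homog_part G A g a =
     (THE c. c \<in> (\<Pi>\<^sub>E h\<in>carrier G. homog A h) \<and> a = (\<Oplus>\<^bsub>A\<^esub>h\<in>carrier G. c h)) g"

definition pm_scale :: "'k::field \<Rightarrow> ('a \<Rightarrow>\<^sub>0 'k) \<Rightarrow> ('a \<Rightarrow>\<^sub>0 'k)" where
  "pm_scale c = Poly_Mapping.map ((*) c)"

lemma vector_space_pm_scale: "vector_space pm_scale"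
  by unfold_locales
    (auto simp: pm_scale_def poly_mapping_eq_iff fun_eq_iff Poly_Mapping.map.rep_eq lookup_add
      when_def algebra_simps simp flip: distrib_left)

text \<open>
  The tensor product of the vector spaces \<open>A\<close> and \<open>B\<close> is the free vector space on
  \<open>carrier A \<times> carrier B\<close> modulo the span of the bilinearity relations. Its elements are cosets
  of this span.
\<close>

definition pair_space ::
    "('k::field, 'g, 'a) graded_alg \<Rightarrow> ('k, 'g, 'b) graded_alg \<Rightarrow> ('a \<times> 'b \<Rightarrow>\<^sub>0 'k) set" where
  "pair_space A B = {p. Poly_Mapping.keys p \<subseteq> carrier A \<times> carrier B}"

abbreviation pair :: "'a \<Rightarrow> 'b \<Rightarrow> ('a \<times> 'b \<Rightarrow>\<^sub>0 'k::field)" where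
  "pair a b \<equiv> Poly_Mapping.single (a, b) 1"

definition bilinear_rels ::
    "('k::field, 'g, 'a) graded_alg \<Rightarrow> ('k, 'g, 'b) graded_alg \<Rightarrow> ('a \<times> 'b \<Rightarrow>\<^sub>0 'k) set" where
  "bilinear_rels A B = module.span pm_scale
     ({pair (a \<oplus>\<^bsub>A\<^esub> a') b - pair a b - pair a' b | a a' b.
         a \<in> carrier A \<and> a' \<in> carrier A \<and> b \<in> carrier B} \<union>
      {pair a (b \<oplus>\<^bsub>B\<^esub> b') - pair a b - pair a b' | a b b'.
         a \<in> carrier A \<and> b \<in> carrier B \<and> b' \<in> carrier B} \<union>
      {pair (c \<odot>\<^bsub>A\<^esub> a) b - pm_scale c (pair a b) | c a b.
         a \<in> carrier A \<and> b \<in> carrier B} \<union>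
      {pair a (c \<odot>\<^bsub>B\<^esub> b) - pm_scale c (pair a b) | c a b.
         a \<in> carrier A \<and> b \<in> carrier B})"

definition tensor_class ::
    "('k::field, 'g, 'a) graded_alg \<Rightarrow> ('k, 'g, 'b) graded_alg \<Rightarrow>
     ('a \<times> 'b \<Rightarrow>\<^sub>0 'k) \<Rightarrow> ('a \<times> 'b \<Rightarrow>\<^sub>0 'k) set" where
  "tensor_class A B p = {p + r | r. r \<in> bilinear_rels A B}"

text \<open>
  The rule \<open>(a \<otimes> a')(b \<otimes> b') = R |a'| |b| (ab \<otimes> a'b')\<close> for homogeneous \<open>a'\<close> and \<open>b\<close>, extended to
  arbitrary \<open>a'\<close> and \<open>b\<close> by decomposing them into homogeneous parts, and then to all formal
  combinations of pairs by bilinearity.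
\<close>

definition pair_mult ::
    "('g, 'x) monoid_scheme \<Rightarrow> ('g \<Rightarrow> 'g \<Rightarrow> 'k::field) \<Rightarrow>
     ('k, 'g, 'a) graded_alg \<Rightarrow> ('k, 'g, 'b) graded_alg \<Rightarrow>
     'a \<times> 'b \<Rightarrow> 'a \<times> 'b \<Rightarrow> ('a \<times> 'b \<Rightarrow>\<^sub>0 'k)" where
  "pair_mult G R A B u v =
     (\<Sum>g\<in>carrier G. \<Sum>h\<in>carrier G.
        pm_scale (R g h)
          (pair (fst u \<otimes>\<^bsub>A\<^esub> homog_part G A h (fst v)) (homog_part G B g (snd u) \<otimes>\<^bsub>B\<^esub> snd v)))"

definition pair_space_mult ::
    "('g, 'x) monoid_scheme \<Rightarrow> ('g \<Rightarrow> 'g \<Rightarrow> 'k::field) \<Rightarrow>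
     ('k, 'g, 'a) graded_alg \<Rightarrow> ('k, 'g, 'b) graded_alg \<Rightarrow>
     ('a \<times> 'b \<Rightarrow>\<^sub>0 'k) \<Rightarrow> ('a \<times> 'b \<Rightarrow>\<^sub>0 'k) \<Rightarrow> ('a \<times> 'b \<Rightarrow>\<^sub>0 'k)" where
  "pair_space_mult G R A B p q =
     (\<Sum>u\<in>Poly_Mapping.keys p. \<Sum>v\<in>Poly_Mapping.keys q.
        pm_scale (Poly_Mapping.lookup p u * Poly_Mapping.lookup q v) (pair_mult G R A B u v))"

text \<open>
  Operations on cosets are unions over all representatives, as in \<^const>\<open>rcoset_mult\<close>.
  The degree \<open>g\<close> component consists of the classes of sums of tensors \<open>a \<otimes> b\<close> with
  \<open>a\<close>, \<open>b\<close> homogeneous and \<open>|a| + |b| = g\<close>.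
\<close>

definition braided_tensor ::
    "('g, 'x) monoid_scheme \<Rightarrow> ('g \<Rightarrow> 'g \<Rightarrow> 'k::field) \<Rightarrow>
     ('k, 'g, 'a) graded_alg \<Rightarrow> ('k, 'g, 'b) graded_alg \<Rightarrow>
     ('k, 'g, ('a \<times> 'b \<Rightarrow>\<^sub>0 'k) set) graded_alg" where
  "braided_tensor G R A B =
     \<lparr>carrier = tensor_class A B ` pair_space A B,
      monoid.mult = (\<lambda>x y. \<Union>p\<in>x. \<Union>q\<in>y. tensor_class A B (pair_space_mult G R A B p q)),
      one = tensor_class A B (pair \<one>\<^bsub>A\<^esub> \<one>\<^bsub>B\<^esub>),
      ring.zero = tensor_class A B 0,
      add = (\<lambda>x y. \<Union>p\<in>x. \<Union>q\<in>y. tensor_class A B (p + q)),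
      module.smult = (\<lambda>c x. \<Union>p\<in>x. tensor_class A B (pm_scale c p)),
      homog = (\<lambda>g. tensor_class A B `
        {p. \<forall>(a, b)\<in>Poly_Mapping.keys p. \<exists>h\<in>carrier G. \<exists>h'\<in>carrier G.
              h \<otimes>\<^bsub>G\<^esub> h' = g \<and> a \<in> homog A h \<and> b \<in> homog B h'})\<rparr>"

text \<open>
  \<open>is_iterated_tensor G R [A\<^sub>1, \<dots>, A\<^sub>r] T\<close>: the algebra \<open>T\<close> is an iterated braided tensor product of
  \<open>A\<^sub>1, \<dots>, A\<^sub>r\<close> in this order, for some choice of parentheses. Since
  \<^const>\<open>braided_tensor\<close> changes the type of the elements, a product with a variable number of
  factors is only determined up to isomorphism here: every binary product that occurs is replaced
  by an isomorphic algebra over the fixed element type \<open>'a\<close>.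
\<close>

inductive is_iterated_tensor ::
    "('g, 'x) monoid_scheme \<Rightarrow> ('g \<Rightarrow> 'g \<Rightarrow> 'k::field) \<Rightarrow>
     ('k, 'g, 'a) graded_alg list \<Rightarrow> ('k, 'g, 'a) graded_alg \<Rightarrow> bool"
  for G :: "('g, 'x) monoid_scheme" and R :: "'g \<Rightarrow> 'g \<Rightarrow> 'k" where
  single: "is_iterated_tensor G R [A] A"
| product: "\<lbrakk>is_iterated_tensor G R As S; is_iterated_tensor G R Bs T;
      graded_alg_iso G (braided_tensor G R S T) U\<rbrakk> \<Longrightarrow> is_iterated_tensor G R (As @ Bs) U"


section \<open>Free algebras\<close>

datatype 'i free_monoid = Word (letters: "'i list")

instantiation free_monoid :: (type) monoid_add
begin

definition zero_free_monoid :: "'a free_monoid" where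
  "0 = Word []"

definition plus_free_monoid :: "'a free_monoid \<Rightarrow> 'a free_monoid \<Rightarrow> 'a free_monoid" where
  "u + v = Word (letters u @ letters v)"

instance
  by standard (simp_all add: zero_free_monoid_def plus_free_monoid_def)

end

text \<open>
  Noncommutative polynomials are finitely supported functions on words; the product on
  \<open>'i free_monoid \<Rightarrow>\<^sub>0 'k\<close> is the convolution product. Those using only the letters in \<open>I\<close> form the
  free algebra on \<open>I\<close>.
\<close>

definition word :: "'i list \<Rightarrow> ('i free_monoid \<Rightarrow>\<^sub>0 'k::field)" where
  "word w = Poly_Mapping.single (Word w) 1"

definition const :: "'k::field \<Rightarrow> ('i free_monoid \<Rightarrow>\<^sub>0 'k)" where
  "const c = Poly_Mapping.single 0 c"

definition free_algebra :: "'i set \<Rightarrow> ('i free_monoid \<Rightarrow>\<^sub>0 'k::field) ring" where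
  "free_algebra I =
     \<lparr>carrier = {p. \<forall>w\<in>Poly_Mapping.keys p. set (letters w) \<subseteq> I},
      monoid.mult = (*), one = 1, ring.zero = 0, add = (+)\<rparr>"


section \<open>Generalized Clifford algebras\<close>

definition primitive_root :: "nat \<Rightarrow> 'k::field \<Rightarrow> bool" where
  "primitive_root n \<omega> \<longleftrightarrow> \<omega> ^ n = 1 \<and> (\<forall>d. 0 < d \<and> d < n \<longrightarrow> \<omega> ^ d \<noteq> 1)"

text \<open>The group of \<open>m\<close>-tuples \<open>(g\<^sub>1, \<dots>, g\<^sub>m)\<close> of residues modulo \<open>n\<close>, represented in \<open>{0..<n}\<close>.\<close>

definition Zn_power :: "nat \<Rightarrow> nat \<Rightarrow> (nat \<Rightarrow> int) monoid" where
  "Zn_power n m = product_group {1..m} (\<lambda>_. integer_mod_group n)"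

definition R_GCA :: "'k::field \<Rightarrow> nat \<Rightarrow> (nat \<Rightarrow> int) \<Rightarrow> (nat \<Rightarrow> int) \<Rightarrow> 'k" where
  "R_GCA \<omega> m g h = \<omega> powi (\<Sum>i\<in>{1..m}. \<Sum>j\<in>{1..<i}. g i * h j - g j * h i)"

definition gca_ideal ::
    "nat \<Rightarrow> 'k::field \<Rightarrow> (nat \<Rightarrow> 'k) \<Rightarrow> nat set \<Rightarrow> (nat free_monoid \<Rightarrow>\<^sub>0 'k) set" where
  "gca_ideal n \<omega> q I = Idl\<^bsub>free_algebra I\<^esub>
     ({word [i] ^ n - const (q i) | i. i \<in> I} \<union>
      {word [i] * word [j] - const \<omega> * (word [j] * word [i]) | i j. i \<in> I \<and> j \<in> I \<and> i > j})"

definition gca_class ::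
    "nat \<Rightarrow> 'k::field \<Rightarrow> (nat \<Rightarrow> 'k) \<Rightarrow> nat set \<Rightarrow>
     (nat free_monoid \<Rightarrow>\<^sub>0 'k) \<Rightarrow> (nat free_monoid \<Rightarrow>\<^sub>0 'k) set" where
  "gca_class n \<omega> q I p = gca_ideal n \<omega> q I +>\<^bsub>free_algebra I\<^esub> p"

text \<open>
  The word \<open>e\<^sub>i\<^sub>1\<^bsup>g i\<^sub>1\<^esup> \<cdots> e\<^sub>i\<^sub>r\<^bsup>g i\<^sub>r\<^esup>\<close>, where \<open>i\<^sub>1 < \<dots> < i\<^sub>r\<close> are the elements of \<open>I\<close>.
\<close>

definition ordered_monomial :: "nat set \<Rightarrow> (nat \<Rightarrow> int) \<Rightarrow> (nat free_monoid \<Rightarrow>\<^sub>0 'k::field)" where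
  "ordered_monomial I g =
     word (concat (map (\<lambda>i. replicate (nat (g i)) i) (sorted_list_of_set I)))"

text \<open>
  For \<open>I = {i\<^sub>1 < \<dots> < i\<^sub>r} \<subseteq> {1..m}\<close> this is the generalized Clifford algebra on the sublist
  \<open>q i\<^sub>1, \<dots>, q i\<^sub>r\<close> of \<open>q 1, \<dots>, q m\<close>. Generators keep their position in the full list as their name,
  so that the generator belonging to \<open>q i\<close> has degree the \<open>i\<close>-th standard generator; degrees not
  supported on \<open>I\<close> have zero component.
\<close>

definition gca ::
    "nat \<Rightarrow> 'k::field \<Rightarrow> nat \<Rightarrow> (nat \<Rightarrow> 'k) \<Rightarrow> nat set \<Rightarrow>
     ('k, nat \<Rightarrow> int, (nat free_monoid \<Rightarrow>\<^sub>0 'k) set) graded_alg" where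
  "gca n \<omega> m q I =
     (let Q = free_algebra I Quot gca_ideal n \<omega> q I; cls = gca_class n \<omega> q I in
     \<lparr>carrier = carrier Q, monoid.mult = monoid.mult Q, one = one Q, ring.zero = ring.zero Q, add = add Q,
      module.smult = (\<lambda>c x. cls (const c) \<otimes>\<^bsub>Q\<^esub> x),
      homog = (\<lambda>g. if \<forall>i\<in>{1..m} - I. g i = 0
                   then {cls (const c * ordered_monomial I g) | c. True}
                   else {cls 0})\<rparr>)"

end

theory Submission
  imports Defs
begin

text \<open>
  Let \<open>\<sigma>\<close> be the 2-cocycle on \<open>G = \<int>\<^sub>n\<^sup>m\<close> that records how ordered monomials multiply: a power of \<open>\<omega>\<close>
  from moving generators past each other and a factor \<open>q\<^sub>i\<close> for every carry in coordinate \<open>i\<close>. The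
  algebra on the generators \<open>I\<close> is the \<open>\<sigma>\<close>-twisted group algebra of the subgroup of tuples
  supported on \<open>I\<close>: evaluating words in the twisted group algebra kills the relations, words reduce
  to ordered monomials modulo the relations, and ordered monomials go to the standard basis.
  Since \<open>\<sigma>(h, g) = R(h, g) \<sigma>(g, h)\<close>, multiplication inside the twisted group algebra of \<open>G\<close> identifies
  the braided tensor product of two twisted group algebras on disjoint supports with the one on
  the union. Being isomorphic to such a model is invariant under isomorphism, so every iterated
  product is identified with the model on all generators.
\<close>


section \<open>Transport of graded algebra structures\<close>

text \<open>Both kinds of algebra are given by cosets, so none of the grading laws is at hand for
  them, and the binary product not even has known ring laws; yet \<open>graded_alg_iso\<close>
  demands all these laws on both sides. They are therefore verified once, in the twisted group
  algebra, where elements are plain functions. A quotient inherits them as soon as its classes are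
  known to be the fibres of an evaluation map. For both quotients the hard inclusion is that an
  element evaluating to zero is a consequence of the relations. It is settled by a spanning set
  (ordered monomials, or pairs of basis elements) whose images are nonzero multiples of distinct
  basis functions. Independence modulo the relations thus comes from the evaluation and requires no
  confluence argument. Keeping all models among the functions on one group also fixes the element
  type, which the binary product changes, and lets factors with different supports be multiplied in
  a single associative product.\<close>

lemma graded_algebraD:
  assumes "graded_algebra G (A :: ('k::field, 'g, 'a) graded_alg)"
  shows graded_algebra_ring: "ring A"
    and graded_algebra_module: "module (ring_of_type_algebra :: 'k ring) A"
    and graded_algebra_smult_mult: "\<And>c x y. x \<in> carrier A \<Longrightarrow> y \<in> carrier A \<Longrightarrow>
      (c \<odot>\<^bsub>A\<^esub> x) \<otimes>\<^bsub>A\<^esub> y = c \<odot>\<^bsub>A\<^esub> (x \<otimes>\<^bsub>A\<^esub> y)"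
    and graded_algebra_mult_smult: "\<And>c x y. x \<in> carrier A \<Longrightarrow> y \<in> carrier A \<Longrightarrow>
      x \<otimes>\<^bsub>A\<^esub> (c \<odot>\<^bsub>A\<^esub> y) = c \<odot>\<^bsub>A\<^esub> (x \<otimes>\<^bsub>A\<^esub> y)"
    and graded_algebra_homog_submodule:
      "\<And>g. g \<in> carrier G \<Longrightarrow> submodule (homog A g) (ring_of_type_algebra :: 'k ring) A"
    and graded_algebra_decomp: "\<And>a. a \<in> carrier A \<Longrightarrow>
      \<exists>!c. c \<in> (\<Pi>\<^sub>E g\<in>carrier G. homog A g) \<and> a = (\<Oplus>\<^bsub>A\<^esub>g\<in>carrier G. c g)"
    and graded_algebra_homog_mult: "\<And>g h a b. \<lbrakk>g \<in> carrier G; h \<in> carrier G; a \<in> homog A g; b \<in> homog A h\<rbrakk>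
      \<Longrightarrow> a \<otimes>\<^bsub>A\<^esub> b \<in> homog A (g \<otimes>\<^bsub>G\<^esub> h)"
    and graded_algebra_finite_span: "\<exists>S. finite S \<and> S \<subseteq> carrier A \<and>
        (\<forall>a\<in>carrier A. \<exists>c :: 'a \<Rightarrow> 'k. a = (\<Oplus>\<^bsub>A\<^esub>s\<in>S. c s \<odot>\<^bsub>A\<^esub> s))"
  using assms unfolding graded_algebra_def by blast+

lemma carrier_ring_of_type_algebra [simp]: "carrier ring_of_type_algebra = UNIV"
  by (simp add: ring_of_type_algebra_def)

lemma graded_algebra_smult_closed:
  assumes "graded_algebra G A" "x \<in> carrier A"
  shows "c \<odot>\<^bsub>A\<^esub> x \<in> carrier A"
  using module.smult_closed[OF graded_algebra_module[OF assms(1)]] assms(2) by simp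

lemma graded_algebra_homog_closed:
  assumes "graded_algebra G A" "g \<in> carrier G" "x \<in> homog A g"
  shows "x \<in> carrier A"
  using module.submoduleE(1)[OF graded_algebra_module[OF assms(1)]
      graded_algebra_homog_submodule[OF assms(1,2)]] assms(3) by blast

lemma graded_algebra_zero_homog:
  assumes "graded_algebra G A" "g \<in> carrier G"
  shows "\<zero>\<^bsub>A\<^esub> \<in> homog A g"
  using subgroup.one_closed[OF submodule.axioms(1)[OF graded_algebra_homog_submodule[OF assms]]]
  by simp

lemma additive_finsum:
  assumes A: "abelian_monoid A" and B: "abelian_monoid B"
    and f: "f \<in> carrier A \<rightarrow> carrier B" and zero: "f \<zero>\<^bsub>A\<^esub> = \<zero>\<^bsub>B\<^esub>"
    and add: "\<And>x y. x \<in> carrier A \<Longrightarrow> y \<in> carrier A \<Longrightarrow> f (x \<oplus>\<^bsub>A\<^esub> y) = f x \<oplus>\<^bsub>B\<^esub> f y"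
    and s: "s \<in> S \<rightarrow> carrier A"
  shows "f (\<Oplus>\<^bsub>A\<^esub>x\<in>S. s x) = (\<Oplus>\<^bsub>B\<^esub>x\<in>S. f (s x))"
proof -
  interpret A: abelian_monoid A by fact
  interpret B: abelian_monoid B by fact
  show ?thesis
  proof (cases "finite S")
    case True
    then show ?thesis using s
    proof (induction S)
      case empty
      then show ?case by (simp add: zero)
    next
      case (insert x S)
      have "(\<lambda>y. f (s y)) \<in> S \<rightarrow> carrier B" "f (s x) \<in> carrier B"
        using insert.prems f by auto
      with insert show ?case by (simp add: Pi_iff add)
    qed
  next
    case False
    then show ?thesis by (simp add: A.finsum_infinite B.finsum_infinite zero)
  qed
qed

text \<open>
  The laws of a graded algebra are assumed for \<open>B\<close> only; those of \<open>A\<close> are pulled back along \<open>f\<close>.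
\<close>

locale graded_transfer =
  fixes G :: "('g, 'x) monoid_scheme" and A :: "('k::field, 'g, 'a) graded_alg"
    and B :: "('k, 'g, 'b) graded_alg" and f :: "'a \<Rightarrow> 'b"
  assumes monoid_G: "Group.monoid G" and graded_B: "graded_algebra G B"
    and bij: "bij_betw f (carrier A) (carrier B)"
    and zero_closed: "\<zero>\<^bsub>A\<^esub> \<in> carrier A" and one_closed: "\<one>\<^bsub>A\<^esub> \<in> carrier A"
    and add_closed: "\<And>x y. x \<in> carrier A \<Longrightarrow> y \<in> carrier A \<Longrightarrow> x \<oplus>\<^bsub>A\<^esub> y \<in> carrier A"
    and mult_closed: "\<And>x y. x \<in> carrier A \<Longrightarrow> y \<in> carrier A \<Longrightarrow> x \<otimes>\<^bsub>A\<^esub> y \<in> carrier A"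
    and smult_closed: "\<And>c x. x \<in> carrier A \<Longrightarrow> c \<odot>\<^bsub>A\<^esub> x \<in> carrier A"
    and zero: "f \<zero>\<^bsub>A\<^esub> = \<zero>\<^bsub>B\<^esub>" and one: "f \<one>\<^bsub>A\<^esub> = \<one>\<^bsub>B\<^esub>"
    and add: "\<And>x y. x \<in> carrier A \<Longrightarrow> y \<in> carrier A \<Longrightarrow> f (x \<oplus>\<^bsub>A\<^esub> y) = f x \<oplus>\<^bsub>B\<^esub> f y"
    and mult: "\<And>x y. x \<in> carrier A \<Longrightarrow> y \<in> carrier A \<Longrightarrow> f (x \<otimes>\<^bsub>A\<^esub> y) = f x \<otimes>\<^bsub>B\<^esub> f y"
    and smult: "\<And>c x. x \<in> carrier A \<Longrightarrow> f (c \<odot>\<^bsub>A\<^esub> x) = c \<odot>\<^bsub>B\<^esub> f x"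
    and homog_subset: "\<And>g. g \<in> carrier G \<Longrightarrow> homog A g \<subseteq> carrier A"
    and homog_image: "\<And>g. g \<in> carrier G \<Longrightarrow> f ` homog A g = homog B g"
begin

interpretation B: ring B by (rule graded_algebra_ring[OF graded_B])
interpretation BM: module "ring_of_type_algebra :: 'k ring" B by (rule graded_algebra_module[OF graded_B])

lemma image_closed: "x \<in> carrier A \<Longrightarrow> f x \<in> carrier B"
  using bij bij_betwE by blast

lemma eq_iff: "x \<in> carrier A \<Longrightarrow> y \<in> carrier A \<Longrightarrow> x = y \<longleftrightarrow> f x = f y"
  using bij by (auto simp: bij_betw_def inj_on_def)

lemma preimage: "y \<in> carrier B \<Longrightarrow> \<exists>x\<in>carrier A. f x = y"
  using bij bij_betw_imp_surj_on by (metis imageE)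

lemma homog_iff:
  assumes "g \<in> carrier G" "x \<in> carrier A"
  shows "x \<in> homog A g \<longleftrightarrow> f x \<in> homog B g"
proof
  show "f x \<in> homog B g" if "x \<in> homog A g" using homog_image[OF assms(1)] that by blast
next
  assume "f x \<in> homog B g"
  then obtain y where "y \<in> homog A g" "f y = f x"
    using homog_image[OF assms(1)] by (metis imageE)
  then show "x \<in> homog A g" using eq_iff assms homog_subset by blast
qed

text \<open>How a law reaches \<open>A\<close>: \<open>eq_iff\<close> replaces an equation in
  \<open>A\<close> by its image under \<open>f\<close>, \<open>hom\<close> pushes \<open>f\<close>
  through the operations, \<open>closed\<close> settles the membership conditions, and the same law
  in \<open>B\<close> is left.\<close>

lemmas closed = zero_closed one_closed add_closed mult_closed smult_closed image_closed
lemmas hom = zero one add mult smult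

lemma abelian_group: "abelian_group A"
proof (rule abelian_groupI)
  fix x assume x: "x \<in> carrier A"
  obtain y where "y \<in> carrier A" "f y = \<ominus>\<^bsub>B\<^esub> f x"
    using preimage[of "\<ominus>\<^bsub>B\<^esub> f x"] x image_closed by auto
  then show "\<exists>y\<in>carrier A. y \<oplus>\<^bsub>A\<^esub> x = \<zero>\<^bsub>A\<^esub>"
    using x by (intro bexI[of _ y]) (simp_all add: eq_iff closed hom B.l_neg)
qed (simp_all add: eq_iff closed hom B.a_ac)

lemma ring: "ring A"
  by (rule ringI[OF abelian_group monoidI])
    (simp_all add: eq_iff closed hom B.m_assoc B.l_distr B.r_distr)

lemma module: "module (ring_of_type_algebra :: 'k ring) A"
  by (rule moduleI[OF _ abelian_group])
    (use cring_from_type_algebra in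
      \<open>simp_all add: eq_iff closed hom BM.smult_l_distr BM.smult_r_distr BM.smult_assoc1\<close>)

lemma finsum: "s \<in> S \<rightarrow> carrier A \<Longrightarrow> f (\<Oplus>\<^bsub>A\<^esub>x\<in>S. s x) = (\<Oplus>\<^bsub>B\<^esub>x\<in>S. f (s x))"
  by (rule additive_finsum[OF abelian_group.axioms(1)[OF abelian_group] B.abelian_monoid_axioms])
    (auto simp: closed hom)

lemma finsum_closed: "s \<in> S \<rightarrow> carrier A \<Longrightarrow> (\<Oplus>\<^bsub>A\<^esub>x\<in>S. s x) \<in> carrier A"
  by (rule abelian_monoid.finsum_closed[OF abelian_group.axioms(1)[OF abelian_group]])

lemma finite_span:
  "\<exists>S. finite S \<and> S \<subseteq> carrier A \<and> (\<forall>a\<in>carrier A. \<exists>c :: 'a \<Rightarrow> 'k. a = (\<Oplus>\<^bsub>A\<^esub>s\<in>S. c s \<odot>\<^bsub>A\<^esub> s))"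
proof -
  obtain S where S: "finite S" "S \<subseteq> carrier B"
    "\<And>a. a \<in> carrier B \<Longrightarrow> \<exists>c :: 'b \<Rightarrow> 'k. a = (\<Oplus>\<^bsub>B\<^esub>s\<in>S. c s \<odot>\<^bsub>B\<^esub> s)"
    using graded_algebra_finite_span[OF graded_B] by blast
  define S' where "S' = {x \<in> carrier A. f x \<in> S}"
  have bij': "bij_betw f S' S"
    using bij S(2) unfolding S'_def bij_betw_def inj_on_def by auto
  show ?thesis
  proof (intro exI[of _ S'] conjI ballI)
    show "finite S'" using bij' S(1) bij_betw_finite by blast
    show "S' \<subseteq> carrier A" by (auto simp: S'_def)
    fix a assume a: "a \<in> carrier A"
    obtain c where c: "f a = (\<Oplus>\<^bsub>B\<^esub>s\<in>S. c s \<odot>\<^bsub>B\<^esub> s)" using S(3) image_closed[OF a] by blast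
    have *: "(\<lambda>s. c (f s) \<odot>\<^bsub>A\<^esub> s) \<in> S' \<rightarrow> carrier A" by (auto simp: S'_def closed)
    have "f (\<Oplus>\<^bsub>A\<^esub>s\<in>S'. c (f s) \<odot>\<^bsub>A\<^esub> s) = (\<Oplus>\<^bsub>B\<^esub>s\<in>S'. f (c (f s) \<odot>\<^bsub>A\<^esub> s))"
      by (rule finsum[OF *])
    also have "\<dots> = (\<Oplus>\<^bsub>B\<^esub>s\<in>S'. c (f s) \<odot>\<^bsub>B\<^esub> f s)"
      by (rule B.add.finprod_cong') (auto simp: S'_def closed hom BM.smult_closed)
    also have "\<dots> = (\<Oplus>\<^bsub>B\<^esub>s\<in>f ` S'. c s \<odot>\<^bsub>B\<^esub> s)"
      by (rule B.finsum_reindex[symmetric])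
        (use bij' S(2) in \<open>auto simp: bij_betw_def subset_iff BM.smult_closed\<close>)
    also have "\<dots> = f a" using bij' c by (simp add: bij_betw_def)
    finally show "\<exists>c. a = (\<Oplus>\<^bsub>A\<^esub>s\<in>S'. c s \<odot>\<^bsub>A\<^esub> s)"
      using eq_iff[OF a finsum_closed[OF *]] by metis
  qed
qed

lemma decomp:
  assumes a: "a \<in> carrier A"
  shows "\<exists>!c. c \<in> (\<Pi>\<^sub>E g\<in>carrier G. homog A g) \<and> a = (\<Oplus>\<^bsub>A\<^esub>g\<in>carrier G. c g)"
proof -
  obtain d where d: "d \<in> (\<Pi>\<^sub>E g\<in>carrier G. homog B g)" "f a = (\<Oplus>\<^bsub>B\<^esub>g\<in>carrier G. d g)"
    and d_uniq: "\<And>e. e \<in> (\<Pi>\<^sub>E g\<in>carrier G. homog B g) \<Longrightarrow> f a = (\<Oplus>\<^bsub>B\<^esub>g\<in>carrier G. e g) \<Longrightarrow> e = d"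
    using graded_algebra_decomp[OF graded_B image_closed[OF a]] by metis
  have Pi_carrier: "c \<in> carrier G \<rightarrow> carrier A" if "c \<in> (\<Pi>\<^sub>E g\<in>carrier G. homog A g)" for c
    using that homog_subset by (auto simp: PiE_iff)
  have f_finsum: "f (\<Oplus>\<^bsub>A\<^esub>g\<in>carrier G. c g) = (\<Oplus>\<^bsub>B\<^esub>g\<in>carrier G. restrict (f \<circ> c) (carrier G) g)"
    if "c \<in> (\<Pi>\<^sub>E g\<in>carrier G. homog A g)" for c
    unfolding finsum[OF Pi_carrier[OF that]]
    by (rule B.add.finprod_cong') (use Pi_carrier[OF that] in \<open>auto simp: Pi_iff closed\<close>)
  \<comment> \<open>\<open>f\<close> carries any decomposition of \<open>a\<close> to one of
    \<open>f a\<close>. Restricting makes the image extensional, as \<open>PiE\<close> requires, so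
    that uniqueness in \<open>B\<close> applies.\<close>
  have f_c: "restrict (f \<circ> c) (carrier G) = d"
    if c: "c \<in> (\<Pi>\<^sub>E g\<in>carrier G. homog A g)" "a = (\<Oplus>\<^bsub>A\<^esub>g\<in>carrier G. c g)" for c
  proof (rule d_uniq)
    show "restrict (f \<circ> c) (carrier G) \<in> (\<Pi>\<^sub>E g\<in>carrier G. homog B g)"
      using c(1) homog_image by (auto simp: PiE_iff)
    show "f a = (\<Oplus>\<^bsub>B\<^esub>g\<in>carrier G. restrict (f \<circ> c) (carrier G) g)"
      using f_finsum c by simp
  qed
  have "\<exists>x\<in>homog A g. f x = d g" if "g \<in> carrier G" for g
    using homog_image[OF that] d(1) that by (metis PiE_mem imageE)
  then obtain c where c: "\<And>g. g \<in> carrier G \<Longrightarrow> c g \<in> homog A g \<and> f (c g) = d g" by metis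
  define c' where "c' = restrict c (carrier G)"
  have c': "c' \<in> (\<Pi>\<^sub>E g\<in>carrier G. homog A g)" using c by (auto simp: c'_def)
  have "restrict (f \<circ> c') (carrier G) = d"
    using d(1) c by (auto simp: c'_def PiE_iff extensional_def fun_eq_iff)
  with f_finsum[OF c'] d(2) have "f a = f (\<Oplus>\<^bsub>A\<^esub>g\<in>carrier G. c' g)" by simp
  then have "a = (\<Oplus>\<^bsub>A\<^esub>g\<in>carrier G. c' g)"
    using eq_iff a finsum_closed[OF Pi_carrier[OF c']] by blast
  with c' show ?thesis
  proof (intro ex1I[of _ c'] conjI; (elim conjE)?)
    fix e assume e: "e \<in> (\<Pi>\<^sub>E g\<in>carrier G. homog A g)" "a = (\<Oplus>\<^bsub>A\<^esub>g\<in>carrier G. e g)"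
    have "e g = c' g" if "g \<in> carrier G" for g
    proof -
      have "f (e g) = f (c' g)"
        using fun_cong[OF f_c[OF e], of g] that c by (simp add: c'_def)
      then show ?thesis
        using eq_iff Pi_carrier[OF e(1)] Pi_carrier[OF c'] that by (meson Pi_mem)
    qed
    then show "e = c'"
      by (rule PiE_ext[OF e(1) c'])
  qed
qed

lemma graded_A: "graded_algebra G A"
  unfolding graded_algebra_def
proof (intro conjI allI ballI)
  show "ring A" "module (ring_of_type_algebra :: 'k ring) A" by (fact ring module)+
  fix c x y assume "x \<in> carrier A" "y \<in> carrier A"
  then show "(c \<odot>\<^bsub>A\<^esub> x) \<otimes>\<^bsub>A\<^esub> y = c \<odot>\<^bsub>A\<^esub> (x \<otimes>\<^bsub>A\<^esub> y)" "x \<otimes>\<^bsub>A\<^esub> (c \<odot>\<^bsub>A\<^esub> y) = c \<odot>\<^bsub>A\<^esub> (x \<otimes>\<^bsub>A\<^esub> y)"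
    by (simp_all add: eq_iff closed hom graded_algebra_smult_mult[OF graded_B]
        graded_algebra_mult_smult[OF graded_B])
next
  fix g assume g: "g \<in> carrier G"
  interpret A: module "ring_of_type_algebra :: 'k ring" A by (rule module)
  have sub: "submodule (homog B g) (ring_of_type_algebra :: 'k ring) B"
    by (rule graded_algebra_homog_submodule[OF graded_B g])
  have carr: "x \<in> carrier A" if "x \<in> homog A g" for x using that homog_subset[OF g] by blast
  show "submodule (homog A g) (ring_of_type_algebra :: 'k ring) A"
  proof (rule A.submoduleI)
    show "homog A g \<subseteq> carrier A" by (rule homog_subset[OF g])
    show "\<zero>\<^bsub>A\<^esub> \<in> homog A g"
      using g by (simp add: homog_iff closed hom graded_algebra_zero_homog[OF graded_B])
    show "c \<odot>\<^bsub>A\<^esub> x \<in> homog A g" if "x \<in> homog A g" for c x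
      using homog_iff[OF g smult_closed[OF carr[OF that]]] homog_iff[OF g carr[OF that]] that
        BM.submoduleE(4)[OF sub, of c "f x"] smult[OF carr[OF that]] by simp
    show "x \<oplus>\<^bsub>A\<^esub> y \<in> homog A g" if "x \<in> homog A g" "y \<in> homog A g" for x y
      using homog_iff[OF g add_closed[OF carr carr, OF that]] homog_iff[OF g carr[OF that(1)]]
        homog_iff[OF g carr[OF that(2)]] that add[OF carr carr, OF that]
        BM.submoduleE(5)[OF sub, of "f x" "f y"] by simp
    show "\<ominus>\<^bsub>A\<^esub> x \<in> homog A g" if x: "x \<in> homog A g" for x
    proof -
      \<comment> \<open>Compatibility with negation is not among the locale assumptions; it follows
        from additivity and uniqueness of inverses in \<open>B\<close>.\<close>
      have "f (\<ominus>\<^bsub>A\<^esub> x) \<oplus>\<^bsub>B\<^esub> f x = \<zero>\<^bsub>B\<^esub>"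
        using carr[OF x] by (simp flip: add zero add: A.l_neg)
      then have "f (\<ominus>\<^bsub>A\<^esub> x) = \<ominus>\<^bsub>B\<^esub> f x"
        using carr[OF x] by (metis A.a_inv_closed B.minus_equality image_closed)
      then show ?thesis
        using x carr[OF x] g BM.submoduleE(3)[OF sub] by (simp add: homog_iff)
    qed
  qed
next
  fix g h a b assume gh: "g \<in> carrier G" "h \<in> carrier G" and ab: "a \<in> homog A g" "b \<in> homog A h"
  have carr: "a \<in> carrier A" "b \<in> carrier A"
    using ab homog_subset[OF gh(1)] homog_subset[OF gh(2)] by blast+
  have "f a \<otimes>\<^bsub>B\<^esub> f b \<in> homog B (g \<otimes>\<^bsub>G\<^esub> h)"
    using ab homog_image[OF gh(1)] homog_image[OF gh(2)]
    by (intro graded_algebra_homog_mult[OF graded_B gh]) blast+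
  then have "f (a \<otimes>\<^bsub>A\<^esub> b) \<in> homog B (g \<otimes>\<^bsub>G\<^esub> h)" "a \<otimes>\<^bsub>A\<^esub> b \<in> carrier A"
    by (simp_all add: carr closed hom)
  moreover have "g \<otimes>\<^bsub>G\<^esub> h \<in> carrier G"
    by (rule monoid.m_closed[OF monoid_G gh])
  ultimately show "a \<otimes>\<^bsub>A\<^esub> b \<in> homog A (g \<otimes>\<^bsub>G\<^esub> h)"
    by (simp add: homog_iff)
qed (fact finite_span decomp)+

lemma graded_iso: "graded_alg_iso G A B"
  unfolding graded_alg_iso_def
proof (intro conjI bexI[of _ f] allI ballI)
  show "f \<in> ring_iso A B"
    by (rule ring_iso_memI) (simp_all add: closed hom bij)
qed (use graded_A graded_B smult homog_image in auto)

end

section \<open>Isomorphism of graded algebras as an equivalence relation\<close>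

lemma ex1_implies_unique: "\<exists>!x. P x \<Longrightarrow> P x \<Longrightarrow> P y \<Longrightarrow> x = y"
  by blast

text \<open>An isomorphism is only required to map each component into the component of the same
  degree, whereas \<open>graded_transfer\<close> needs equality. Equality is automatic: the images
  of the components of a preimage of \<open>y\<close> decompose \<open>y\<close>, and by uniqueness
  this must be the decomposition concentrated in the degree of \<open>y\<close>.\<close>

lemma graded_alg_isoE:
  assumes "Group.monoid G" "graded_alg_iso G A B"
  obtains f where "graded_transfer G A B f"
proof -
  from assms(2) obtain f where A: "graded_algebra G A" and B: "graded_algebra G B"
    and f: "f \<in> ring_iso A B"
    and smult: "\<And>c a. a \<in> carrier A \<Longrightarrow> f (c \<odot>\<^bsub>A\<^esub> a) = c \<odot>\<^bsub>B\<^esub> f a"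
    and homog: "\<And>g. g \<in> carrier G \<Longrightarrow> f ` homog A g \<subseteq> homog B g"
    unfolding graded_alg_iso_def by blast
  interpret A: ring A by (rule graded_algebra_ring[OF A])
  interpret B: ring B by (rule graded_algebra_ring[OF B])
  have f_closed: "x \<in> carrier A \<Longrightarrow> f x \<in> carrier B" for x
    using ring_iso_memE(1)[OF f] .
  have add: "x \<in> carrier A \<Longrightarrow> y \<in> carrier A \<Longrightarrow> f (x \<oplus>\<^bsub>A\<^esub> y) = f x \<oplus>\<^bsub>B\<^esub> f y" for x y
    using ring_iso_memE(3)[OF f] .
  have zero: "f \<zero>\<^bsub>A\<^esub> = \<zero>\<^bsub>B\<^esub>"
  proof -
    have "f \<zero>\<^bsub>A\<^esub> \<oplus>\<^bsub>B\<^esub> f \<zero>\<^bsub>A\<^esub> = f \<zero>\<^bsub>A\<^esub>" using add[of "\<zero>\<^bsub>A\<^esub>" "\<zero>\<^bsub>A\<^esub>"] by simp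
    then show ?thesis using f_closed[of "\<zero>\<^bsub>A\<^esub>"] by simp
  qed
  have bij: "bij_betw f (carrier A) (carrier B)" using ring_iso_memE(5)[OF f] .
  have onto: "homog B g \<subseteq> f ` homog A g" if g: "g \<in> carrier G" for g
  proof
    fix y assume y: "y \<in> homog B g"
    have yB: "y \<in> carrier B" by (rule graded_algebra_homog_closed[OF B g y])
    then obtain x where x: "x \<in> carrier A" "f x = y"
      using bij bij_betw_imp_surj_on by (metis imageE)
    obtain c where c: "c \<in> (\<Pi>\<^sub>E g\<in>carrier G. homog A g)" "x = (\<Oplus>\<^bsub>A\<^esub>g\<in>carrier G. c g)"
      using graded_algebra_decomp[OF A x(1)] by blast
    have cA: "c \<in> carrier G \<rightarrow> carrier A"
      using c(1) graded_algebra_homog_closed[OF A] by (auto simp: PiE_iff)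
    define d where "d = restrict (f \<circ> c) (carrier G)"
    have dB: "d \<in> carrier G \<rightarrow> carrier B" using cA f_closed by (auto simp: d_def Pi_iff)
    have d: "d \<in> (\<Pi>\<^sub>E g\<in>carrier G. homog B g)"
      using c(1) homog by (auto simp: d_def PiE_iff)
    have y_sum: "y = (\<Oplus>\<^bsub>B\<^esub>g\<in>carrier G. d g)"
    proof -
      have "y = (\<Oplus>\<^bsub>B\<^esub>g\<in>carrier G. f (c g))"
        unfolding x(2)[symmetric] c(2)
        by (rule additive_finsum[OF A.abelian_monoid_axioms B.abelian_monoid_axioms _ zero add cA])
          (simp_all add: f_closed)
      also have "\<dots> = (\<Oplus>\<^bsub>B\<^esub>g\<in>carrier G. d g)"
        by (rule B.add.finprod_cong') (use cA f_closed in \<open>auto simp: d_def Pi_iff\<close>)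
      finally show ?thesis .
    qed
    show "y \<in> f ` homog A g"
    proof (cases "finite (carrier G)")
      \<comment> \<open>A \<open>finsum\<close> over an infinite set is zero by convention, so here
        \<open>y\<close> is zero and zero is a homogeneous preimage.\<close>
      case False
      then have "y = f \<zero>\<^bsub>A\<^esub>" unfolding y_sum zero by (rule B.add.finprod_infinite)
      then show ?thesis using graded_algebra_zero_homog[OF A g] by blast
    next
      case True
      \<comment> \<open>The decomposition of \<open>y\<close> concentrated in degree
        \<open>g\<close>, to be compared with \<open>d\<close>.\<close>
      define e where "e = (\<lambda>h\<in>carrier G. if h = g then y else \<zero>\<^bsub>B\<^esub>)"
      have "e \<in> (\<Pi>\<^sub>E g\<in>carrier G. homog B g)"
        using y graded_algebra_zero_homog[OF B] by (auto simp: e_def)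
      moreover have "y = (\<Oplus>\<^bsub>B\<^esub>g\<in>carrier G. e g)"
      proof -
        have "(\<Oplus>\<^bsub>B\<^esub>h\<in>carrier G. e h) = (\<Oplus>\<^bsub>B\<^esub>h\<in>carrier G. if g = h then y else \<zero>\<^bsub>B\<^esub>)"
          by (rule B.add.finprod_cong') (use yB in \<open>auto simp: e_def\<close>)
        also have "\<dots> = y"
          using B.add.finprod_singleton[OF g True, of "\<lambda>_. y"] yB by simp
        finally show ?thesis by simp
      qed
      ultimately have "d = e"
        using d y_sum ex1_implies_unique[OF graded_algebra_decomp[OF B yB]] by blast
      then have "d g = e g" by simp
      then have "f (c g) = y" using g by (simp add: d_def e_def)
      moreover have "c g \<in> homog A g" using c(1) g by (rule PiE_mem)
      ultimately show ?thesis by blast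
    qed
  qed
  have "graded_transfer G A B f"
  proof (rule graded_transfer.intro)
    show "f ` homog A g = homog B g" if "g \<in> carrier G" for g
      using homog[OF that] onto[OF that] by (rule equalityI)
    show "homog A g \<subseteq> carrier A" if "g \<in> carrier G" for g
      using graded_algebra_homog_closed[OF A that] by (rule subsetI)
  qed (simp_all add: assms(1) B bij add zero smult ring_iso_memE(2,4)[OF f]
      graded_algebra_smult_closed[OF A])
  then show ?thesis by (rule that)
qed

text \<open>The inverse respects degrees because \<open>graded_alg_isoE\<close> upgrades inclusion
  of components to equality.\<close>

lemma graded_alg_iso_sym:
  assumes G: "Group.monoid G" and iso: "graded_alg_iso G A B"
  shows "graded_alg_iso G B A"
proof -
  obtain f where "graded_transfer G A B f" by (rule graded_alg_isoE[OF assms])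
  then interpret graded_transfer G A B f .
  interpret A: ring A by (rule ring)
  define f' where "f' = inv_into (carrier A) f"
  have f': "y \<in> carrier B \<Longrightarrow> f' y \<in> carrier A \<and> f (f' y) = y" for y
    unfolding f'_def using bij by (metis bij_betw_imp_surj_on f_inv_into_f inv_into_into)
  have f'f: "x \<in> carrier A \<Longrightarrow> f' (f x) = x" for x
    unfolding f'_def using bij by (simp add: bij_betw_def)
  interpret B: ring B by (rule graded_algebra_ring[OF graded_B])
  have "graded_transfer G B A f'"
  proof (rule graded_transfer.intro)
    show "bij_betw f' (carrier B) (carrier A)" unfolding f'_def by (rule bij_betw_inv_into[OF bij])
    show "f' ` homog B g = homog A g" "homog B g \<subseteq> carrier B" if "g \<in> carrier G" for g
    proof -
      have "f' ` (f ` homog A g) = homog A g"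
        unfolding image_image using homog_subset[OF that] f'f by (simp add: subset_iff)
      then show "f' ` homog B g = homog A g" by (simp only: homog_image[OF that])
      show "homog B g \<subseteq> carrier B"
        using graded_algebra_homog_closed[OF graded_B that] by blast
    qed
  qed (use G graded_A f' graded_algebra_smult_closed[OF graded_B] in
        \<open>auto simp: eq_iff closed hom\<close>)
  then show ?thesis by (rule graded_transfer.graded_iso)
qed

lemma graded_alg_iso_trans:
  assumes "graded_alg_iso G A B" "graded_alg_iso G B C"
  shows "graded_alg_iso G A C"
proof -
  obtain f where f: "f \<in> ring_iso A B" "\<And>c a. a \<in> carrier A \<Longrightarrow> f (c \<odot>\<^bsub>A\<^esub> a) = c \<odot>\<^bsub>B\<^esub> f a"
    "\<And>g. g \<in> carrier G \<Longrightarrow> f ` homog A g \<subseteq> homog B g"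
    using assms(1) unfolding graded_alg_iso_def by blast
  obtain f' where f': "f' \<in> ring_iso B C" "\<And>c a. a \<in> carrier B \<Longrightarrow> f' (c \<odot>\<^bsub>B\<^esub> a) = c \<odot>\<^bsub>C\<^esub> f' a"
    "\<And>g. g \<in> carrier G \<Longrightarrow> f' ` homog B g \<subseteq> homog C g"
    using assms(2) unfolding graded_alg_iso_def by blast
  show ?thesis
    unfolding graded_alg_iso_def
  proof (intro conjI bexI[of _ "f' \<circ> f"] allI ballI)
    show "f' \<circ> f \<in> ring_iso A C" by (rule ring_iso_set_trans[OF f(1) f'(1)])
    fix c a assume "a \<in> carrier A"
    then show "(f' \<circ> f) (c \<odot>\<^bsub>A\<^esub> a) = c \<odot>\<^bsub>C\<^esub> (f' \<circ> f) a"
      using f(2) f'(2) ring_iso_memE(1)[OF f(1)] by simp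
  next
    fix g assume g: "g \<in> carrier G"
    show "(f' \<circ> f) ` homog A g \<subseteq> homog C g"
      unfolding image_comp[symmetric] using image_mono[OF f(3)[OF g]] f'(3)[OF g] by (rule order_trans)
  next
    show "graded_algebra G A" "graded_algebra G C"
      using assms unfolding graded_alg_iso_def by blast+
  qed
qed

text \<open>
  First isomorphism theorem: \<open>P\<close> is a set of representatives of the elements \<open>cls p\<close> of \<open>A\<close>, and
  \<open>F\<close> is a surjection onto \<open>B\<close> with the same fibres as \<open>cls\<close>.
\<close>

lemma graded_alg_iso_quotient:
  fixes G :: "('g, 'x) monoid_scheme" and A :: "('k::field, 'g, 'a) graded_alg"
    and B :: "('k, 'g, 'b) graded_alg" and cls :: "'p \<Rightarrow> 'a" and F :: "'p \<Rightarrow> 'b"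
  assumes G: "Group.monoid G" and B: "graded_algebra G B"
    and carrier: "carrier A = cls ` P" and surj: "F ` P = carrier B"
    and fibres: "\<And>p q. p \<in> P \<Longrightarrow> q \<in> P \<Longrightarrow> cls p = cls q \<longleftrightarrow> F p = F q"
    and zero: "\<exists>r\<in>P. \<zero>\<^bsub>A\<^esub> = cls r \<and> F r = \<zero>\<^bsub>B\<^esub>"
    and one: "\<exists>r\<in>P. \<one>\<^bsub>A\<^esub> = cls r \<and> F r = \<one>\<^bsub>B\<^esub>"
    and add: "\<And>p q. p \<in> P \<Longrightarrow> q \<in> P \<Longrightarrow> \<exists>r\<in>P. cls p \<oplus>\<^bsub>A\<^esub> cls q = cls r \<and> F r = F p \<oplus>\<^bsub>B\<^esub> F q"
    and mult: "\<And>p q. p \<in> P \<Longrightarrow> q \<in> P \<Longrightarrow> \<exists>r\<in>P. cls p \<otimes>\<^bsub>A\<^esub> cls q = cls r \<and> F r = F p \<otimes>\<^bsub>B\<^esub> F q"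
    and smult: "\<And>c p. p \<in> P \<Longrightarrow> \<exists>r\<in>P. c \<odot>\<^bsub>A\<^esub> cls p = cls r \<and> F r = c \<odot>\<^bsub>B\<^esub> F p"
    and homog: "\<And>g. g \<in> carrier G \<Longrightarrow> \<exists>H\<subseteq>P. homog A g = cls ` H \<and> F ` H = homog B g"
  shows "graded_alg_iso G A B"
proof -
  define f where "f x = F (SOME p. p \<in> P \<and> cls p = x)" for x
  have f: "f (cls p) = F p" if "p \<in> P" for p
  proof -
    let ?Q = "\<lambda>q. q \<in> P \<and> cls q = cls p"
    have "?Q (Eps ?Q)" using that by (intro someI[where P = ?Q and x = p]) simp
    then have "F (Eps ?Q) = F p" using fibres[of "Eps ?Q" p] that by simp
    then show ?thesis by (simp add: f_def)
  qed
  have "graded_transfer G A B f"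
  proof (rule graded_transfer.intro)
    show "bij_betw f (carrier A) (carrier B)"
      unfolding bij_betw_def inj_on_def carrier surj[symmetric]
      using fibres by (simp add: f image_image)
    \<comment> \<open>One witness \<open>r\<close> yields both facts needed about an operation: its
      result is again a class, and \<open>f\<close> sends it to the right element.\<close>
    have closed_hom: "x \<in> carrier A \<and> f x = y" if "\<exists>r\<in>P. x = cls r \<and> F r = y" for x y
      using that f unfolding carrier by blast
    show "\<zero>\<^bsub>A\<^esub> \<in> carrier A" "f \<zero>\<^bsub>A\<^esub> = \<zero>\<^bsub>B\<^esub>" using closed_hom[OF zero] by simp_all
    show "\<one>\<^bsub>A\<^esub> \<in> carrier A" "f \<one>\<^bsub>A\<^esub> = \<one>\<^bsub>B\<^esub>" using closed_hom[OF one] by simp_all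
    show "x \<oplus>\<^bsub>A\<^esub> y \<in> carrier A" "f (x \<oplus>\<^bsub>A\<^esub> y) = f x \<oplus>\<^bsub>B\<^esub> f y"
      "x \<otimes>\<^bsub>A\<^esub> y \<in> carrier A" "f (x \<otimes>\<^bsub>A\<^esub> y) = f x \<otimes>\<^bsub>B\<^esub> f y"
      if xy: "x \<in> carrier A" "y \<in> carrier A" for x y
    proof -
      obtain p q where pq: "p \<in> P" "q \<in> P" "x = cls p" "y = cls q"
        using xy unfolding carrier by blast
      show "x \<oplus>\<^bsub>A\<^esub> y \<in> carrier A" "f (x \<oplus>\<^bsub>A\<^esub> y) = f x \<oplus>\<^bsub>B\<^esub> f y"
        using closed_hom[OF add[OF pq(1,2)]] pq f by simp_all
      show "x \<otimes>\<^bsub>A\<^esub> y \<in> carrier A" "f (x \<otimes>\<^bsub>A\<^esub> y) = f x \<otimes>\<^bsub>B\<^esub> f y"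
        using closed_hom[OF mult[OF pq(1,2)]] pq f by simp_all
    qed
    show "c \<odot>\<^bsub>A\<^esub> x \<in> carrier A" "f (c \<odot>\<^bsub>A\<^esub> x) = c \<odot>\<^bsub>B\<^esub> f x" if x: "x \<in> carrier A" for c x
    proof -
      obtain p where p: "p \<in> P" "x = cls p" using x unfolding carrier by blast
      show "c \<odot>\<^bsub>A\<^esub> x \<in> carrier A" "f (c \<odot>\<^bsub>A\<^esub> x) = c \<odot>\<^bsub>B\<^esub> f x"
        using closed_hom[OF smult[OF p(1), of c]] f[OF p(1)] unfolding p(2) by simp_all
    qed
    fix g assume g: "g \<in> carrier G"
    obtain H where H: "H \<subseteq> P" "homog A g = cls ` H" "F ` H = homog B g"
      using homog[OF g] by (elim exE conjE)
    show "homog A g \<subseteq> carrier A" unfolding H(2) carrier using H(1) by (rule image_mono)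
    have "f (cls p) = F p" if "p \<in> H" for p using f H(1) that by blast
    then show "f ` homog A g = homog B g" unfolding H(2) image_image H(3)[symmetric]
      by (rule image_cong[OF refl])
  qed (fact G B)+
  then show ?thesis by (rule graded_transfer.graded_iso)
qed

section \<open>Twisted group algebras\<close>

text \<open>Convolution determined by \<open>e_g e_h = \<sigma>(g,h) e_(gh)\<close>. An indicator
  replaces the substitution of \<open>g^(-1) k\<close> for \<open>h\<close>, so bilinearity and
  exchanges of sums involve no inverses.\<close>

definition twisted_mult ::
    "('g, 'x) monoid_scheme \<Rightarrow> ('g \<Rightarrow> 'g \<Rightarrow> 'k::field) \<Rightarrow> ('g \<Rightarrow> 'k) \<Rightarrow> ('g \<Rightarrow> 'k) \<Rightarrow> 'g \<Rightarrow> 'k" where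
  "twisted_mult G \<sigma> f f' = (\<lambda>k. \<Sum>g\<in>carrier G. \<Sum>h\<in>carrier G.
     of_bool (g \<otimes>\<^bsub>G\<^esub> h = k) * \<sigma> g h * f g * f' h)"

definition basis_fun :: "'g \<Rightarrow> 'g \<Rightarrow> 'k::field" where
  "basis_fun g = (\<lambda>h. of_bool (h = g))"

text \<open>
  \<open>\<Gamma>\<close> only restricts the support: the product always sums over all of \<open>G\<close>, so that elements of the
  algebras for different \<open>\<Gamma>\<close> can be multiplied with each other.
\<close>

definition twisted_group_algebra ::
    "('g, 'x) monoid_scheme \<Rightarrow> ('g \<Rightarrow> 'g \<Rightarrow> 'k::field) \<Rightarrow> 'g set \<Rightarrow> ('k, 'g, 'g \<Rightarrow> 'k) graded_alg" where
  "twisted_group_algebra G \<sigma> \<Gamma> =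
     \<lparr>carrier = {f. \<forall>g. g \<notin> \<Gamma> \<longrightarrow> f g = 0},
      monoid.mult = twisted_mult G \<sigma>,
      one = basis_fun \<one>\<^bsub>G\<^esub>,
      ring.zero = (\<lambda>_. 0),
      add = (\<lambda>f f' g. f g + f' g),
      module.smult = (\<lambda>c f g. c * f g),
      homog = (\<lambda>g. {f. \<forall>h. h \<notin> \<Gamma> \<or> h \<noteq> g \<longrightarrow> f h = 0})\<rparr>"

lemma twisted_group_algebra_simps [simp]:
  "f \<in> carrier (twisted_group_algebra G \<sigma> \<Gamma>) \<longleftrightarrow> (\<forall>g. g \<notin> \<Gamma> \<longrightarrow> f g = 0)"
  "f \<otimes>\<^bsub>twisted_group_algebra G \<sigma> \<Gamma>\<^esub> f' = twisted_mult G \<sigma> f f'"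
  "\<one>\<^bsub>twisted_group_algebra G \<sigma> \<Gamma>\<^esub> = basis_fun \<one>\<^bsub>G\<^esub>"
  "\<zero>\<^bsub>twisted_group_algebra G \<sigma> \<Gamma>\<^esub> = (\<lambda>_. 0)"
  "f \<oplus>\<^bsub>twisted_group_algebra G \<sigma> \<Gamma>\<^esub> f' = (\<lambda>g. f g + f' g)"
  "c \<odot>\<^bsub>twisted_group_algebra G \<sigma> \<Gamma>\<^esub> f = (\<lambda>g. c * f g)"
  "f \<in> homog (twisted_group_algebra G \<sigma> \<Gamma>) g \<longleftrightarrow> (\<forall>h. h \<notin> \<Gamma> \<or> h \<noteq> g \<longrightarrow> f h = 0)"
  by (simp_all add: twisted_group_algebra_def)

lemma sum_of_bool_eq:
  fixes F :: "'a \<Rightarrow> 'k::comm_ring_1"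
  assumes "finite A" "a \<in> A"
  shows "(\<Sum>x\<in>A. of_bool (a = x) * F x) = F a" "(\<Sum>x\<in>A. of_bool (x = a) * F x) = F a"
  using assms by (simp_all add: of_bool_def if_distrib[of "\<lambda>x. x * _"] sum.delta sum.delta' cong: if_cong)

section \<open>Bilinearity of the twisted product\<close>

lemma twisted_mult_add_left:
  "twisted_mult G \<sigma> (\<lambda>g. f g + f' g) f'' = (\<lambda>k. twisted_mult G \<sigma> f f'' k + twisted_mult G \<sigma> f' f'' k)"
  by (simp add: twisted_mult_def algebra_simps sum.distrib)

lemma twisted_mult_add_right:
  "twisted_mult G \<sigma> f (\<lambda>g. f' g + f'' g) = (\<lambda>k. twisted_mult G \<sigma> f f' k + twisted_mult G \<sigma> f f'' k)"
  by (simp add: twisted_mult_def algebra_simps sum.distrib)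

lemma twisted_mult_smult_left:
  "twisted_mult G \<sigma> (\<lambda>g. c * f g) f' = (\<lambda>k. c * twisted_mult G \<sigma> f f' k)"
  by (simp add: twisted_mult_def sum_distrib_left ac_simps)

lemma twisted_mult_smult_right:
  "twisted_mult G \<sigma> f (\<lambda>g. c * f' g) = (\<lambda>k. c * twisted_mult G \<sigma> f f' k)"
  by (simp add: twisted_mult_def sum_distrib_left ac_simps)

lemma twisted_mult_sum_left:
  "finite S \<Longrightarrow> twisted_mult G \<sigma> (\<lambda>g. \<Sum>s\<in>S. F s g) f' = (\<lambda>k. \<Sum>s\<in>S. twisted_mult G \<sigma> (F s) f' k)"
proof (induction S rule: finite_induct)
  case (insert x S)
  then show ?case using twisted_mult_add_left[of G \<sigma> "F x" "\<lambda>g. \<Sum>s\<in>S. F s g" f'] by simp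
qed (simp add: twisted_mult_def)

lemma twisted_mult_sum_right:
  "finite S \<Longrightarrow> twisted_mult G \<sigma> f (\<lambda>g. \<Sum>s\<in>S. F s g) = (\<lambda>k. \<Sum>s\<in>S. twisted_mult G \<sigma> f (F s) k)"
proof (induction S rule: finite_induct)
  case (insert x S)
  then show ?case using twisted_mult_add_right[of G \<sigma> f "F x" "\<lambda>g. \<Sum>s\<in>S. F s g"] by simp
qed (simp add: twisted_mult_def)

lemma twisted_mult_eq_0_outside:
  assumes "\<And>g h. g \<in> carrier G \<Longrightarrow> h \<in> carrier G \<Longrightarrow> g \<otimes>\<^bsub>G\<^esub> h = k \<Longrightarrow> f g = 0 \<or> f' h = 0"
  shows "twisted_mult G \<sigma> f f' k = 0"
  unfolding twisted_mult_def using assms by (intro sum.neutral ballI) auto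

text \<open>Commutativity of \<open>G\<close> makes the product of two subgroups a subgroup and puts
  \<open>e_g e_h\<close> and \<open>e_h e_g\<close> in the same degree, where they can be compared.
  The normalisation \<open>cocycle_one\<close> makes the basis function of the neutral element a
  unit.\<close>

locale group_cocycle = comm_group G for G :: "('g, 'x) monoid_scheme" (structure) +
  fixes \<sigma> :: "'g \<Rightarrow> 'g \<Rightarrow> 'k::field"
  assumes finite_carrier: "finite (carrier G)"
    and cocycle: "\<And>g h k. \<lbrakk>g \<in> carrier G; h \<in> carrier G; k \<in> carrier G\<rbrakk> \<Longrightarrow>
      \<sigma> g h * \<sigma> (g \<otimes> h) k = \<sigma> g (h \<otimes> k) * \<sigma> h k"
    and cocycle_one: "\<And>g. g \<in> carrier G \<Longrightarrow> \<sigma> \<one> g = 1 \<and> \<sigma> g \<one> = 1"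
begin

text \<open>Summing a product against a weight \<open>\<phi>\<close> removes the indicator. In
  \<open>twisted_mult_assoc\<close> the weight is the kernel of the other multiplication.\<close>

lemma twisted_mult_pairing:
  "(\<Sum>k\<in>carrier G. twisted_mult G \<sigma> f f' k * \<phi> k) =
   (\<Sum>g\<in>carrier G. \<Sum>h\<in>carrier G. \<sigma> g h * f g * f' h * \<phi> (g \<otimes> h))"
proof -
  have "(\<Sum>k\<in>carrier G. twisted_mult G \<sigma> f f' k * \<phi> k) =
    (\<Sum>k\<in>carrier G. \<Sum>g\<in>carrier G. \<Sum>h\<in>carrier G. of_bool (g \<otimes> h = k) * (\<sigma> g h * f g * f' h * \<phi> k))"
    by (simp add: twisted_mult_def sum_distrib_right mult.assoc)
  also have "\<dots> = (\<Sum>g\<in>carrier G. \<Sum>k\<in>carrier G. \<Sum>h\<in>carrier G.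
      of_bool (g \<otimes> h = k) * (\<sigma> g h * f g * f' h * \<phi> k))"
    by (rule sum.swap)
  also have "\<dots> = (\<Sum>g\<in>carrier G. \<Sum>h\<in>carrier G. \<Sum>k\<in>carrier G.
      of_bool (g \<otimes> h = k) * (\<sigma> g h * f g * f' h * \<phi> k))"
    by (intro sum.cong refl sum.swap)
  also have "\<dots> = (\<Sum>g\<in>carrier G. \<Sum>h\<in>carrier G. \<sigma> g h * f g * f' h * \<phi> (g \<otimes> h))"
    by (intro sum.cong refl) (simp add: sum_of_bool_eq finite_carrier)
  finally show ?thesis .
qed

lemma twisted_mult_assoc:
  "twisted_mult G \<sigma> (twisted_mult G \<sigma> f f') f'' = twisted_mult G \<sigma> f (twisted_mult G \<sigma> f' f'')"
proof
  fix k
  let ?C = "carrier G"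
  have "twisted_mult G \<sigma> (twisted_mult G \<sigma> f f') f'' k =
      (\<Sum>y\<in>?C. \<Sum>x\<in>?C. twisted_mult G \<sigma> f f' x * (of_bool (x \<otimes> y = k) * \<sigma> x y * f'' y))"
    by (subst sum.swap) (simp add: twisted_mult_def[of _ _ _ f''] ac_simps)
  also have "\<dots> = (\<Sum>y\<in>?C. \<Sum>g\<in>?C. \<Sum>h\<in>?C.
      of_bool (g \<otimes> h \<otimes> y = k) * (\<sigma> g h * \<sigma> (g \<otimes> h) y) * f g * f' h * f'' y)"
    unfolding twisted_mult_pairing by (simp add: ac_simps)
  also have "\<dots> = (\<Sum>g\<in>?C. \<Sum>y\<in>?C. \<Sum>h\<in>?C.
      of_bool (g \<otimes> h \<otimes> y = k) * (\<sigma> g h * \<sigma> (g \<otimes> h) y) * f g * f' h * f'' y)"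
    by (rule sum.swap)
  also have "\<dots> = (\<Sum>g\<in>?C. \<Sum>h\<in>?C. \<Sum>y\<in>?C.
      of_bool (g \<otimes> h \<otimes> y = k) * (\<sigma> g h * \<sigma> (g \<otimes> h) y) * f g * f' h * f'' y)"
    by (intro sum.cong refl sum.swap)
  \<comment> \<open>The surrounding steps only rearrange finite sums; here associativity of
    \<open>G\<close> and the cocycle identity act on each term.\<close>
  also have "\<dots> = (\<Sum>g\<in>?C. \<Sum>h\<in>?C. \<Sum>y\<in>?C.
      \<sigma> h y * f' h * f'' y * (of_bool (g \<otimes> (h \<otimes> y) = k) * \<sigma> g (h \<otimes> y) * f g))"
    by (intro sum.cong refl) (simp add: m_assoc cocycle)
  also have "\<dots> = (\<Sum>g\<in>?C. \<Sum>x\<in>?C. twisted_mult G \<sigma> f' f'' x * (of_bool (g \<otimes> x = k) * \<sigma> g x * f g))"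
    by (simp add: twisted_mult_pairing)
  also have "\<dots> = twisted_mult G \<sigma> f (twisted_mult G \<sigma> f' f'') k"
    by (simp add: twisted_mult_def[of _ _ f] ac_simps)
  finally show "twisted_mult G \<sigma> (twisted_mult G \<sigma> f f') f'' k =
      twisted_mult G \<sigma> f (twisted_mult G \<sigma> f' f'') k" .
qed

lemma twisted_mult_basis_left:
  assumes "g \<in> carrier G"
  shows "twisted_mult G \<sigma> (basis_fun g) f k = (\<Sum>h\<in>carrier G. of_bool (g \<otimes> h = k) * \<sigma> g h * f h)"
proof -
  have "twisted_mult G \<sigma> (basis_fun g) f k = (\<Sum>x\<in>carrier G. of_bool (x = g) *
      (\<Sum>h\<in>carrier G. of_bool (x \<otimes> h = k) * \<sigma> x h * f h))"
    by (simp add: twisted_mult_def basis_fun_def sum_distrib_left ac_simps)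
  then show ?thesis using assms finite_carrier by (simp add: sum_of_bool_eq)
qed

lemma twisted_mult_basis_right:
  assumes "h \<in> carrier G"
  shows "twisted_mult G \<sigma> f (basis_fun h) k = (\<Sum>g\<in>carrier G. of_bool (g \<otimes> h = k) * \<sigma> g h * f g)"
proof -
  have "twisted_mult G \<sigma> f (basis_fun h) k = (\<Sum>g\<in>carrier G. \<Sum>y\<in>carrier G. of_bool (y = h) *
      (of_bool (g \<otimes> y = k) * \<sigma> g y * f g))"
    by (simp add: twisted_mult_def basis_fun_def ac_simps)
  then show ?thesis using assms finite_carrier by (simp add: sum_of_bool_eq)
qed

lemma twisted_mult_basis:
  assumes "g \<in> carrier G" "h \<in> carrier G"
  shows "twisted_mult G \<sigma> (basis_fun g) (basis_fun h) = (\<lambda>k. \<sigma> g h * basis_fun (g \<otimes> h) k)"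
proof
  fix k
  have "twisted_mult G \<sigma> (basis_fun g) (basis_fun h) k =
      (\<Sum>y\<in>carrier G. of_bool (y = h) * (of_bool (g \<otimes> y = k) * \<sigma> g y))"
    unfolding twisted_mult_basis_left[OF assms(1)] by (simp add: basis_fun_def ac_simps)
  also have "\<dots> = \<sigma> g h * basis_fun (g \<otimes> h) k"
    using assms finite_carrier by (auto simp: sum_of_bool_eq basis_fun_def)
  finally show "twisted_mult G \<sigma> (basis_fun g) (basis_fun h) k = \<sigma> g h * basis_fun (g \<otimes> h) k" .
qed

lemma twisted_mult_one:
  assumes "\<And>g. g \<notin> carrier G \<Longrightarrow> f g = 0"
  shows "twisted_mult G \<sigma> (basis_fun \<one>) f = f" "twisted_mult G \<sigma> f (basis_fun \<one>) = f"
proof -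
  have *: "(\<Sum>g\<in>carrier G. of_bool (g = k) * f g) = f k" for k
    using assms finite_carrier by (cases "k \<in> carrier G") (auto simp: sum_of_bool_eq intro!: sum.neutral)
  show "twisted_mult G \<sigma> (basis_fun \<one>) f = f"
  proof
    show "twisted_mult G \<sigma> (basis_fun \<one>) f k = f k" for k
      unfolding twisted_mult_basis_left[OF one_closed]
      by (subst *[of k, symmetric], intro sum.cong refl) (simp add: cocycle_one)
  qed
  show "twisted_mult G \<sigma> f (basis_fun \<one>) = f"
  proof
    show "twisted_mult G \<sigma> f (basis_fun \<one>) k = f k" for k
      unfolding twisted_mult_basis_right[OF one_closed]
      by (subst *[of k, symmetric], intro sum.cong refl) (simp add: cocycle_one)
  qed
qed

context
  fixes \<Gamma> assumes \<Gamma>: "subgroup \<Gamma> G"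
begin

interpretation \<Gamma>: subgroup \<Gamma> G by (rule \<Gamma>)

private abbreviation "T \<equiv> twisted_group_algebra G \<sigma> \<Gamma>"

lemma twisted_mult_closed:
  assumes "f \<in> carrier T" "f' \<in> carrier T"
  shows "twisted_mult G \<sigma> f f' \<in> carrier T"
  using assms \<Gamma>.m_closed by (fastforce intro: twisted_mult_eq_0_outside)

lemma abelian_group_twisted: "abelian_group T"
proof (rule abelian_groupI)
  fix x assume x: "x \<in> carrier T"
  show "\<exists>y\<in>carrier T. y \<oplus>\<^bsub>T\<^esub> x = \<zero>\<^bsub>T\<^esub>"
    by (rule bexI[of _ "\<lambda>g. - x g"]) (use x in auto)
qed (auto simp: ac_simps)

lemma ring_twisted: "ring T"
proof (rule ringI[OF abelian_group_twisted monoidI])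
  show "\<one>\<^bsub>T\<^esub> \<in> carrier T" by (auto simp: basis_fun_def)
  show "x \<otimes>\<^bsub>T\<^esub> y \<in> carrier T" if "x \<in> carrier T" "y \<in> carrier T" for x y
    using twisted_mult_closed[OF that] by simp
  show "\<one>\<^bsub>T\<^esub> \<otimes>\<^bsub>T\<^esub> x = x" "x \<otimes>\<^bsub>T\<^esub> \<one>\<^bsub>T\<^esub> = x" if "x \<in> carrier T" for x
    using that \<Gamma>.subset by (auto intro!: twisted_mult_one)
qed (simp_all add: twisted_mult_assoc twisted_mult_add_left twisted_mult_add_right)

lemma module_twisted: "module (ring_of_type_algebra :: 'k ring) T"
  by (rule moduleI[OF cring_from_type_algebra abelian_group_twisted])
    (simp_all add: ring_of_type_algebra_def algebra_simps)

lemma finsum_twisted: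
  assumes "finite S" "s \<in> S \<rightarrow> carrier T"
  shows "(\<Oplus>\<^bsub>T\<^esub>x\<in>S. s x) = (\<lambda>g. \<Sum>x\<in>S. s x g)"
  using assms
proof (induction S rule: finite_induct)
  interpret abelian_group T by (rule abelian_group_twisted)
  case empty
  then show ?case by simp
next
  interpret A: abelian_group T by (rule abelian_group_twisted)
  case (insert x S)
  then have "s \<in> S \<rightarrow> carrier T" "s x \<in> carrier T" by auto
  with insert show ?case by (simp add: A.finsum_insert[OF insert.hyps])
qed

lemma basis_expansion:
  assumes "f \<in> carrier T"
  shows "f k = (\<Sum>g\<in>\<Gamma>. f g * basis_fun g k)"
proof -
  have fin: "finite \<Gamma>" using \<Gamma>.subset finite_carrier finite_subset by blast
  have "(\<Sum>g\<in>\<Gamma>. f g * basis_fun g k) = (\<Sum>g\<in>\<Gamma>. of_bool (k = g) * f g)"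
    by (simp add: basis_fun_def ac_simps)
  also have "\<dots> = f k"
    using assms fin by (cases "k \<in> \<Gamma>") (auto simp: sum_of_bool_eq intro!: sum.neutral)
  finally show ?thesis by simp
qed

lemma submodule_homog_twisted:
  "submodule (homog T g) (ring_of_type_algebra :: 'k ring) T"
proof -
  interpret module "ring_of_type_algebra :: 'k ring" T by (rule module_twisted)
  show ?thesis
  proof (rule submoduleI)
    show "\<ominus>\<^bsub>T\<^esub> x \<in> homog T g" if x: "x \<in> homog T g" for x
    proof -
      have "\<ominus>\<^bsub>T\<^esub> x = (\<lambda>g. - x g)" by (rule M.minus_equality) (use x in auto)
      then show ?thesis using x by simp
    qed
  qed auto
qed

lemma graded_algebra_twisted: "graded_algebra G T"
  unfolding graded_algebra_def
proof (intro conjI allI ballI)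
  have fin: "finite \<Gamma>" using \<Gamma>.subset finite_carrier finite_subset by blast
  show "\<exists>S. finite S \<and> S \<subseteq> carrier T \<and>
    (\<forall>a\<in>carrier T. \<exists>c :: ('g \<Rightarrow> 'k) \<Rightarrow> 'k. a = (\<Oplus>\<^bsub>T\<^esub>s\<in>S. c s \<odot>\<^bsub>T\<^esub> s))"
  proof (intro exI[of _ "basis_fun ` \<Gamma>"] conjI ballI)
    show sub: "basis_fun ` \<Gamma> \<subseteq> carrier T" by (auto simp: basis_fun_def)
    show "finite (basis_fun ` \<Gamma>)" using fin by simp
    fix a assume a: "a \<in> carrier T"
    have inj: "inj_on (basis_fun :: 'g \<Rightarrow> 'g \<Rightarrow> 'k) \<Gamma>"
      by (rule inj_onI) (auto simp: basis_fun_def fun_eq_iff of_bool_def split: if_splits)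
    \<comment> \<open>In the spanning condition coefficients are indexed by elements of the algebra,
      so the group element is recovered from its basis function.\<close>
    define c where "c s = a (inv_into \<Gamma> basis_fun s)" for s :: "'g \<Rightarrow> 'k"
    have "(\<Oplus>\<^bsub>T\<^esub>s\<in>basis_fun ` \<Gamma>. c s \<odot>\<^bsub>T\<^esub> s) = (\<lambda>k. \<Sum>s\<in>basis_fun ` \<Gamma>. (c s \<odot>\<^bsub>T\<^esub> s) k)"
      by (rule finsum_twisted) (use fin sub in auto)
    also have "\<dots> = (\<lambda>k. \<Sum>g\<in>\<Gamma>. a g * basis_fun g k)"
      by (simp add: sum.reindex[OF inj] c_def inv_into_f_f[OF inj])
    also have "\<dots> = a" by (intro ext basis_expansion[OF a, symmetric])
    finally have "(\<Oplus>\<^bsub>T\<^esub>s\<in>basis_fun ` \<Gamma>. c s \<odot>\<^bsub>T\<^esub> s) = a" .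
    then show "\<exists>c :: ('g \<Rightarrow> 'k) \<Rightarrow> 'k. a = (\<Oplus>\<^bsub>T\<^esub>s\<in>basis_fun ` \<Gamma>. c s \<odot>\<^bsub>T\<^esub> s)"
      by (intro exI[of _ c]) (rule sym)
  qed
next
  fix a assume a: "a \<in> carrier T"
  have closed: "c \<in> carrier G \<rightarrow> carrier T"
    if "c \<in> (\<Pi>\<^sub>E g\<in>carrier G. homog T g)" for c :: "'g \<Rightarrow> 'g \<Rightarrow> 'k"
    using that by (auto simp: PiE_iff)
  \<comment> \<open>At the point \<open>k\<close> only the component of degree \<open>k\<close> can
    be nonzero. The sum is read off the diagonal, which gives existence and uniqueness of the
    decomposition alike.\<close>
  have coeff: "(\<Oplus>\<^bsub>T\<^esub>g\<in>carrier G. c g) = (\<lambda>k. if k \<in> carrier G then c k k else 0)"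
    if c: "c \<in> (\<Pi>\<^sub>E g\<in>carrier G. homog T g)" for c
  proof -
    have "(\<Oplus>\<^bsub>T\<^esub>g\<in>carrier G. c g) = (\<lambda>k. \<Sum>g\<in>carrier G. of_bool (k = g) * c g k)"
      unfolding finsum_twisted[OF finite_carrier closed[OF c]]
      using c by (intro ext sum.cong refl) (auto simp: PiE_iff)
    also have "\<dots> = (\<lambda>k. if k \<in> carrier G then c k k else 0)"
      using finite_carrier by (auto simp: sum_of_bool_eq fun_eq_iff intro!: sum.neutral)
    finally show ?thesis .
  qed
  define c where "c = (\<lambda>g\<in>carrier G. \<lambda>k. if k = g then a k else 0)"
  show "\<exists>!c. c \<in> (\<Pi>\<^sub>E g\<in>carrier G. homog T g) \<and> a = (\<Oplus>\<^bsub>T\<^esub>g\<in>carrier G. c g)"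
  proof (rule ex1I[of _ c], intro conjI)
    show c: "c \<in> (\<Pi>\<^sub>E g\<in>carrier G. homog T g)" using a by (auto simp: c_def)
    show "a = (\<Oplus>\<^bsub>T\<^esub>g\<in>carrier G. c g)"
      unfolding coeff[OF c] using a \<Gamma>.subset by (auto simp: c_def fun_eq_iff)
    fix d assume d: "d \<in> (\<Pi>\<^sub>E g\<in>carrier G. homog T g) \<and> a = (\<Oplus>\<^bsub>T\<^esub>g\<in>carrier G. d g)"
    then have "a = (\<lambda>k. if k \<in> carrier G then d k k else 0)" using coeff by auto
    then have "d g = c g" if "g \<in> carrier G" for g
      using that d by (auto simp: c_def PiE_iff fun_eq_iff)
    then show "d = c" using PiE_ext[of d _ _ c] d c by blast
  qed
next
  fix g h a b assume "g \<in> carrier G" "h \<in> carrier G" "a \<in> homog T g" "b \<in> homog T h"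
  then show "a \<otimes>\<^bsub>T\<^esub> b \<in> homog T (g \<otimes> h)"
    using \<Gamma>.m_closed by (fastforce intro: twisted_mult_eq_0_outside)
qed (use ring_twisted module_twisted submodule_homog_twisted in
    \<open>simp_all add: twisted_mult_smult_left twisted_mult_smult_right\<close>)

end

end

section \<open>Braided tensor products of twisted group algebras\<close>

definition lin_ext :: "('u \<Rightarrow> 'k::field) \<Rightarrow> ('u \<Rightarrow>\<^sub>0 'k) \<Rightarrow> 'k" where
  "lin_ext \<phi> p = (\<Sum>u\<in>Poly_Mapping.keys p. Poly_Mapping.lookup p u * \<phi> u)"

lemma lin_ext_superset:
  assumes "finite S" "Poly_Mapping.keys p \<subseteq> S"
  shows "lin_ext \<phi> p = (\<Sum>u\<in>S. Poly_Mapping.lookup p u * \<phi> u)"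
  unfolding lin_ext_def using assms
  by (intro sum.mono_neutral_left) (auto simp: in_keys_iff)

lemma lookup_pm_scale [simp]: "Poly_Mapping.lookup (pm_scale c p) u = c * Poly_Mapping.lookup p u"
  by (simp add: pm_scale_def Poly_Mapping.map.rep_eq when_def)

lemma pm_scale_single: "pm_scale c (Poly_Mapping.single u d) = Poly_Mapping.single u (c * d)"
  by (rule poly_mapping_eqI) (simp add: lookup_single when_def)

lemma keys_pm_scale: "Poly_Mapping.keys (pm_scale c p) \<subseteq> Poly_Mapping.keys p"
  by (auto simp: in_keys_iff)

lemma lin_ext_zero [simp]: "lin_ext \<phi> 0 = 0"
  by (simp add: lin_ext_def)

lemma lin_ext_single [simp]: "lin_ext \<phi> (Poly_Mapping.single u c) = c * \<phi> u"
  by (simp add: lin_ext_def)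

lemma lin_ext_add: "lin_ext \<phi> (p + q) = lin_ext \<phi> p + lin_ext \<phi> q"
proof -
  let ?S = "Poly_Mapping.keys p \<union> Poly_Mapping.keys q"
  have "lin_ext \<phi> r = (\<Sum>u\<in>?S. Poly_Mapping.lookup r u * \<phi> u)" if "r \<in> {p, q, p + q}" for r
    using that Poly_Mapping.keys_add[of p q] by (intro lin_ext_superset) auto
  then show ?thesis by (simp add: lookup_add distrib_right sum.distrib)
qed

lemma lin_ext_pm_scale: "lin_ext \<phi> (pm_scale c p) = c * lin_ext \<phi> p"
  unfolding lin_ext_superset[OF finite_keys keys_pm_scale, of \<phi> c p]
  by (simp add: lin_ext_def sum_distrib_left mult.assoc)

lemma lin_ext_uminus: "lin_ext \<phi> (- p) = - lin_ext \<phi> p"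
  using lin_ext_add[of \<phi> "- p" p] by (simp add: eq_neg_iff_add_eq_0)

lemma lin_ext_diff: "lin_ext \<phi> (p - q) = lin_ext \<phi> p - lin_ext \<phi> q"
  using lin_ext_add[of \<phi> p "- q"] by (simp add: lin_ext_uminus)

lemma lin_ext_sum: "lin_ext \<phi> (\<Sum>x\<in>S. f x) = (\<Sum>x\<in>S. lin_ext \<phi> (f x))"
  by (induction S rule: infinite_finite_induct) (simp_all add: lin_ext_add)

lemma poly_mapping_expansion:
  "p = (\<Sum>u\<in>Poly_Mapping.keys p. Poly_Mapping.single u (Poly_Mapping.lookup p u))"
proof (rule poly_mapping_eqI)
  fix v
  have "(\<Sum>u\<in>Poly_Mapping.keys p. Poly_Mapping.lookup (Poly_Mapping.single u (Poly_Mapping.lookup p u)) v) =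
    (\<Sum>u\<in>Poly_Mapping.keys p. if u = v then Poly_Mapping.lookup p u else 0)"
    by (intro sum.cong refl) (simp add: lookup_single when_def)
  also have "\<dots> = Poly_Mapping.lookup p v" by (simp add: in_keys_iff)
  finally show "Poly_Mapping.lookup p v = Poly_Mapping.lookup
      (\<Sum>u\<in>Poly_Mapping.keys p. Poly_Mapping.single u (Poly_Mapping.lookup p u)) v"
    by (simp add: lookup_sum)
qed

lemma poly_mapping_expansion_pm_scale:
  "p = (\<Sum>u\<in>Poly_Mapping.keys p. pm_scale (Poly_Mapping.lookup p u) (Poly_Mapping.single u 1))"
  using poly_mapping_expansion[of p] by (simp add: pm_scale_single)

section \<open>Formal pairs, and coordinates in algebras isomorphic to twisted group
  algebras\<close>

interpretation pm: vector_space pm_scale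
  by (rule vector_space_pm_scale)

lemma subspace_pair_space:
  fixes A :: "('c::field, 'g, 'a) graded_alg" and B :: "('c, 'g, 'b) graded_alg"
  shows "pm.subspace (pair_space A B)"
  unfolding pm.subspace_def pair_space_def
proof (intro conjI allI ballI CollectI)
  fix p q :: "'a \<times> 'b \<Rightarrow>\<^sub>0 'c" and c
  assume "p \<in> {p. Poly_Mapping.keys p \<subseteq> carrier A \<times> carrier B}"
    "q \<in> {p. Poly_Mapping.keys p \<subseteq> carrier A \<times> carrier B}"
  then show "Poly_Mapping.keys (p + q) \<subseteq> carrier A \<times> carrier B"
    using Poly_Mapping.keys_add[of p q] by blast
next
  fix p :: "'a \<times> 'b \<Rightarrow>\<^sub>0 'c" and c
  assume "p \<in> {p. Poly_Mapping.keys p \<subseteq> carrier A \<times> carrier B}"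
  then show "Poly_Mapping.keys (pm_scale c p) \<subseteq> carrier A \<times> carrier B"
    using keys_pm_scale[of c p] by blast
qed simp

lemmas pair_space_closed =
  pm.subspace_0[OF subspace_pair_space] pm.subspace_add[OF subspace_pair_space]
  pm.subspace_scale[OF subspace_pair_space] pm.subspace_sum[OF subspace_pair_space]
  pm.subspace_diff[OF subspace_pair_space]

lemma single_pair_space:
  "a \<in> carrier A \<Longrightarrow> b \<in> carrier B \<Longrightarrow> Poly_Mapping.single (a, b) c \<in> pair_space A B"
  by (auto simp: pair_space_def)

text \<open>\<open>homog_part\<close> is a definite description. Uniqueness of decompositions turns
  it into a component of an actual decomposition, and evaluating at \<open>h\<close>, where the
  other components vanish, computes it.\<close>

lemma (in group_cocycle) homog_part_twisted:
  assumes \<Gamma>: "subgroup \<Gamma> G" and transfer: "graded_transfer G A (twisted_group_algebra G \<sigma> \<Gamma>) \<alpha>"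
    and a: "a \<in> carrier A" and h: "h \<in> carrier G"
  shows "homog_part G A h a \<in> carrier A" "\<alpha> (homog_part G A h a) = (\<lambda>k. \<alpha> a h * basis_fun h k)"
proof -
  interpret A: graded_transfer G A "twisted_group_algebra G \<sigma> \<Gamma>" \<alpha> by (rule transfer)
  define c where "c = (THE c. c \<in> (\<Pi>\<^sub>E g\<in>carrier G. homog A g) \<and> a = (\<Oplus>\<^bsub>A\<^esub>g\<in>carrier G. c g))"
  have c: "c \<in> (\<Pi>\<^sub>E g\<in>carrier G. homog A g)" "a = (\<Oplus>\<^bsub>A\<^esub>g\<in>carrier G. c g)"
    using theI'[OF A.decomp[OF a], folded c_def] by blast+
  have part: "homog_part G A h a = c h" by (simp add: homog_part_def c_def)
  have homog: "c g \<in> homog A g" if "g \<in> carrier G" for g using c(1) that by (rule PiE_mem)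
  then have carr: "c \<in> carrier G \<rightarrow> carrier A" using A.homog_subset by blast
  show "homog_part G A h a \<in> carrier A" unfolding part using carr h by blast
  have supp: "\<alpha> (c g) k = 0" if "g \<in> carrier G" "k \<noteq> g" for g k
  proof -
    have "\<alpha> (c g) \<in> homog (twisted_group_algebra G \<sigma> \<Gamma>) g"
      using A.homog_image[OF that(1)] homog[OF that(1)] by blast
    then show ?thesis using that(2) by simp
  qed
  have "\<alpha> a = (\<Oplus>\<^bsub>twisted_group_algebra G \<sigma> \<Gamma>\<^esub>g\<in>carrier G. \<alpha> (c g))"
    using A.finsum[OF carr] c(2) by simp
  also have "\<dots> = (\<lambda>k. \<Sum>g\<in>carrier G. \<alpha> (c g) k)"
    by (rule finsum_twisted[OF \<Gamma> finite_carrier]) (use carr A.image_closed in blast)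
  finally have "\<alpha> a h = (\<Sum>g\<in>carrier G. \<alpha> (c g) h)" by simp
  also have "\<dots> = (\<Sum>g\<in>carrier G. of_bool (h = g) * \<alpha> (c g) h)"
    by (intro sum.cong refl) (use supp in auto)
  also have "\<dots> = \<alpha> (c h) h" using h finite_carrier by (simp add: sum_of_bool_eq)
  finally have "\<alpha> a h = \<alpha> (c h) h" .
  then show "\<alpha> (homog_part G A h a) = (\<lambda>k. \<alpha> a h * basis_fun h k)"
    unfolding part using supp[OF h] by (auto simp: basis_fun_def)
qed

definition basis_elem :: "('k::field, 'g, 'a) graded_alg \<Rightarrow> ('a \<Rightarrow> 'g \<Rightarrow> 'k) \<Rightarrow> 'g \<Rightarrow> 'a" where
  "basis_elem A \<alpha> g = inv_into (carrier A) \<alpha> (basis_fun g)"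

lemma basis_elem:
  assumes "graded_transfer G A (twisted_group_algebra G \<sigma> \<Gamma>) \<alpha>" "g \<in> \<Gamma>"
  shows "basis_elem A \<alpha> g \<in> carrier A \<and> \<alpha> (basis_elem A \<alpha> g) = basis_fun g"
proof -
  interpret graded_transfer G A "twisted_group_algebra G \<sigma> \<Gamma>" \<alpha> by fact
  have "\<exists>x\<in>carrier A. \<alpha> x = basis_fun g"
    using assms(2) by (intro preimage) (auto simp: basis_fun_def)
  then have "basis_fun g \<in> \<alpha> ` carrier A" by (metis imageI)
  then show ?thesis unfolding basis_elem_def by (simp add: inv_into_into f_inv_into_f)
qed

lemma (in group_cocycle) basis_elem_expansion:
  assumes \<Gamma>: "subgroup \<Gamma> G" and transfer: "graded_transfer G A (twisted_group_algebra G \<sigma> \<Gamma>) \<alpha>"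
    and a: "a \<in> carrier A"
  shows "a = (\<Oplus>\<^bsub>A\<^esub>g\<in>\<Gamma>. \<alpha> a g \<odot>\<^bsub>A\<^esub> basis_elem A \<alpha> g)"
proof -
  interpret A: graded_transfer G A "twisted_group_algebra G \<sigma> \<Gamma>" \<alpha> by (rule transfer)
  let ?e = "basis_elem A \<alpha>"
  note e = basis_elem[OF transfer]
  have finite: "finite \<Gamma>" using subgroup.subset[OF \<Gamma>] finite_carrier finite_subset by blast
  have carr: "(\<lambda>g. \<alpha> a g \<odot>\<^bsub>A\<^esub> ?e g) \<in> \<Gamma> \<rightarrow> carrier A"
    using e by (auto intro!: A.smult_closed)
  have "\<alpha> (\<Oplus>\<^bsub>A\<^esub>g\<in>\<Gamma>. \<alpha> a g \<odot>\<^bsub>A\<^esub> ?e g) = (\<lambda>k. \<Sum>g\<in>\<Gamma>. \<alpha> (\<alpha> a g \<odot>\<^bsub>A\<^esub> ?e g) k)"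
    unfolding A.finsum[OF carr]
    by (rule finsum_twisted[OF \<Gamma> finite]) (use carr A.image_closed in blast)
  also have "\<dots> = (\<lambda>k. \<Sum>g\<in>\<Gamma>. \<alpha> a g * basis_fun g k)"
    by (intro ext sum.cong refl) (simp add: A.smult e)
  also have "\<dots> = \<alpha> a"
    by (intro ext basis_expansion[OF \<Gamma> A.image_closed[OF a], symmetric])
  finally show ?thesis
    using A.eq_iff[OF a A.finsum_closed[OF carr]] by simp
qed

text \<open>The factors are merely isomorphic to twisted group algebras, since in an iterated
  product they are themselves products. By \<open>inj_mult\<close> and \<open>nonzero\<close> the
  map from \<open>e_g\<close> tensor \<open>e_h\<close> to \<open>\<sigma>(g,h) e_(gh)\<close> is
  injective on the span of these pairs; \<open>commute\<close> makes it respect the braided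
  product.\<close>

locale braided_factors = group_cocycle G \<sigma>
  for G :: "('g, 'x) monoid_scheme" (structure) and \<sigma> :: "'g \<Rightarrow> 'g \<Rightarrow> 'k::field" +
  fixes R :: "'g \<Rightarrow> 'g \<Rightarrow> 'k" and \<Gamma> \<Delta> :: "'g set"
    and A :: "('k, 'g, 'a) graded_alg" and \<alpha> :: "'a \<Rightarrow> 'g \<Rightarrow> 'k"
    and B :: "('k, 'g, 'b) graded_alg" and \<beta> :: "'b \<Rightarrow> 'g \<Rightarrow> 'k"
  assumes subgroups: "subgroup \<Gamma> G" "subgroup \<Delta> G"
    and inj_mult: "inj_on (\<lambda>(g, h). g \<otimes> h) (\<Gamma> \<times> \<Delta>)"
    and commute: "\<And>g h. g \<in> \<Gamma> \<Longrightarrow> h \<in> \<Delta> \<Longrightarrow> \<sigma> h g = R h g * \<sigma> g h"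
    and nonzero: "\<And>g h. g \<in> \<Gamma> \<Longrightarrow> h \<in> \<Delta> \<Longrightarrow> \<sigma> g h \<noteq> 0"
    and transfer_A: "graded_transfer G A (twisted_group_algebra G \<sigma> \<Gamma>) \<alpha>"
    and transfer_B: "graded_transfer G B (twisted_group_algebra G \<sigma> \<Delta>) \<beta>"
begin

interpretation \<Gamma>: subgroup \<Gamma> G by (rule subgroups)
interpretation \<Delta>: subgroup \<Delta> G by (rule subgroups)
interpretation A: graded_transfer G A "twisted_group_algebra G \<sigma> \<Gamma>" \<alpha> by (rule transfer_A)
interpretation B: graded_transfer G B "twisted_group_algebra G \<sigma> \<Delta>" \<beta> by (rule transfer_B)
interpretation MA: module "ring_of_type_algebra :: 'k ring" A by (rule A.module)
interpretation MB: module "ring_of_type_algebra :: 'k ring" B by (rule B.module)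

abbreviation M :: "('g \<Rightarrow> 'k) \<Rightarrow> ('g \<Rightarrow> 'k) \<Rightarrow> 'g \<Rightarrow> 'k" where "M \<equiv> twisted_mult G \<sigma>"

definition prod_fun :: "'a \<times> 'b \<Rightarrow> 'g \<Rightarrow> 'k" where
  "prod_fun u = M (\<alpha> (fst u)) (\<beta> (snd u))"

definition tensor_eval :: "('a \<times> 'b \<Rightarrow>\<^sub>0 'k) \<Rightarrow> 'g \<Rightarrow> 'k" where
  "tensor_eval p = (\<lambda>k. lin_ext (\<lambda>u. prod_fun u k) p)"

lemma finite_subgroups: "finite \<Gamma>" "finite \<Delta>"
  using \<Gamma>.subset \<Delta>.subset finite_carrier finite_subset by blast+

lemma \<alpha>_outside: "a \<in> carrier A \<Longrightarrow> g \<notin> \<Gamma> \<Longrightarrow> \<alpha> a g = 0"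
  using A.image_closed by simp

lemma \<beta>_outside: "b \<in> carrier B \<Longrightarrow> g \<notin> \<Delta> \<Longrightarrow> \<beta> b g = 0"
  using B.image_closed by simp

lemma mult_eq_iff:
  "\<lbrakk>g \<in> \<Gamma>; h \<in> \<Delta>; g' \<in> \<Gamma>; h' \<in> \<Delta>\<rbrakk> \<Longrightarrow> g \<otimes> h = g' \<otimes> h' \<longleftrightarrow> g = g' \<and> h = h'"
  using inj_onD[OF inj_mult, of "(g, h)" "(g', h')"] by auto

text \<open>Unique factorisation in the product of the two subgroups leaves a single term of the
  double sum. This is what allows the coordinates of a tensor to be recovered from its
  evaluation.\<close>

lemma prod_fun_mult:
  assumes "a \<in> carrier A" "b \<in> carrier B" "g \<in> \<Gamma>" "h \<in> \<Delta>"
  shows "prod_fun (a, b) (g \<otimes> h) = \<sigma> g h * (\<alpha> a g * \<beta> b h)"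
proof -
  have "prod_fun (a, b) (g \<otimes> h) = (\<Sum>x\<in>carrier G. \<Sum>y\<in>carrier G.
      of_bool (x = g) * (of_bool (y = h) * (\<sigma> x y * (\<alpha> a x * \<beta> b y))))"
    unfolding prod_fun_def twisted_mult_def
  proof (intro sum.cong refl)
    fix x y
    show "of_bool (x \<otimes> y = g \<otimes> h) * \<sigma> x y * \<alpha> (fst (a, b)) x * \<beta> (snd (a, b)) y =
      of_bool (x = g) * (of_bool (y = h) * (\<sigma> x y * (\<alpha> a x * \<beta> b y)))"
      using assms \<alpha>_outside \<beta>_outside mult_eq_iff[of x y g h]
      by (cases "x \<in> \<Gamma> \<and> y \<in> \<Delta>") auto
  qed
  also have "\<dots> = \<sigma> g h * (\<alpha> a g * \<beta> b h)"
    using assms finite_carrier by (simp add: sum_of_bool_eq flip: sum_distrib_left)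
  finally show ?thesis .
qed

lemma prod_fun_outside:
  assumes "a \<in> carrier A" "b \<in> carrier B" "k \<notin> \<Gamma> <#> \<Delta>"
  shows "prod_fun (a, b) k = 0"
  unfolding prod_fun_def
proof (rule twisted_mult_eq_0_outside)
  fix g h assume "g \<otimes> h = k"
  then have "g \<notin> \<Gamma> \<or> h \<notin> \<Delta>" using assms(3) by (auto simp: set_mult_def)
  then show "\<alpha> (fst (a, b)) g = 0 \<or> \<beta> (snd (a, b)) h = 0"
    using assms(1,2) \<alpha>_outside \<beta>_outside by auto
qed

lemma tensor_eval_add: "tensor_eval (p + q) = (\<lambda>k. tensor_eval p k + tensor_eval q k)"
  by (simp add: tensor_eval_def lin_ext_add)

lemma tensor_eval_diff: "tensor_eval (p - q) = (\<lambda>k. tensor_eval p k - tensor_eval q k)"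
  by (simp add: tensor_eval_def lin_ext_diff)

lemma tensor_eval_pm_scale: "tensor_eval (pm_scale c p) = (\<lambda>k. c * tensor_eval p k)"
  by (simp add: tensor_eval_def lin_ext_pm_scale)

lemma tensor_eval_zero: "tensor_eval 0 = (\<lambda>k. 0)"
  by (simp add: tensor_eval_def)

lemma tensor_eval_single: "tensor_eval (Poly_Mapping.single u c) = (\<lambda>k. c * prod_fun u k)"
  by (simp add: tensor_eval_def)

lemma tensor_eval_outside:
  assumes "p \<in> pair_space A B" "k \<notin> \<Gamma> <#> \<Delta>"
  shows "tensor_eval p k = 0"
  unfolding tensor_eval_def lin_ext_def
proof (intro sum.neutral ballI)
  fix u assume "u \<in> Poly_Mapping.keys p"
  then have "fst u \<in> carrier A" "snd u \<in> carrier B"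
    using assms(1) by (auto simp: pair_space_def)
  then have "prod_fun (fst u, snd u) k = 0" using assms(2) by (rule prod_fun_outside)
  then show "Poly_Mapping.lookup p u * prod_fun u k = 0" by simp
qed

lemma tensor_eval_mult:
  assumes "p \<in> pair_space A B" "g \<in> \<Gamma>" "h \<in> \<Delta>"
  shows "tensor_eval p (g \<otimes> h) = \<sigma> g h * lin_ext (\<lambda>u. \<alpha> (fst u) g * \<beta> (snd u) h) p"
  unfolding tensor_eval_def lin_ext_def sum_distrib_left
proof (intro sum.cong refl)
  fix u assume "u \<in> Poly_Mapping.keys p"
  then have "fst u \<in> carrier A" "snd u \<in> carrier B"
    using assms(1) by (auto simp: pair_space_def)
  then have "prod_fun (fst u, snd u) (g \<otimes> h) = \<sigma> g h * (\<alpha> (fst u) g * \<beta> (snd u) h)"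
    using assms(2,3) by (rule prod_fun_mult)
  then show "Poly_Mapping.lookup p u * prod_fun u (g \<otimes> h) =
      \<sigma> g h * (Poly_Mapping.lookup p u * (\<alpha> (fst u) g * \<beta> (snd u) h))"
    by simp
qed

text \<open>Half of the kernel computation, by bilinearity of the twisted product. Membership in
  \<open>pair_space\<close> is recorded as well, so that adding a relation does not leave the space
  of formal pairs.\<close>

lemma bilinear_rels_subset: "bilinear_rels A B \<subseteq> {p \<in> pair_space A B. tensor_eval p = (\<lambda>_. 0)}"
  unfolding bilinear_rels_def
proof (rule pm.span_minimal)
  show "pm.subspace {p \<in> pair_space A B. tensor_eval p = (\<lambda>_. 0)}"
    unfolding pm.subspace_def by (simp add: tensor_eval_zero tensor_eval_add tensor_eval_pm_scale pair_space_closed)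
qed (auto intro!: pair_space_closed single_pair_space A.add_closed B.add_closed A.smult_closed B.smult_closed
    simp: tensor_eval_diff tensor_eval_single tensor_eval_pm_scale prod_fun_def A.add B.add A.smult B.smult
      twisted_mult_add_left twisted_mult_add_right twisted_mult_smult_left twisted_mult_smult_right)

lemma subspace_bilinear_rels: "pm.subspace (bilinear_rels A B)"
  unfolding bilinear_rels_def by (rule pm.subspace_span)

lemmas bilinear_rels_closed =
  pm.subspace_add[OF subspace_bilinear_rels] pm.subspace_scale[OF subspace_bilinear_rels]
  pm.subspace_sum[OF subspace_bilinear_rels] pm.subspace_neg[OF subspace_bilinear_rels]

lemma bilinear_rels_add_left:
  "\<lbrakk>a \<in> carrier A; a' \<in> carrier A; b \<in> carrier B\<rbrakk> \<Longrightarrow>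
    pair (a \<oplus>\<^bsub>A\<^esub> a') b - pair a b - pair a' b \<in> bilinear_rels A B"
  unfolding bilinear_rels_def by (intro pm.span_base) blast

lemma bilinear_rels_add_right:
  "\<lbrakk>a \<in> carrier A; b \<in> carrier B; b' \<in> carrier B\<rbrakk> \<Longrightarrow>
    pair a (b \<oplus>\<^bsub>B\<^esub> b') - pair a b - pair a b' \<in> bilinear_rels A B"
  unfolding bilinear_rels_def by (intro pm.span_base) blast

lemma bilinear_rels_smult_left:
  "\<lbrakk>a \<in> carrier A; b \<in> carrier B\<rbrakk> \<Longrightarrow>
    pair (c \<odot>\<^bsub>A\<^esub> a) b - pm_scale c (pair a b) \<in> bilinear_rels A B"
  unfolding bilinear_rels_def by (intro pm.span_base) blast

lemma bilinear_rels_smult_right: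
  "\<lbrakk>a \<in> carrier A; b \<in> carrier B\<rbrakk> \<Longrightarrow>
    pair a (c \<odot>\<^bsub>B\<^esub> b) - pm_scale c (pair a b) \<in> bilinear_rels A B"
  unfolding bilinear_rels_def by (intro pm.span_base) blast

text \<open>The relations cover two summands and one scalar at a time; expanding in a basis needs
  them for finite linear combinations.\<close>

lemma bilinear_rels_lincomb_left:
  assumes "finite S" "x \<in> S \<rightarrow> carrier A" "b \<in> carrier B"
  shows "pair (\<Oplus>\<^bsub>A\<^esub>i\<in>S. c i \<odot>\<^bsub>A\<^esub> x i) b - (\<Sum>i\<in>S. pm_scale (c i) (pair (x i) b)) \<in> bilinear_rels A B"
  using assms(1,2)
proof (induction S rule: finite_induct)
  case empty
  \<comment> \<open>The additivity relation for \<open>0 + 0\<close> is minus the pair with first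
    entry zero, which shows that this pair is itself a relation.\<close>
  have "- (pair (\<zero>\<^bsub>A\<^esub> \<oplus>\<^bsub>A\<^esub> \<zero>\<^bsub>A\<^esub>) b - pair \<zero>\<^bsub>A\<^esub> b - pair \<zero>\<^bsub>A\<^esub> b) \<in> bilinear_rels A B"
    using assms(3) by (intro bilinear_rels_closed bilinear_rels_add_left) auto
  then show ?case by simp
next
  case (insert j S)
  let ?s = "\<Oplus>\<^bsub>A\<^esub>i\<in>S. c i \<odot>\<^bsub>A\<^esub> x i"
  have carr: "x j \<in> carrier A" "(\<lambda>i. c i \<odot>\<^bsub>A\<^esub> x i) \<in> S \<rightarrow> carrier A"
    using insert.prems by (auto simp: A.smult_closed)
  then have s: "?s \<in> carrier A" by (intro A.finsum_closed)
  \<comment> \<open>Additivity, homogeneity and the induction hypothesis telescope to the difference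
    claimed for the enlarged set.\<close>
  have "(pair (c j \<odot>\<^bsub>A\<^esub> x j \<oplus>\<^bsub>A\<^esub> ?s) b - pair (c j \<odot>\<^bsub>A\<^esub> x j) b - pair ?s b)
      + (pair (c j \<odot>\<^bsub>A\<^esub> x j) b - pm_scale (c j) (pair (x j) b))
      + (pair ?s b - (\<Sum>i\<in>S. pm_scale (c i) (pair (x i) b))) \<in> bilinear_rels A B"
    using carr s assms(3) insert.prems
    by (intro bilinear_rels_closed bilinear_rels_add_left bilinear_rels_smult_left insert.IH)
      (auto simp: A.smult_closed)
  then show ?case
    using insert.hyps carr by (simp add: MA.finsum_insert A.smult_closed algebra_simps)
qed

lemma bilinear_rels_lincomb_right:
  assumes "finite S" "x \<in> S \<rightarrow> carrier B" "a \<in> carrier A"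
  shows "pair a (\<Oplus>\<^bsub>B\<^esub>i\<in>S. c i \<odot>\<^bsub>B\<^esub> x i) - (\<Sum>i\<in>S. pm_scale (c i) (pair a (x i))) \<in> bilinear_rels A B"
  using assms(1,2)
proof (induction S rule: finite_induct)
  case empty
  have "- (pair a (\<zero>\<^bsub>B\<^esub> \<oplus>\<^bsub>B\<^esub> \<zero>\<^bsub>B\<^esub>) - pair a \<zero>\<^bsub>B\<^esub> - pair a \<zero>\<^bsub>B\<^esub>) \<in> bilinear_rels A B"
    using assms(3) by (intro bilinear_rels_closed bilinear_rels_add_right) auto
  then show ?case by simp
next
  case (insert j S)
  let ?s = "\<Oplus>\<^bsub>B\<^esub>i\<in>S. c i \<odot>\<^bsub>B\<^esub> x i"
  have carr: "x j \<in> carrier B" "(\<lambda>i. c i \<odot>\<^bsub>B\<^esub> x i) \<in> S \<rightarrow> carrier B"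
    using insert.prems by (auto simp: B.smult_closed)
  then have s: "?s \<in> carrier B" by (intro B.finsum_closed)
  have "(pair a (c j \<odot>\<^bsub>B\<^esub> x j \<oplus>\<^bsub>B\<^esub> ?s) - pair a (c j \<odot>\<^bsub>B\<^esub> x j) - pair a ?s)
      + (pair a (c j \<odot>\<^bsub>B\<^esub> x j) - pm_scale (c j) (pair a (x j)))
      + (pair a ?s - (\<Sum>i\<in>S. pm_scale (c i) (pair a (x i)))) \<in> bilinear_rels A B"
    using carr s assms(3) insert.prems
    by (intro bilinear_rels_closed bilinear_rels_add_right bilinear_rels_smult_right insert.IH)
      (auto simp: B.smult_closed)
  then show ?case
    using insert.hyps carr by (simp add: MB.finsum_insert B.smult_closed algebra_simps)
qed

abbreviation basis_A :: "'g \<Rightarrow> 'a" where "basis_A \<equiv> basis_elem A \<alpha>"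
abbreviation basis_B :: "'g \<Rightarrow> 'b" where "basis_B \<equiv> basis_elem B \<beta>"

lemmas basis_A = basis_elem[OF transfer_A] and basis_B = basis_elem[OF transfer_B]
lemmas expansion_A = basis_elem_expansion[OF subgroups(1) transfer_A]
  and expansion_B = basis_elem_expansion[OF subgroups(2) transfer_B]

lemma pair_normal_form:
  assumes a: "a \<in> carrier A" and b: "b \<in> carrier B"
  shows "pair a b - (\<Sum>g\<in>\<Gamma>. \<Sum>h\<in>\<Delta>. pm_scale (\<alpha> a g * \<beta> b h) (pair (basis_A g) (basis_B h)))
    \<in> bilinear_rels A B"
proof -
  let ?l = "\<Sum>g\<in>\<Gamma>. pm_scale (\<alpha> a g) (pair (basis_A g) b)"
  let ?r = "\<lambda>g. \<Sum>h\<in>\<Delta>. pm_scale (\<beta> b h) (pair (basis_A g) (basis_B h))"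
  have "pair a b - ?l \<in> bilinear_rels A B"
    by (subst (1) expansion_A[OF a], rule bilinear_rels_lincomb_left)
      (use finite_subgroups basis_A b in auto)
  moreover have "pair (basis_A g) b - ?r g \<in> bilinear_rels A B" if "g \<in> \<Gamma>" for g
    by (subst (1) expansion_B[OF b], rule bilinear_rels_lincomb_right)
      (use finite_subgroups basis_A basis_B that in auto)
  \<comment> \<open>The left entry is expanded first, then the right entry inside every resulting
    term.\<close>
  ultimately have "(pair a b - ?l) + (\<Sum>g\<in>\<Gamma>. pm_scale (\<alpha> a g) (pair (basis_A g) b - ?r g))
      \<in> bilinear_rels A B"
    by (intro bilinear_rels_closed)
  then show ?thesis
    by (simp add: pm.scale_right_diff_distrib sum_subtractf pm.scale_sum_right pm.scale_scale)
qed

text \<open>Modulo the relations \<open>p\<close> is a combination of pairs of basis elements. The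
  coefficient at \<open>(g, h)\<close>, multiplied by the nonzero \<open>\<sigma> g h\<close>, is
  the value of \<open>tensor_eval p\<close> at the product of \<open>g\<close> and \<open>h\<close>;
  all coefficients therefore vanish.\<close>

lemma tensor_eval_eq_0_imp:
  assumes p: "p \<in> pair_space A B" and 0: "tensor_eval p = (\<lambda>_. 0)"
  shows "p \<in> bilinear_rels A B"
proof -
  let ?n = "\<lambda>u. \<Sum>g\<in>\<Gamma>. \<Sum>h\<in>\<Delta>. pm_scale (\<alpha> (fst u) g * \<beta> (snd u) h) (pair (basis_A g) (basis_B h))"
  let ?c = "Poly_Mapping.lookup p" and ?K = "Poly_Mapping.keys p"
  have "(\<Sum>u\<in>?K. pm_scale (?c u) (?n u)) =
      (\<Sum>u\<in>?K. \<Sum>g\<in>\<Gamma>. \<Sum>h\<in>\<Delta>. pm_scale (?c u * (\<alpha> (fst u) g * \<beta> (snd u) h)) (pair (basis_A g) (basis_B h)))"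
    by (simp add: pm.scale_sum_right pm.scale_scale)
  also have "\<dots> = (\<Sum>g\<in>\<Gamma>. \<Sum>u\<in>?K. \<Sum>h\<in>\<Delta>. pm_scale (?c u * (\<alpha> (fst u) g * \<beta> (snd u) h)) (pair (basis_A g) (basis_B h)))"
    by (rule sum.swap)
  also have "\<dots> = (\<Sum>g\<in>\<Gamma>. \<Sum>h\<in>\<Delta>. \<Sum>u\<in>?K. pm_scale (?c u * (\<alpha> (fst u) g * \<beta> (snd u) h)) (pair (basis_A g) (basis_B h)))"
    by (intro sum.cong refl sum.swap)
  also have "\<dots> = (\<Sum>g\<in>\<Gamma>. \<Sum>h\<in>\<Delta>. pm_scale (lin_ext (\<lambda>u. \<alpha> (fst u) g * \<beta> (snd u) h) p)
      (pair (basis_A g) (basis_B h)))"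
    by (simp add: pm.scale_sum_left lin_ext_def)
  also have "\<dots> = 0"
  proof (intro sum.neutral ballI)
    fix g h assume "g \<in> \<Gamma>" "h \<in> \<Delta>"
    then have "lin_ext (\<lambda>u. \<alpha> (fst u) g * \<beta> (snd u) h) p = 0"
      using tensor_eval_mult[OF p] nonzero 0 by (simp add: fun_eq_iff)
    then show "pm_scale (lin_ext (\<lambda>u. \<alpha> (fst u) g * \<beta> (snd u) h) p) (pair (basis_A g) (basis_B h)) = 0"
      by simp
  qed
  finally have n0: "(\<Sum>u\<in>?K. pm_scale (?c u) (?n u)) = 0" .
  have "pair (fst u) (snd u) - ?n u \<in> bilinear_rels A B" if "u \<in> ?K" for u
    using p that by (intro pair_normal_form) (auto simp: pair_space_def)
  then have "(\<Sum>u\<in>?K. pm_scale (?c u) (pair (fst u) (snd u) - ?n u)) \<in> bilinear_rels A B"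
    by (intro bilinear_rels_closed)
  then have "(\<Sum>u\<in>?K. pm_scale (?c u) (pair (fst u) (snd u))) \<in> bilinear_rels A B"
    using n0 by (simp add: pm.scale_right_diff_distrib sum_subtractf)
  then show ?thesis using poly_mapping_expansion_pm_scale[of p] by simp
qed

text \<open>Cosets become fibres of \<open>tensor_eval\<close>; the later arguments about
  representatives rest on this description and not on the generating relations.\<close>

lemma tensor_class_eq:
  assumes p: "p \<in> pair_space A B"
  shows "tensor_class A B p = {q \<in> pair_space A B. tensor_eval q = tensor_eval p}"
proof (intro equalityI subsetI)
  fix q assume "q \<in> tensor_class A B p"
  then obtain r where "q = p + r" "r \<in> bilinear_rels A B" by (auto simp: tensor_class_def)
  then show "q \<in> {q \<in> pair_space A B. tensor_eval q = tensor_eval p}"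
    using bilinear_rels_subset p by (auto simp: tensor_eval_add pair_space_closed)
next
  fix q assume q: "q \<in> {q \<in> pair_space A B. tensor_eval q = tensor_eval p}"
  then have "q - p \<in> bilinear_rels A B"
    using p by (intro tensor_eval_eq_0_imp) (auto simp: pair_space_closed tensor_eval_diff)
  then show "q \<in> tensor_class A B p" unfolding tensor_class_def
    by (intro CollectI exI[of _ "q - p"]) simp
qed

section \<open>Multiplicativity of the evaluation of tensors\<close>

lemma subgroup_prod: "subgroup (\<Gamma> <#> \<Delta>) G"
  by (rule mult_subgroups[OF subgroups])

text \<open>This is where the braiding enters: for \<open>g\<close> in \<open>\<Delta>\<close> and
  \<open>h\<close> in \<open>\<Gamma>\<close>, \<open>e_g e_h\<close> is \<open>R g h\<close> times
  \<open>e_h e_g\<close>. Off these supports both sides vanish term by term, so the sums may run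
  over all of \<open>G\<close>.\<close>

lemma mult_commute:
  assumes "f \<in> carrier (twisted_group_algebra G \<sigma> \<Gamma>)" "f' \<in> carrier (twisted_group_algebra G \<sigma> \<Delta>)"
  shows "M f' f = (\<lambda>k. \<Sum>g\<in>carrier G. \<Sum>h\<in>carrier G.
    (R g h * (f' g * f h)) * M (basis_fun h) (basis_fun g) k)"
proof
  fix k
  show "M f' f k = (\<Sum>g\<in>carrier G. \<Sum>h\<in>carrier G.
    (R g h * (f' g * f h)) * M (basis_fun h) (basis_fun g) k)"
    unfolding twisted_mult_def[of G \<sigma> f' f]
  proof (intro sum.cong refl)
    fix g h assume gh: "g \<in> carrier G" "h \<in> carrier G"
    show "of_bool (g \<otimes> h = k) * \<sigma> g h * f' g * f h =
        (R g h * (f' g * f h)) * M (basis_fun h) (basis_fun g) k"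
    proof (cases "g \<in> \<Delta> \<and> h \<in> \<Gamma>")
      case True
      then show ?thesis
        unfolding twisted_mult_basis[OF gh(2,1)]
        using gh commute[of h g] m_comm[OF gh] by (auto simp: basis_fun_def)
    next
      case False
      then show ?thesis using assms by auto
    qed
  qed
qed

lemma pair_mult_closed:
  assumes "u \<in> carrier A \<times> carrier B" "v \<in> carrier A \<times> carrier B"
  shows "pair_mult G R A B u v \<in> pair_space A B"
  unfolding pair_mult_def using assms
  by (intro pair_space_closed single_pair_space A.mult_closed B.mult_closed)
    (auto intro: homog_part_twisted(1)[OF subgroups(1) transfer_A] homog_part_twisted(1)[OF subgroups(2) transfer_B])

lemma tensor_eval_sum: "tensor_eval (\<Sum>i\<in>S. f i) = (\<lambda>k. \<Sum>i\<in>S. tensor_eval (f i) k)"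
  by (simp add: tensor_eval_def lin_ext_sum)

text \<open>By associativity the product of the images of two pairs has the middle factor
  \<open>\<beta> b\<close> times \<open>\<alpha> a'\<close>. Exchanging these two with
  \<open>mult_commute\<close> produces exactly the sum over degrees in
  \<open>pair_mult\<close>.\<close>

lemma tensor_eval_pair_mult:
  assumes "a \<in> carrier A" "b \<in> carrier B" "a' \<in> carrier A" "b' \<in> carrier B"
  shows "tensor_eval (pair_mult G R A B (a, b) (a', b')) = M (prod_fun (a, b)) (prod_fun (a', b'))"
proof -
  let ?C = "carrier G"
  let ?E = "basis_fun :: 'g \<Rightarrow> 'g \<Rightarrow> 'k"
  have fin: "finite ?C" by (rule finite_carrier)
  have "tensor_eval (pair_mult G R A B (a, b) (a', b')) = (\<lambda>k. \<Sum>g\<in>?C. \<Sum>h\<in>?C. R g h *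
      prod_fun (a \<otimes>\<^bsub>A\<^esub> homog_part G A h a', homog_part G B g b \<otimes>\<^bsub>B\<^esub> b') k)"
    by (simp add: pair_mult_def tensor_eval_sum tensor_eval_pm_scale tensor_eval_single)
  also have "\<dots> = (\<lambda>k. \<Sum>g\<in>?C. \<Sum>h\<in>?C. R g h *
      M (M (\<alpha> a) (\<lambda>k. \<alpha> a' h * ?E h k)) (M (\<lambda>k. \<beta> b g * ?E g k) (\<beta> b')) k)"
    by (intro ext sum.cong refl)
      (simp add: prod_fun_def A.mult B.mult assms
        homog_part_twisted[OF subgroups(1) transfer_A] homog_part_twisted[OF subgroups(2) transfer_B])
  also have "\<dots> = (\<lambda>k. \<Sum>g\<in>?C. \<Sum>h\<in>?C. (R g h * (\<beta> b g * \<alpha> a' h)) *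
      M (\<alpha> a) (M (M (?E h) (?E g)) (\<beta> b')) k)"
    unfolding twisted_mult_smult_left twisted_mult_smult_right twisted_mult_assoc
    by (simp add: ac_simps)
  also have "\<dots> = M (\<alpha> a) (M (\<lambda>k. \<Sum>g\<in>?C. \<Sum>h\<in>?C. (R g h * (\<beta> b g * \<alpha> a' h)) * M (?E h) (?E g) k) (\<beta> b'))"
    by (simp add: twisted_mult_sum_left[OF fin] twisted_mult_sum_right[OF fin]
        twisted_mult_smult_left twisted_mult_smult_right)
  also have "\<dots> = M (\<alpha> a) (M (M (\<beta> b) (\<alpha> a')) (\<beta> b'))"
    using mult_commute[OF A.image_closed B.image_closed, of a' b] assms by simp
  also have "\<dots> = M (prod_fun (a, b)) (prod_fun (a', b'))"
    by (simp add: prod_fun_def twisted_mult_assoc)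
  finally show ?thesis .
qed

lemma pair_space_mult_closed:
  assumes "p \<in> pair_space A B" "q \<in> pair_space A B"
  shows "pair_space_mult G R A B p q \<in> pair_space A B"
  unfolding pair_space_mult_def using assms
  by (intro pair_space_closed pair_mult_closed) (auto simp: pair_space_def)

lemma tensor_eval_pair_space_mult:
  assumes "p \<in> pair_space A B" "q \<in> pair_space A B"
  shows "tensor_eval (pair_space_mult G R A B p q) = M (tensor_eval p) (tensor_eval q)"
proof -
  let ?K = "Poly_Mapping.keys" and ?c = "Poly_Mapping.lookup"
  have "tensor_eval (pair_space_mult G R A B p q) =
      (\<lambda>k. \<Sum>u\<in>?K p. \<Sum>v\<in>?K q. (?c p u * ?c q v) * tensor_eval (pair_mult G R A B u v) k)"
    by (simp add: pair_space_mult_def tensor_eval_sum tensor_eval_pm_scale)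
  also have "\<dots> = (\<lambda>k. \<Sum>u\<in>?K p. \<Sum>v\<in>?K q. (?c p u * ?c q v) * M (prod_fun u) (prod_fun v) k)"
  proof (intro ext sum.cong refl)
    fix u v k assume "u \<in> ?K p" "v \<in> ?K q"
    then have "u \<in> carrier A \<times> carrier B" "v \<in> carrier A \<times> carrier B"
      using assms by (auto simp: pair_space_def)
    then show "(?c p u * ?c q v) * tensor_eval (pair_mult G R A B u v) k =
        (?c p u * ?c q v) * M (prod_fun u) (prod_fun v) k"
      by (auto simp: tensor_eval_pair_mult)
  qed
  also have "\<dots> = M (tensor_eval p) (tensor_eval q)"
    by (simp add: tensor_eval_def lin_ext_def twisted_mult_sum_left twisted_mult_sum_right
        twisted_mult_smult_left twisted_mult_smult_right sum_distrib_left mult.assoc)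
  finally show ?thesis .
qed

section \<open>Image and homogeneous components of the evaluation of tensors\<close>

lemma tensor_eval_carrier:
  "p \<in> pair_space A B \<Longrightarrow> tensor_eval p \<in> carrier (twisted_group_algebra G \<sigma> (\<Gamma> <#> \<Delta>))"
  using tensor_eval_outside by simp

lemma tensor_eval_single_basis:
  assumes "g \<in> \<Gamma>" "h \<in> \<Delta>"
  shows "tensor_eval (Poly_Mapping.single (basis_A g, basis_B h) c) = (\<lambda>k. c * \<sigma> g h * basis_fun (g \<otimes> h) k)"
  using assms by (simp add: tensor_eval_single prod_fun_def basis_A basis_B twisted_mult_basis mult.assoc)

lemma tensor_eval_surj: "tensor_eval ` pair_space A B = carrier (twisted_group_algebra G \<sigma> (\<Gamma> <#> \<Delta>))"
proof (intro equalityI subsetI)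
  fix f assume f: "f \<in> carrier (twisted_group_algebra G \<sigma> (\<Gamma> <#> \<Delta>))"
  \<comment> \<open>Division by \<open>\<sigma> g h\<close> compensates the factor that a pair of
    basis elements acquires when evaluated.\<close>
  define p where "p = (\<Sum>g\<in>\<Gamma>. \<Sum>h\<in>\<Delta>.
    Poly_Mapping.single (basis_A g, basis_B h) (f (g \<otimes> h) / \<sigma> g h))"
  have p: "p \<in> pair_space A B" unfolding p_def
    by (intro pair_space_closed single_pair_space) (auto simp: basis_A basis_B)
  have "tensor_eval p = f"
  proof
    fix k
    show "tensor_eval p k = f k"
    proof (cases "k \<in> \<Gamma> <#> \<Delta>")
      case True
      then obtain x y where xy: "x \<in> \<Gamma>" "y \<in> \<Delta>" "k = x \<otimes> y" by (auto simp: set_mult_def)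
      have "tensor_eval p k = (\<Sum>g\<in>\<Gamma>. \<Sum>h\<in>\<Delta>. f (g \<otimes> h) / \<sigma> g h * \<sigma> g h * basis_fun (g \<otimes> h) k)"
        unfolding p_def tensor_eval_sum by (intro sum.cong refl) (simp add: tensor_eval_single_basis)
      also have "\<dots> = (\<Sum>g\<in>\<Gamma>. \<Sum>h\<in>\<Delta>. of_bool (x = g) * (of_bool (y = h) * f (g \<otimes> h)))"
        by (intro sum.cong refl) (use nonzero xy in \<open>auto simp: basis_fun_def mult_eq_iff\<close>)
      also have "\<dots> = f (x \<otimes> y)"
        using xy finite_subgroups by (simp add: sum_of_bool_eq flip: sum_distrib_left)
      finally show ?thesis using xy by simp
    next
      case False
      then show ?thesis using f tensor_eval_outside[OF p] by simp
    qed
  qed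
  with p show "f \<in> tensor_eval ` pair_space A B" by blast
qed (use tensor_eval_carrier in auto)

definition homog_reps :: "'g \<Rightarrow> ('a \<times> 'b \<Rightarrow>\<^sub>0 'k) set" where
  "homog_reps g = {p. \<forall>(a, b)\<in>Poly_Mapping.keys p. \<exists>h\<in>carrier G. \<exists>h'\<in>carrier G.
              h \<otimes> h' = g \<and> a \<in> homog A h \<and> b \<in> homog B h'}"

lemma homog_reps_subset: "homog_reps g \<subseteq> pair_space A B"
proof
  fix p assume p: "p \<in> homog_reps g"
  have "u \<in> carrier A \<times> carrier B" if u: "u \<in> Poly_Mapping.keys p" for u
  proof -
    obtain a b where ab: "u = (a, b)" by (cases u)
    then obtain h h' where "h \<in> carrier G" "h' \<in> carrier G" "a \<in> homog A h" "b \<in> homog B h'"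
      using p u by (auto simp: homog_reps_def)
    then show ?thesis using ab A.homog_subset[of h] B.homog_subset[of h'] by auto
  qed
  then show "p \<in> pair_space A B" by (auto simp: pair_space_def)
qed

lemma tensor_eval_homog_reps:
  "tensor_eval ` homog_reps g = homog (twisted_group_algebra G \<sigma> (\<Gamma> <#> \<Delta>)) g"
proof (intro equalityI subsetI)
  fix f assume "f \<in> tensor_eval ` homog_reps g"
  then obtain p where p: "p \<in> homog_reps g" "f = tensor_eval p" by blast
  have "tensor_eval p k = 0" if "k \<noteq> g" for k
    unfolding tensor_eval_def lin_ext_def
  proof (intro sum.neutral ballI)
    fix u assume "u \<in> Poly_Mapping.keys p"
    then obtain h h' where h: "h \<in> carrier G" "h' \<in> carrier G" "h \<otimes> h' = g"
      "fst u \<in> homog A h" "snd u \<in> homog B h'"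
      using p(1) by (fastforce simp: homog_reps_def)
    have "\<alpha> (fst u) \<in> homog (twisted_group_algebra G \<sigma> \<Gamma>) h" "\<beta> (snd u) \<in> homog (twisted_group_algebra G \<sigma> \<Delta>) h'"
      using A.homog_image[OF h(1)] B.homog_image[OF h(2)] h(4,5) by blast+
    then have "prod_fun u k = 0"
      unfolding prod_fun_def using h(3) \<open>k \<noteq> g\<close> by (intro twisted_mult_eq_0_outside) auto
    then show "Poly_Mapping.lookup p u * prod_fun u k = 0" by simp
  qed
  moreover have "tensor_eval p k = 0" if "k \<notin> \<Gamma> <#> \<Delta>" for k
    using p(1) homog_reps_subset tensor_eval_outside that by blast
  ultimately show "f \<in> homog (twisted_group_algebra G \<sigma> (\<Gamma> <#> \<Delta>)) g" using p(2) by auto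
next
  fix f assume f: "f \<in> homog (twisted_group_algebra G \<sigma> (\<Gamma> <#> \<Delta>)) g"
  show "f \<in> tensor_eval ` homog_reps g"
  proof (cases "g \<in> \<Gamma> <#> \<Delta>")
    case True
    then obtain x y where xy: "x \<in> \<Gamma>" "y \<in> \<Delta>" "g = x \<otimes> y" by (auto simp: set_mult_def)
    define p where "p = Poly_Mapping.single (basis_A x, basis_B y) (f g / \<sigma> x y)"
    have "basis_A x \<in> homog A x" "basis_B y \<in> homog B y"
      using xy by (auto simp: A.homog_iff B.homog_iff basis_A basis_B basis_fun_def)
    then have "\<exists>h\<in>carrier G. \<exists>h'\<in>carrier G. h \<otimes> h' = g \<and> basis_A x \<in> homog A h \<and> basis_B y \<in> homog B h'"
      using xy by (intro bexI[of _ x] bexI[of _ y]) auto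
    then have "p \<in> homog_reps g" by (auto simp: homog_reps_def p_def)
    moreover have "tensor_eval p = f"
      unfolding p_def using xy f nonzero by (auto simp: tensor_eval_single_basis basis_fun_def)
    ultimately show ?thesis by blast
  next
    \<comment> \<open>No product of a degree in \<open>\<Gamma>\<close> with one in
      \<open>\<Delta>\<close> equals \<open>g\<close>, so \<open>f\<close> is zero. The zero
      combination is a representative vacuously, having no keys.\<close>
    case False
    then have "f = tensor_eval 0" using f by (auto simp: tensor_eval_zero fun_eq_iff)
    moreover have "0 \<in> homog_reps g" by (simp add: homog_reps_def)
    ultimately show ?thesis by blast
  qed
qed

lemma tensor_class_eq_iff:
  assumes "p \<in> pair_space A B" "q \<in> pair_space A B"
  shows "tensor_class A B p = tensor_class A B q \<longleftrightarrow> tensor_eval p = tensor_eval q"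
  using assms by (auto simp: tensor_class_eq)

lemma mem_tensor_class: "p \<in> pair_space A B \<Longrightarrow> p \<in> tensor_class A B p"
  by (simp add: tensor_class_eq)

text \<open>The operations of \<open>braided_tensor\<close> are unions over all representatives.
  When \<open>F\<close> respects the fibres of \<open>tensor_eval\<close>, all members of the union
  coincide and it collapses to one class.\<close>

lemma tensor_class_UNION1:
  assumes p: "p \<in> pair_space A B"
    and F: "\<And>p'. p' \<in> pair_space A B \<Longrightarrow> tensor_eval p' = tensor_eval p \<Longrightarrow> F p' \<in> pair_space A B \<and> tensor_eval (F p') = tensor_eval (F p)"
  shows "(\<Union>p'\<in>tensor_class A B p. tensor_class A B (F p')) = tensor_class A B (F p)"
proof -
  have "tensor_class A B (F p') = tensor_class A B (F p)" if "p' \<in> tensor_class A B p" for p'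
    using that F[OF p refl] F[of p'] by (simp add: tensor_class_eq p tensor_class_eq_iff)
  then show ?thesis using mem_tensor_class[OF p] by blast
qed

lemma tensor_class_UNION2:
  assumes p: "p \<in> pair_space A B" and q: "q \<in> pair_space A B"
    and F: "\<And>p' q'. \<lbrakk>p' \<in> pair_space A B; tensor_eval p' = tensor_eval p; q' \<in> pair_space A B; tensor_eval q' = tensor_eval q\<rbrakk> \<Longrightarrow>
      F p' q' \<in> pair_space A B \<and> tensor_eval (F p' q') = tensor_eval (F p q)"
  shows "(\<Union>p'\<in>tensor_class A B p. \<Union>q'\<in>tensor_class A B q. tensor_class A B (F p' q')) =
    tensor_class A B (F p q)"
proof -
  have "tensor_class A B (F p' q') = tensor_class A B (F p q)"
    if "p' \<in> tensor_class A B p" "q' \<in> tensor_class A B q" for p' q'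
    using that F[OF p refl q refl] F[of p' q'] by (simp add: tensor_class_eq p q tensor_class_eq_iff)
  then show ?thesis using mem_tensor_class[OF p] mem_tensor_class[OF q] by blast
qed

theorem braided_tensor_iso:
  "graded_alg_iso G (braided_tensor G R A B) (twisted_group_algebra G \<sigma> (\<Gamma> <#> \<Delta>))"
proof (rule graded_alg_iso_quotient[where cls = "tensor_class A B" and P = "pair_space A B" and F = tensor_eval])
  show "graded_algebra G (twisted_group_algebra G \<sigma> (\<Gamma> <#> \<Delta>))"
    by (rule graded_algebra_twisted[OF subgroup_prod])
  show "carrier (braided_tensor G R A B) = tensor_class A B ` pair_space A B"
    by (simp add: braided_tensor_def)
  show "\<exists>r\<in>pair_space A B. \<zero>\<^bsub>braided_tensor G R A B\<^esub> = tensor_class A B r \<and>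
      tensor_eval r = \<zero>\<^bsub>twisted_group_algebra G \<sigma> (\<Gamma> <#> \<Delta>)\<^esub>"
    by (rule bexI[of _ 0]) (simp_all add: braided_tensor_def tensor_eval_zero pair_space_closed)
  show "\<exists>r\<in>pair_space A B. \<one>\<^bsub>braided_tensor G R A B\<^esub> = tensor_class A B r \<and>
      tensor_eval r = \<one>\<^bsub>twisted_group_algebra G \<sigma> (\<Gamma> <#> \<Delta>)\<^esub>"
    by (rule bexI[of _ "pair \<one>\<^bsub>A\<^esub> \<one>\<^bsub>B\<^esub>"])
      (simp_all add: braided_tensor_def tensor_eval_single prod_fun_def A.one B.one twisted_mult_basis
        cocycle_one single_pair_space A.one_closed B.one_closed)
  fix p q assume p: "p \<in> pair_space A B" and q: "q \<in> pair_space A B"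
  show "\<exists>r\<in>pair_space A B. tensor_class A B p \<oplus>\<^bsub>braided_tensor G R A B\<^esub> tensor_class A B q = tensor_class A B r \<and>
      tensor_eval r = tensor_eval p \<oplus>\<^bsub>twisted_group_algebra G \<sigma> (\<Gamma> <#> \<Delta>)\<^esub> tensor_eval q"
    using p q by (intro bexI[of _ "p + q"])
      (simp_all add: braided_tensor_def tensor_eval_add pair_space_closed tensor_class_UNION2)
  show "\<exists>r\<in>pair_space A B. tensor_class A B p \<otimes>\<^bsub>braided_tensor G R A B\<^esub> tensor_class A B q = tensor_class A B r \<and>
      tensor_eval r = tensor_eval p \<otimes>\<^bsub>twisted_group_algebra G \<sigma> (\<Gamma> <#> \<Delta>)\<^esub> tensor_eval q"
    using p q by (intro bexI[of _ "pair_space_mult G R A B p q"])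
      (simp_all add: braided_tensor_def tensor_eval_pair_space_mult pair_space_mult_closed tensor_class_UNION2)
next
  fix c p assume p: "p \<in> pair_space A B"
  show "\<exists>r\<in>pair_space A B. c \<odot>\<^bsub>braided_tensor G R A B\<^esub> tensor_class A B p = tensor_class A B r \<and>
      tensor_eval r = c \<odot>\<^bsub>twisted_group_algebra G \<sigma> (\<Gamma> <#> \<Delta>)\<^esub> tensor_eval p"
    using p by (intro bexI[of _ "pm_scale c p"])
      (simp_all add: braided_tensor_def tensor_eval_pm_scale pair_space_closed tensor_class_UNION1)
next
  fix g assume "g \<in> carrier G"
  show "\<exists>H\<subseteq>pair_space A B. homog (braided_tensor G R A B) g = tensor_class A B ` H \<and>
      tensor_eval ` H = homog (twisted_group_algebra G \<sigma> (\<Gamma> <#> \<Delta>)) g"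
    by (intro exI[of _ "homog_reps g"] conjI homog_reps_subset tensor_eval_homog_reps)
      (simp add: braided_tensor_def homog_reps_def)
qed (auto simp: tensor_eval_surj tensor_class_eq_iff intro: is_monoid)

end

section \<open>The cocycle of the generalized Clifford algebra\<close>

lemma carrier_Zn_power: "0 < n \<Longrightarrow> carrier (Zn_power n m) = (\<Pi>\<^sub>E i\<in>{1..m}. {0..<int n})"
  by (simp add: Zn_power_def carrier_integer_mod_group)

lemma mult_Zn_power: "x \<otimes>\<^bsub>Zn_power n m\<^esub> y = (\<lambda>i\<in>{1..m}. (x i + y i) mod int n)"
  by (simp add: Zn_power_def)

lemma one_Zn_power: "\<one>\<^bsub>Zn_power n m\<^esub> = (\<lambda>i\<in>{1..m}. 0)"
  by (simp add: Zn_power_def)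

lemma comm_group_Zn_power: "comm_group (Zn_power n m)"
proof (rule group.group_comm_groupI)
  show "group (Zn_power n m)" by (simp add: Zn_power_def)
  show "x \<otimes>\<^bsub>Zn_power n m\<^esub> y = y \<otimes>\<^bsub>Zn_power n m\<^esub> x" for x y
    by (simp add: mult_Zn_power add.commute)
qed

text \<open>The exponent of \<open>\<omega>\<close> when two ordered monomials are merged: moving
  \<open>e_j^(y j)\<close> left past \<open>e_i^(x i)\<close> with \<open>j < i\<close> contributes
  \<open>x i * y j\<close>.\<close>

definition pairing :: "nat \<Rightarrow> (nat \<Rightarrow> int) \<Rightarrow> (nat \<Rightarrow> int) \<Rightarrow> int" where
  "pairing m x y = (\<Sum>i\<in>{1..m}. \<Sum>j\<in>{1..<i}. x i * y j)"

definition gca_cocycle ::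
    "nat \<Rightarrow> 'k::field \<Rightarrow> nat \<Rightarrow> (nat \<Rightarrow> 'k) \<Rightarrow> (nat \<Rightarrow> int) \<Rightarrow> (nat \<Rightarrow> int) \<Rightarrow> 'k" where
  "gca_cocycle n \<omega> m q x y =
     \<omega> powi pairing m x y * (\<Prod>i\<in>{1..m}. q i ^ nat ((x i + y i) div int n))"

text \<open>Here \<open>z\<close> stands for the sum of \<open>x\<close> and \<open>y\<close> after
  reduction of coordinates. The pairing is bilinear over the integers, so reduction disturbs
  additivity only by multiples of \<open>d\<close>, and for \<open>d = n\<close> the powers of
  \<open>\<omega>\<close> do not see these.\<close>

lemma pairing_dvd_left:
  assumes "\<And>i. i \<in> {1..m} \<Longrightarrow> d dvd z i - x i - y i"
  shows "d dvd pairing m z t - (pairing m x t + pairing m y t)"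
proof -
  have "pairing m z t - (pairing m x t + pairing m y t) =
      (\<Sum>i\<in>{1..m}. \<Sum>j\<in>{1..<i}. (z i - x i - y i) * t j)"
    by (simp add: pairing_def left_diff_distrib sum_subtractf)
  also have "d dvd \<dots>" using assms by (intro dvd_sum dvd_mult2)
  finally show ?thesis .
qed

lemma pairing_dvd_right:
  assumes "\<And>i. i \<in> {1..m} \<Longrightarrow> d dvd z i - x i - y i"
  shows "d dvd pairing m t z - (pairing m t x + pairing m t y)"
proof -
  have "pairing m t z - (pairing m t x + pairing m t y) =
      (\<Sum>i\<in>{1..m}. \<Sum>j\<in>{1..<i}. t i * (z j - x j - y j))"
    by (simp add: pairing_def right_diff_distrib sum_subtractf)
  also have "d dvd \<dots>" using assms by (intro dvd_sum dvd_mult) auto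
  finally show ?thesis .
qed

text \<open>Both sides equal the total carry \<open>(a + b + c) div n\<close>, so carrying satisfies
  the additive cocycle identity.\<close>

lemma div_carry_assoc:
  fixes a b c n :: int
  assumes "0 < n"
  shows "(a + b) div n + ((a + b) mod n + c) div n = (b + c) div n + (a + (b + c) mod n) div n"
proof -
  have "(x + y) div n = x div n + (x mod n + y) div n" for x y
  proof -
    have "x + y = (x mod n + y) + x div n * n" by simp
    then show ?thesis using assms by (simp only: div_mult_self1)
  qed
  from this[of "a + b" c] this[of "b + c" a] show ?thesis by (simp add: ac_simps)
qed

locale clifford_params =
  fixes n m :: nat and \<omega> :: "'k::field" and q :: "nat \<Rightarrow> 'k"
  assumes n: "n \<ge> 2" and root: "\<omega> ^ n = 1" and q_nonzero: "\<And>i. i \<in> {1..m} \<Longrightarrow> q i \<noteq> 0"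
begin

abbreviation G where "G \<equiv> Zn_power n m"
abbreviation \<sigma> where "\<sigma> \<equiv> gca_cocycle n \<omega> m q"

lemma \<omega>_nonzero: "\<omega> \<noteq> 0"
  using root n by (auto simp: zero_power)

lemma \<omega>_powi_eq:
  assumes "int n dvd a - b"
  shows "\<omega> powi a = \<omega> powi b"
proof -
  from assms obtain k where "a = int n * k + b" by (metis diff_add_cancel dvdE)
  then show ?thesis using \<omega>_nonzero root by (simp add: power_int_add power_int_mult)
qed

lemma carrier_G: "carrier G = (\<Pi>\<^sub>E i\<in>{1..m}. {0..<int n})"
  using n by (simp add: carrier_Zn_power)

lemma G_range: "x \<in> carrier G \<Longrightarrow> i \<in> {1..m} \<Longrightarrow> 0 \<le> x i \<and> x i < int n"
  unfolding carrier_G by (auto dest!: PiE_mem)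

lemma G_mod: "x \<in> carrier G \<Longrightarrow> i \<in> {1..m} \<Longrightarrow> x i mod int n = x i"
  using G_range by (simp add: mod_pos_pos_trivial)

lemma G_ext: "x \<in> carrier G \<Longrightarrow> y \<in> carrier G \<Longrightarrow> (\<And>i. i \<in> {1..m} \<Longrightarrow> x i = y i) \<Longrightarrow> x = y"
  unfolding carrier_G by (rule PiE_ext)

lemma mult_dvd: "i \<in> {1..m} \<Longrightarrow> int n dvd (x \<otimes>\<^bsub>G\<^esub> y) i - x i - y i"
  by (simp add: mult_Zn_power) (metis add_diff_eq diff_diff_eq2 dvd_minus_mod dvd_minus_iff minus_diff_eq
      diff_diff_add)

sublocale group_cocycle G \<sigma>
proof (intro group_cocycle.intro comm_group_Zn_power group_cocycle_axioms.intro)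
  show "finite (carrier G)" unfolding carrier_G by (intro finite_PiE) auto
next
  fix g h k assume g: "g \<in> carrier G" and h: "h \<in> carrier G" and k: "k \<in> carrier G"
  have "\<omega> powi (pairing m g h + pairing m (g \<otimes>\<^bsub>G\<^esub> h) k) = \<omega> powi (pairing m g (h \<otimes>\<^bsub>G\<^esub> k) + pairing m h k)"
  proof (rule \<omega>_powi_eq)
    \<comment> \<open>Each bracket is a failure of additivity caused by reduction modulo
      \<open>n\<close>; the term \<open>pairing m g k\<close> cancels in their difference.\<close>
    have "int n dvd (pairing m (g \<otimes>\<^bsub>G\<^esub> h) k - (pairing m g k + pairing m h k)) -
        (pairing m g (h \<otimes>\<^bsub>G\<^esub> k) - (pairing m g h + pairing m g k))"
      by (intro dvd_diff pairing_dvd_left pairing_dvd_right mult_dvd)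
    then show "int n dvd pairing m g h + pairing m (g \<otimes>\<^bsub>G\<^esub> h) k -
        (pairing m g (h \<otimes>\<^bsub>G\<^esub> k) + pairing m h k)"
      by (simp add: algebra_simps)
  qed
  moreover have "(\<Prod>i\<in>{1..m}. q i ^ nat ((g i + h i) div int n) * q i ^ nat (((g \<otimes>\<^bsub>G\<^esub> h) i + k i) div int n)) =
      (\<Prod>i\<in>{1..m}. q i ^ nat ((g i + (h \<otimes>\<^bsub>G\<^esub> k) i) div int n) * q i ^ nat ((h i + k i) div int n))"
  proof (rule prod.cong[OF refl])
    fix i assume i: "i \<in> {1..m}"
    \<comment> \<open>Nonnegativity is essential: \<open>nat\<close> would truncate a negative carry
      and would not be additive.\<close>
    have "0 \<le> g i" "0 \<le> h i" "0 \<le> k i" using G_range i g h k by blast+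
    then have "nat ((g i + h i) div int n) + nat (((g i + h i) mod int n + k i) div int n) =
        nat ((g i + (h i + k i) mod int n) div int n) + nat ((h i + k i) div int n)"
      using div_carry_assoc[of "int n" "g i" "h i" "k i"] n
      by (simp add: pos_imp_zdiv_nonneg_iff flip: nat_add_distrib)
    then show "q i ^ nat ((g i + h i) div int n) * q i ^ nat (((g \<otimes>\<^bsub>G\<^esub> h) i + k i) div int n) =
        q i ^ nat ((g i + (h \<otimes>\<^bsub>G\<^esub> k) i) div int n) * q i ^ nat ((h i + k i) div int n)"
      using i by (simp add: mult_Zn_power flip: power_add)
  qed
  ultimately show "\<sigma> g h * \<sigma> (g \<otimes>\<^bsub>G\<^esub> h) k = \<sigma> g (h \<otimes>\<^bsub>G\<^esub> k) * \<sigma> h k"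
    using \<omega>_nonzero by (simp add: gca_cocycle_def prod.distrib power_int_add ac_simps)
next
  fix g assume g: "g \<in> carrier G"
  have "pairing m \<one>\<^bsub>G\<^esub> g = 0" "pairing m g \<one>\<^bsub>G\<^esub> = 0"
    unfolding pairing_def by (auto simp: one_Zn_power intro!: sum.neutral)
  moreover have "(\<one>\<^bsub>G\<^esub> i + g i) div int n = 0" "(g i + \<one>\<^bsub>G\<^esub> i) div int n = 0" if "i \<in> {1..m}" for i
    using G_range[OF g that] that by (auto simp: one_Zn_power)
  ultimately show "\<sigma> \<one>\<^bsub>G\<^esub> g = 1 \<and> \<sigma> g \<one>\<^bsub>G\<^esub> = 1"
    by (simp add: gca_cocycle_def)
qed

lemma R_GCA_eq: "R_GCA \<omega> m g h = \<omega> powi (pairing m g h - pairing m h g)"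
  by (simp add: R_GCA_def pairing_def sum_subtractf mult.commute)

text \<open>The carry factors are symmetric in the two arguments, so exchanging them only
  antisymmetrises the exponent of \<open>\<omega>\<close>, and the antisymmetrised pairing is the
  exponent in \<open>R_GCA\<close>.\<close>

lemma cocycle_swap: "\<sigma> h g = R_GCA \<omega> m h g * \<sigma> g h"
  using \<omega>_nonzero by (simp add: R_GCA_eq gca_cocycle_def power_int_diff add.commute)

lemma cocycle_nonzero: "\<sigma> g h \<noteq> 0"
  using \<omega>_nonzero q_nonzero by (simp add: gca_cocycle_def)

section \<open>Subgroups of tuples with prescribed support\<close>

definition supp_group :: "nat set \<Rightarrow> (nat \<Rightarrow> int) set" where
  "supp_group I = {g \<in> carrier G. \<forall>i\<in>{1..m} - I. g i = 0}"

lemma subgroup_supp_group: "subgroup (supp_group I) G"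
proof (rule subgroupI)
  show "supp_group I \<noteq> {}" using one_closed by (auto simp: supp_group_def one_Zn_power)
  fix x assume x: "x \<in> supp_group I"
  then have "inv\<^bsub>G\<^esub> x = (\<lambda>i\<in>{1..m}. (- x i) mod int n)"
    using n unfolding supp_group_def Zn_power_def
    by (subst inv_product_group) (auto intro!: restrict_ext dest!: PiE_mem)
  then show "inv\<^bsub>G\<^esub> x \<in> supp_group I" using x inv_closed[of x] by (simp add: supp_group_def)
  fix y assume y: "y \<in> supp_group I"
  then have "x \<otimes>\<^bsub>G\<^esub> y \<in> carrier G" using x by (simp add: supp_group_def)
  then show "x \<otimes>\<^bsub>G\<^esub> y \<in> supp_group I" using x y by (simp add: supp_group_def mult_Zn_power)
qed (auto simp: supp_group_def)

text \<open>On disjoint supports at most one summand is nonzero in each coordinate, hence no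
  reduction takes place and both factors can be read off their product.\<close>

lemma supp_group_mult_coord:
  assumes "I \<inter> J = {}" "g \<in> supp_group I" "h \<in> supp_group J" "i \<in> {1..m}"
  shows "(g \<otimes>\<^bsub>G\<^esub> h) i = (if i \<in> I then g i else if i \<in> J then h i else 0)"
  using assms by (auto simp: supp_group_def mult_Zn_power G_mod)

lemma inj_on_supp_group_mult:
  assumes "I \<inter> J = {}"
  shows "inj_on (\<lambda>(g, h). g \<otimes>\<^bsub>G\<^esub> h) (supp_group I \<times> supp_group J)"
proof (intro inj_onI; clarsimp)
  fix g h g' h' assume *: "g \<in> supp_group I" "h \<in> supp_group J" "g' \<in> supp_group I" "h' \<in> supp_group J"
    "g \<otimes>\<^bsub>G\<^esub> h = g' \<otimes>\<^bsub>G\<^esub> h'"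
  have eq: "(if i \<in> I then g i else if i \<in> J then h i else 0) =
      (if i \<in> I then g' i else if i \<in> J then h' i else 0)" if "i \<in> {1..m}" for i
    using supp_group_mult_coord[OF assms *(1,2) that] supp_group_mult_coord[OF assms *(3,4) that] *(5)
    by simp
  have carr: "x \<in> carrier G" "i \<in> {1..m} \<Longrightarrow> i \<notin> S \<Longrightarrow> x i = 0" if "x \<in> supp_group S" for x S i
    using that by (auto simp: supp_group_def)
  show "g = g' \<and> h = h'"
  proof (intro conjI G_ext)
    fix i assume i: "i \<in> {1..m}"
    show "g i = g' i"
      using eq[OF i] carr(2)[OF *(1) i] carr(2)[OF *(3) i] by (cases "i \<in> I") auto
    show "h i = h' i"
      using eq[OF i] carr(2)[OF *(2) i] carr(2)[OF *(4) i] assms by (cases "i \<in> J") (auto simp: disjoint_iff split: if_splits)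
  qed (use carr(1) * in auto)
qed

lemma supp_group_Un:
  assumes "I \<inter> J = {}"
  shows "supp_group I <#>\<^bsub>G\<^esub> supp_group J = supp_group (I \<union> J)"
proof (intro equalityI subsetI)
  fix x assume "x \<in> supp_group I <#>\<^bsub>G\<^esub> supp_group J"
  then obtain g h where gh: "g \<in> supp_group I" "h \<in> supp_group J" "x = g \<otimes>\<^bsub>G\<^esub> h"
    by (auto simp: set_mult_def)
  then have "x \<in> carrier G" by (simp add: supp_group_def)
  then show "x \<in> supp_group (I \<union> J)"
    using supp_group_mult_coord[OF assms gh(1,2)] gh(3) by (simp add: supp_group_def)
next
  fix x assume x: "x \<in> supp_group (I \<union> J)"
  define part where "part S = (\<lambda>i\<in>{1..m}. if i \<in> S then x i else 0)" for S
  have range: "0 \<le> x i \<and> x i < int n" if "i \<in> {1..m}" for i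
    using G_range[of x i] that x by (simp add: supp_group_def)
  have part: "part S \<in> supp_group S" for S
    using range n unfolding supp_group_def part_def carrier_G by auto
  have "part I \<otimes>\<^bsub>G\<^esub> part J = x"
  proof (rule G_ext)
    show "part I \<otimes>\<^bsub>G\<^esub> part J \<in> carrier G" "x \<in> carrier G"
      using part[of I] part[of J] x by (simp_all add: supp_group_def)
    fix i assume i: "i \<in> {1..m}"
    then show "(part I \<otimes>\<^bsub>G\<^esub> part J) i = x i"
      using supp_group_mult_coord[OF assms part part i] x by (auto simp: part_def supp_group_def)
  qed
  then show "x \<in> supp_group I <#>\<^bsub>G\<^esub> supp_group J"
    using part[of I] part[of J] unfolding set_mult_def by blast
qed

abbreviation model :: "nat set \<Rightarrow> ('k, nat \<Rightarrow> int, (nat \<Rightarrow> int) \<Rightarrow> 'k) graded_alg" where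
  "model I \<equiv> twisted_group_algebra G \<sigma> (supp_group I)"

text \<open>The step on which induction over bracketings runs: hypotheses and conclusion have the
  same shape, whatever the element types of the factors.\<close>

lemma braided_tensor_model:
  assumes disj: "I \<inter> J = {}" and A: "graded_alg_iso G A (model I)" and B: "graded_alg_iso G B (model J)"
  shows "graded_alg_iso G (braided_tensor G (R_GCA \<omega> m) A B) (model (I \<union> J))"
proof -
  obtain \<alpha> where \<alpha>: "graded_transfer G A (model I) \<alpha>" by (rule graded_alg_isoE[OF is_monoid A])
  obtain \<beta> where \<beta>: "graded_transfer G B (model J) \<beta>" by (rule graded_alg_isoE[OF is_monoid B])
  interpret braided_factors G \<sigma> "R_GCA \<omega> m" "supp_group I" "supp_group J" A \<alpha> B \<beta>
    by (intro braided_factors.intro group_cocycle_axioms braided_factors_axioms.intro)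
      (simp_all add: subgroup_supp_group inj_on_supp_group_mult disj cocycle_swap[symmetric]
        cocycle_nonzero \<alpha> \<beta>)
  show ?thesis using braided_tensor_iso by (simp add: supp_group_Un disj)
qed

end

section \<open>Generalized Clifford algebras as twisted group algebras\<close>

lemma word_append: "word (u @ v) = word u * word v"
  by (simp add: word_def mult_single plus_free_monoid_def)

lemma word_Cons: "word (i # w) = word [i] * word w"
  using word_append[of "[i]" w] by simp

lemma word_Nil: "word [] = 1"
  by (simp add: word_def flip: zero_free_monoid_def)

lemma word_power: "word [i] ^ k = word (replicate k i)"
  by (induction k) (simp_all add: word_Nil word_Cons[of i "replicate _ i"])

lemma const_mult: "const c * p = pm_scale c p"
  by (simp add: const_def pm_scale_def mult_map_scale_conv_mult)

lemma const_eq: "const c = pm_scale c 1"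
  using const_mult[of c 1] by simp

lemma pm_scale_mult_left:
  fixes p q :: "'i free_monoid \<Rightarrow>\<^sub>0 'k::field"
  shows "pm_scale c p * q = pm_scale c (p * q)"
  by (simp add: mult.assoc flip: const_mult)

lemma mult_expansion:
  fixes p q :: "'i::monoid_add \<Rightarrow>\<^sub>0 'k::field"
  shows "p * q = (\<Sum>u\<in>Poly_Mapping.keys p. \<Sum>v\<in>Poly_Mapping.keys q.
    Poly_Mapping.single (u + v) (Poly_Mapping.lookup p u * Poly_Mapping.lookup q v))"
proof -
  have "p * q = (\<Sum>u\<in>Poly_Mapping.keys p. Poly_Mapping.single u (Poly_Mapping.lookup p u)) *
      (\<Sum>v\<in>Poly_Mapping.keys q. Poly_Mapping.single v (Poly_Mapping.lookup q v))"
    by (simp flip: poly_mapping_expansion)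
  then show ?thesis by (simp add: sum_product mult_single)
qed

text \<open>The ring is noncommutative, so centrality of constants needs an argument: on monomials
  it holds because the empty word is neutral on both sides and the coefficients commute.\<close>

lemma pm_scale_mult_right:
  fixes p q :: "'i free_monoid \<Rightarrow>\<^sub>0 'k::field"
  shows "p * pm_scale c q = pm_scale c (p * q)"
proof -
  have "p * const c = pm_scale c p" for p :: "'i free_monoid \<Rightarrow>\<^sub>0 'k"
  proof -
    have "p * const c = (\<Sum>u\<in>Poly_Mapping.keys p. Poly_Mapping.single u (Poly_Mapping.lookup p u)) * const c"
      by (simp flip: poly_mapping_expansion)
    also have "\<dots> = (\<Sum>u\<in>Poly_Mapping.keys p. pm_scale c (Poly_Mapping.single u (Poly_Mapping.lookup p u)))"
      by (simp add: sum_distrib_right const_def mult_single pm_scale_single mult.commute)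
    also have "\<dots> = pm_scale c p"
      by (simp flip: pm.scale_sum_right poly_mapping_expansion)
    finally show ?thesis .
  qed
  then show ?thesis by (metis const_mult mult.assoc)
qed

lemma free_algebra_simps [simp]:
  "p \<in> carrier (free_algebra I) \<longleftrightarrow> (\<forall>w\<in>Poly_Mapping.keys p. set (letters w) \<subseteq> I)"
  "p \<otimes>\<^bsub>free_algebra I\<^esub> r = p * r" "\<one>\<^bsub>free_algebra I\<^esub> = 1"
  "\<zero>\<^bsub>free_algebra I\<^esub> = 0" "p \<oplus>\<^bsub>free_algebra I\<^esub> r = p + r"
  by (simp_all add: free_algebra_def)

lemma free_algebra_closed:
  fixes p r :: "'i free_monoid \<Rightarrow>\<^sub>0 'k::field"
  shows "0 \<in> carrier (free_algebra I)" "1 \<in> carrier (free_algebra I)"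
    and "p \<in> carrier (free_algebra I) \<Longrightarrow> pm_scale c p \<in> carrier (free_algebra I)"
    and "p \<in> carrier (free_algebra I) \<Longrightarrow> - p \<in> carrier (free_algebra I)"
    and "p \<in> carrier (free_algebra I) \<Longrightarrow> r \<in> carrier (free_algebra I) \<Longrightarrow> p + r \<in> carrier (free_algebra I)"
    and "p \<in> carrier (free_algebra I) \<Longrightarrow> r \<in> carrier (free_algebra I) \<Longrightarrow> p - r \<in> carrier (free_algebra I)"
    and "p \<in> carrier (free_algebra I) \<Longrightarrow> r \<in> carrier (free_algebra I) \<Longrightarrow> p * r \<in> carrier (free_algebra I)"
proof -
  show scale: "pm_scale c p \<in> carrier (free_algebra I)" if "p \<in> carrier (free_algebra I)"
    for c and p :: "'i free_monoid \<Rightarrow>\<^sub>0 'k"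
    using that keys_pm_scale[of c p] by (auto simp: subset_iff)
  show add: "p + r \<in> carrier (free_algebra I)"
    if "p \<in> carrier (free_algebra I)" "r \<in> carrier (free_algebra I)"
    for p r :: "'i free_monoid \<Rightarrow>\<^sub>0 'k"
    using that Poly_Mapping.keys_add[of p r] by (auto simp: subset_iff)
  have "- p = pm_scale (- 1) p" for p :: "'i free_monoid \<Rightarrow>\<^sub>0 'k" by simp
  then show uminus: "- p \<in> carrier (free_algebra I)" if "p \<in> carrier (free_algebra I)"
    for p :: "'i free_monoid \<Rightarrow>\<^sub>0 'k"
    using scale[OF that, of "- 1"] by metis
  show "p - r \<in> carrier (free_algebra I)"
    if "p \<in> carrier (free_algebra I)" "r \<in> carrier (free_algebra I)"
    for p r :: "'i free_monoid \<Rightarrow>\<^sub>0 'k"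
    using add[OF that(1), of "- r"] that(2) uminus[OF that(2)] by (simp del: free_algebra_simps(1))
  show "p * r \<in> carrier (free_algebra I)"
    if "p \<in> carrier (free_algebra I)" "r \<in> carrier (free_algebra I)"
    for p r :: "'i free_monoid \<Rightarrow>\<^sub>0 'k"
    unfolding free_algebra_simps
  proof
    fix w assume "w \<in> Poly_Mapping.keys (p * r)"
    then obtain u v where "w = u + v" "u \<in> Poly_Mapping.keys p" "v \<in> Poly_Mapping.keys r"
      using Poly_Mapping.keys_mult[of p r] by blast
    then show "set (letters w) \<subseteq> I" using that by (simp add: plus_free_monoid_def)
  qed
qed (auto simp: zero_free_monoid_def)

lemma free_algebra_sum:
  fixes f :: "'b \<Rightarrow> 'i free_monoid \<Rightarrow>\<^sub>0 'k::field"
  assumes "\<And>x. x \<in> S \<Longrightarrow> f x \<in> carrier (free_algebra I)"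
  shows "sum f S \<in> carrier (free_algebra I)"
  using assms
  by (induction S rule: infinite_finite_induct)
    (simp_all add: free_algebra_closed del: free_algebra_simps(1))

lemma ring_free_algebra: "ring (free_algebra I :: ('i free_monoid \<Rightarrow>\<^sub>0 'k::field) ring)"
proof (rule ringI[OF abelian_groupI monoidI])
  fix p :: "'i free_monoid \<Rightarrow>\<^sub>0 'k" assume "p \<in> carrier (free_algebra I)"
  then show "\<exists>r\<in>carrier (free_algebra I). r \<oplus>\<^bsub>free_algebra I\<^esub> p = \<zero>\<^bsub>free_algebra I\<^esub>"
    by (intro bexI[of _ "- p"] free_algebra_closed) simp_all
qed (use free_algebra_closed in \<open>simp_all del: free_algebra_simps(1) add: algebra_simps\<close>)

lemma word_closed: "set w \<subseteq> I \<Longrightarrow> word w \<in> carrier (free_algebra I)"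
  by (simp add: word_def)

section \<open>Evaluation of noncommutative polynomials in the twisted group algebra\<close>

context clifford_params begin

abbreviation M where "M \<equiv> twisted_mult G \<sigma>"

definition gen :: "nat \<Rightarrow> nat \<Rightarrow> int" where
  "gen i = (\<lambda>j\<in>{1..m}. of_bool (j = i))"

primrec word_fun :: "nat list \<Rightarrow> (nat \<Rightarrow> int) \<Rightarrow> 'k" where
  "word_fun [] = basis_fun \<one>\<^bsub>G\<^esub>"
| "word_fun (i # w) = M (basis_fun (gen i)) (word_fun w)"

definition gca_eval :: "(nat free_monoid \<Rightarrow>\<^sub>0 'k) \<Rightarrow> (nat \<Rightarrow> int) \<Rightarrow> 'k" where
  "gca_eval p = (\<lambda>k. lin_ext (\<lambda>w. word_fun (letters w) k) p)"

lemma gen_closed: "gen i \<in> carrier G"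
  using n by (auto simp: carrier_G gen_def)

lemma gen_supp: "i \<in> I \<Longrightarrow> gen i \<in> supp_group I"
  using gen_closed by (auto simp: supp_group_def gen_def)

lemma word_fun_closed: "set w \<subseteq> I \<Longrightarrow> word_fun w \<in> carrier (model I)"
proof (induction w)
  case Nil
  interpret subgroup "supp_group I" G by (rule subgroup_supp_group)
  show ?case using one_closed by (auto simp: basis_fun_def)
next
  case (Cons i w)
  have "basis_fun (gen i) \<in> carrier (model I)"
    using Cons.prems gen_supp by (auto simp: basis_fun_def)
  with Cons show ?case
    using twisted_mult_closed[OF subgroup_supp_group, of "basis_fun (gen i)" I "word_fun w"] by simp
qed

lemma word_fun_append: "word_fun (u @ v) = M (word_fun u) (word_fun v)"
proof (induction u)
  case Nil
  \<comment> \<open>The unit law holds only for functions vanishing outside the group, hence the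
    appeal to closedness with all letters allowed.\<close>
  have "word_fun v g = 0" if "g \<notin> carrier G" for g
    using word_fun_closed[of v UNIV] that by (simp add: supp_group_def)
  then show ?case by (simp add: twisted_mult_one)
qed (simp add: twisted_mult_assoc)

lemma gca_eval_add: "gca_eval (p + r) = (\<lambda>k. gca_eval p k + gca_eval r k)"
  by (simp add: gca_eval_def lin_ext_add)

lemma gca_eval_diff: "gca_eval (p - r) = (\<lambda>k. gca_eval p k - gca_eval r k)"
  by (simp add: gca_eval_def lin_ext_diff)

lemma gca_eval_zero: "gca_eval 0 = (\<lambda>_. 0)"
  by (simp add: gca_eval_def)

lemma gca_eval_pm_scale: "gca_eval (pm_scale c p) = (\<lambda>k. c * gca_eval p k)"
  by (simp add: gca_eval_def lin_ext_pm_scale)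

lemma gca_eval_sum: "gca_eval (\<Sum>i\<in>S. f i) = (\<lambda>k. \<Sum>i\<in>S. gca_eval (f i) k)"
  by (simp add: gca_eval_def lin_ext_sum)

lemma gca_eval_word: "gca_eval (word w) = word_fun w"
  by (simp add: gca_eval_def word_def)

lemma gca_eval_one: "gca_eval 1 = basis_fun \<one>\<^bsub>G\<^esub>"
  using gca_eval_word[of "[]"] by (simp add: word_Nil)

lemma gca_eval_mult: "gca_eval (p * r) = M (gca_eval p) (gca_eval r)"
proof -
  have "gca_eval (p * r) = (\<lambda>k. \<Sum>u\<in>Poly_Mapping.keys p. \<Sum>v\<in>Poly_Mapping.keys r.
      Poly_Mapping.lookup p u * Poly_Mapping.lookup r v * M (word_fun (letters u)) (word_fun (letters v)) k)"
    by (simp add: mult_expansion[of p r] gca_eval_sum)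
      (simp add: gca_eval_def plus_free_monoid_def word_fun_append)
  then show ?thesis
    by (simp add: gca_eval_def lin_ext_def twisted_mult_sum_left twisted_mult_sum_right
        twisted_mult_smult_left twisted_mult_smult_right sum_distrib_left mult.assoc)
qed

lemma gca_eval_closed:
  assumes "p \<in> carrier (free_algebra I)"
  shows "gca_eval p \<in> carrier (model I)"
proof -
  have "gca_eval p g = 0" if "g \<notin> supp_group I" for g
    unfolding gca_eval_def lin_ext_def
  proof (intro sum.neutral ballI)
    fix w assume "w \<in> Poly_Mapping.keys p"
    then have "word_fun (letters w) g = 0"
      using assms word_fun_closed[of "letters w" I] that by simp
    then show "Poly_Mapping.lookup p w * word_fun (letters w) g = 0" by simp
  qed
  then show ?thesis by simp
qed

text \<open>Since \<open>g\<close> vanishes below \<open>i\<close>, only a carry in coordinate \<open>i\<close> can contribute a factor.\<close>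

lemma gen_mult_basis:
  assumes i: "i \<in> {1..m}" and g: "g \<in> carrier G" and low: "\<And>j. j \<in> {1..<i} \<Longrightarrow> g j = 0"
  shows "g i + 1 < int n \<Longrightarrow> M (basis_fun (gen i)) (basis_fun g) = basis_fun (g(i := g i + 1))"
    and "g i + 1 = int n \<Longrightarrow> M (basis_fun (gen i)) (basis_fun g) = (\<lambda>k. q i * basis_fun (g(i := 0)) k)"
proof -
  have pair: "pairing m (gen i) g = 0"
    unfolding pairing_def using i low by (intro sum.neutral ballI) (auto simp: gen_def)
  have mult: "gen i \<otimes>\<^bsub>G\<^esub> g = g(i := (g i + 1) mod int n)"
  proof (rule G_ext)
    show "gen i \<otimes>\<^bsub>G\<^esub> g \<in> carrier G" using gen_closed g by simp
    show "g(i := (g i + 1) mod int n) \<in> carrier G"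
      using g i n unfolding carrier_G by (auto simp: PiE_iff extensional_def)
  qed (use i g in \<open>auto simp: mult_Zn_power gen_def G_mod add.commute\<close>)
  have gi: "0 \<le> g i" using G_range[OF g i] by simp
  have carry: "(\<Prod>j\<in>{1..m}. q j ^ nat ((gen i j + g j) div int n)) = q i ^ nat ((g i + 1) div int n)"
  proof -
    have "(\<Prod>j\<in>{1..m}. q j ^ nat ((gen i j + g j) div int n)) =
        (\<Prod>j\<in>{1..m}. if j = i then q i ^ nat ((g i + 1) div int n) else 1)"
      by (intro prod.cong refl) (use G_range[OF g] in \<open>auto simp: gen_def add.commute\<close>)
    then show ?thesis using i by simp
  qed
  have eq: "M (basis_fun (gen i)) (basis_fun g) =
      (\<lambda>k. q i ^ nat ((g i + 1) div int n) * basis_fun (g(i := (g i + 1) mod int n)) k)"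
    unfolding twisted_mult_basis[OF gen_closed g] mult gca_cocycle_def pair carry by simp
  show "M (basis_fun (gen i)) (basis_fun g) = basis_fun (g(i := g i + 1))" if "g i + 1 < int n"
    unfolding eq using that gi by (simp add: mod_pos_pos_trivial div_pos_pos_trivial)
  show "M (basis_fun (gen i)) (basis_fun g) = (\<lambda>k. q i * basis_fun (g(i := 0)) k)" if "g i + 1 = int n"
    unfolding eq using that n by simp
qed

section \<open>Evaluation of ordered monomials\<close>

definition block :: "(nat \<Rightarrow> int) \<Rightarrow> nat list \<Rightarrow> nat list" where
  "block g zs = concat (map (\<lambda>i. replicate (nat (g i)) i) zs)"

lemma set_block: "set (block g zs) \<subseteq> set zs"
  by (auto simp: block_def)

text \<open>The monomial is built from its right end. Each new letter \<open>z\<close> is smaller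
  than all letters already present, so it has nothing to pass, and its exponent stays below
  \<open>n\<close>, so it causes no carry; no scalar ever appears. An arbitrary sorted list lets the
  induction drop the smallest index.\<close>

lemma word_fun_block:
  assumes "sorted zs" "distinct zs" "set zs \<subseteq> {1..m}" "g \<in> carrier G"
  shows "word_fun (block g zs) = basis_fun (\<lambda>j\<in>{1..m}. if j \<in> set zs then g j else 0)"
  using assms(1-3)
proof (induction zs)
  case Nil
  then show ?case by (simp add: block_def one_Zn_power restrict_def)
next
  case (Cons z zs)
  define h where "h = (\<lambda>j\<in>{1..m}. if j \<in> set zs then g j else 0)"
  have z: "z \<in> {1..m}" "z \<notin> set zs" and low: "\<And>j. j \<in> {1..<z} \<Longrightarrow> h j = 0"
    using Cons.prems by (auto simp: h_def)
  have hG: "h \<in> carrier G"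
    using G_range[OF assms(4)] n unfolding h_def carrier_G by auto
  have *: "word_fun (replicate k z @ block g zs) = basis_fun (h(z := int k))" if "int k \<le> g z" for k
    using that
  proof (induction k)
    case 0
    have "h z = 0" using z by (simp add: h_def)
    then have "h(z := int 0) = h" by auto
    moreover have "word_fun (block g zs) = basis_fun h"
      using Cons.IH Cons.prems by (simp only: h_def sorted_simps distinct.simps set_simps insert_subset)
    ultimately show ?case by simp
  next
    case (Suc k)
    \<comment> \<open>This bound selects the case of \<open>gen_mult_basis\<close> without a
      carry.\<close>
    have "int k < int n - 1" using Suc.prems G_range[OF assms(4) z(1)] by simp
    moreover have "h(z := int k) \<in> carrier G"
      using hG z(1) \<open>int k < int n - 1\<close> unfolding carrier_G by (auto simp: PiE_iff extensional_def)
    ultimately have step: "M (basis_fun (gen z)) (basis_fun (h(z := int k))) = basis_fun (h(z := int k + 1))"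
      using gen_mult_basis(1)[OF z(1), of "h(z := int k)"] low by simp
    have IH: "word_fun (replicate k z @ block g zs) = basis_fun (h(z := int k))"
      using Suc.prems by (intro Suc.IH) simp
    have k: "int (Suc k) = int k + 1" by simp
    show ?case unfolding replicate_Suc append_Cons word_fun.simps IH step k ..
  qed
  have "word_fun (block g (z # zs)) = basis_fun (h(z := g z))"
    using *[of "nat (g z)"] G_range[OF assms(4) z(1)] by (simp add: block_def)
  also have "h(z := g z) = (\<lambda>j\<in>{1..m}. if j \<in> set (z # zs) then g j else 0)"
    using z by (auto simp: h_def)
  finally show ?case .
qed

lemma ordered_monomial_eq: "ordered_monomial I g = word (block g (sorted_list_of_set I))"
  by (simp add: ordered_monomial_def block_def)

lemma gca_eval_ordered_monomial:
  assumes I: "I \<subseteq> {1..m}" and g: "g \<in> supp_group I"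
  shows "gca_eval (ordered_monomial I g) = basis_fun g"
proof -
  have fin: "finite I" using I finite_subset by blast
  have gG: "g \<in> carrier G" using g by (simp add: supp_group_def)
  have "(\<lambda>j\<in>{1..m}. if j \<in> I then g j else 0) = g"
    using g gG by (intro ext) (auto simp: supp_group_def carrier_G PiE_iff extensional_def)
  then show ?thesis
    using word_fun_block[of "sorted_list_of_set I" g] I gG fin
    by (simp add: ordered_monomial_eq gca_eval_word)
qed

end

section \<open>The ideal of relations as the kernel of evaluation\<close>

locale clifford_subset = clifford_params n m \<omega> q
  for n m :: nat and \<omega> :: "'k::field" and q :: "nat \<Rightarrow> 'k" +
  fixes I :: "nat set"
  assumes I: "I \<subseteq> {1..m}"
begin

abbreviation F :: "(nat free_monoid \<Rightarrow>\<^sub>0 'k) ring" where "F \<equiv> free_algebra I"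
abbreviation J where "J \<equiv> gca_ideal n \<omega> q I"
abbreviation mono where "mono \<equiv> ordered_monomial I :: _ \<Rightarrow> nat free_monoid \<Rightarrow>\<^sub>0 'k"

definition relators :: "(nat free_monoid \<Rightarrow>\<^sub>0 'k) set" where
  "relators = {word [i] ^ n - const (q i) | i. i \<in> I} \<union>
     {word [i] * word [j] - const \<omega> * (word [j] * word [i]) | i j. i \<in> I \<and> j \<in> I \<and> i > j}"

interpretation F: ring F by (rule ring_free_algebra)

lemma finite_I: "finite I"
  using I finite_subset by blast

lemma relators_closed: "relators \<subseteq> carrier F"
proof -
  have "word [i] ^ n - const (q i) \<in> carrier F" if "i \<in> I" for i
    unfolding word_power const_eq using that by (intro free_algebra_closed word_closed) auto
  moreover have "word [i] * word [j] - const \<omega> * (word [j] * word [i]) \<in> carrier F"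
    if "i \<in> I" "j \<in> I" for i j
    unfolding const_mult using that by (intro free_algebra_closed word_closed) auto
  ultimately show ?thesis unfolding relators_def by blast
qed

lemma J_eq: "J = Idl\<^bsub>F\<^esub> relators"
  by (simp add: gca_ideal_def relators_def)

interpretation J: ideal J F
  unfolding J_eq by (rule F.genideal_ideal[OF relators_closed])

lemma relators_J: "relators \<subseteq> J"
  unfolding J_eq by (rule F.genideal_self[OF relators_closed])

lemma J_subset: "p \<in> J \<Longrightarrow> p \<in> carrier F"
  using J.a_subset by blast

lemma J_add: "p \<in> J \<Longrightarrow> r \<in> J \<Longrightarrow> p + r \<in> J"
  using J.a_closed[of p r] by simp

lemma J_mult: "p \<in> J \<Longrightarrow> r \<in> carrier F \<Longrightarrow> r * p \<in> J" "p \<in> J \<Longrightarrow> r \<in> carrier F \<Longrightarrow> p * r \<in> J"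
  using J.I_l_closed[of p r] J.I_r_closed[of p r] by (simp_all del: free_algebra_simps(1))

lemma J_pm_scale:
  assumes "p \<in> J"
  shows "pm_scale c p \<in> J"
proof -
  have "const c \<in> carrier F" unfolding const_eq by (intro free_algebra_closed)
  from J_mult(1)[OF assms this] show ?thesis by (simp only: const_mult)
qed

lemma J_zero: "0 \<in> J"
  using J.zero_closed by simp

lemma J_sum: "(\<And>i. i \<in> S \<Longrightarrow> f i \<in> J) \<Longrightarrow> sum f S \<in> J"
  by (induction S rule: infinite_finite_induct) (simp_all add: J_zero J_add)

lemma J_trans: "p - r \<in> J \<Longrightarrow> r - s \<in> J \<Longrightarrow> p - s \<in> J"
  using J_add[of "p - r" "r - s"] by simp

text \<open>The ideal \<open>J\<close> is the smallest one containing the relators, so once the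
  kernel is an ideal, only the relators have to be evaluated.\<close>

lemma ker_ideal: "ideal {p \<in> carrier F. gca_eval p = (\<lambda>_. 0)} F" (is "ideal ?K F")
proof (rule idealI[OF ring_free_algebra])
  show "subgroup ?K (add_monoid F)"
  proof (rule group.subgroupI[OF F.a_group])
    show "?K \<noteq> {}" using free_algebra_closed(1)[of I] gca_eval_zero by blast
    fix p assume p: "p \<in> ?K"
    then have "inv\<^bsub>add_monoid F\<^esub> p = - p"
      using F.minus_equality[of "- p" p] free_algebra_closed(4)[of p I]
      by (simp add: a_inv_def del: free_algebra_simps(1))
    moreover have "gca_eval (- p) = (\<lambda>_. 0)"
      using p gca_eval_diff[of 0 p] by (simp add: gca_eval_zero)
    ultimately show "inv\<^bsub>add_monoid F\<^esub> p \<in> ?K"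
      using p free_algebra_closed(4)[of p I] by (simp del: free_algebra_simps(1))
    fix r assume "r \<in> ?K"
    with p show "p \<otimes>\<^bsub>add_monoid F\<^esub> r \<in> ?K"
      using free_algebra_closed(5)[of p I r] by (simp add: gca_eval_add del: free_algebra_simps(1))
  qed auto
  fix p r assume "p \<in> ?K" "r \<in> carrier F"
  then show "r \<otimes>\<^bsub>F\<^esub> p \<in> ?K" "p \<otimes>\<^bsub>F\<^esub> r \<in> ?K"
    using free_algebra_closed(7)[of p I r] free_algebra_closed(7)[of r I p]
    by (simp_all add: gca_eval_mult twisted_mult_def del: free_algebra_simps(1))
qed

lemma pairing_gen:
  assumes "i \<in> {1..m}" "j \<in> {1..m}"
  shows "pairing m (gen i) (gen j) = of_bool (j < i)"
proof -
  have "pairing m (gen i) (gen j) = (\<Sum>a\<in>{1..m}. of_bool (i = a) * (\<Sum>b\<in>{1..<a}. of_bool (b = j)))"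
    unfolding pairing_def sum_distrib_left using assms by (intro sum.cong refl) (auto simp: gen_def)
  also have "\<dots> = (\<Sum>b\<in>{1..<i}. of_bool (b = j))"
    using assms by (subst sum_of_bool_eq) auto
  also have "\<dots> = of_bool (j < i)" using assms by (simp add: of_bool_def)
  finally show ?thesis .
qed

text \<open>The first \<open>n - 1\<close> letters form an ordered monomial with the top exponent
  \<open>n - 1\<close>. The last letter produces the only carry, which returns the exponent to zero
  and contributes \<open>q i\<close>.\<close>

lemma word_fun_replicate_n:
  assumes i: "i \<in> {1..m}"
  shows "word_fun (replicate n i) = (\<lambda>k. q i * basis_fun \<one>\<^bsub>G\<^esub> k)"
proof -
  define h where "h = \<one>\<^bsub>G\<^esub>(i := int (n - 1))"
  have h: "h \<in> carrier G" "\<And>j. j \<in> {1..<i} \<Longrightarrow> h j = 0" "h i + 1 = int n" "h(i := 0) = \<one>\<^bsub>G\<^esub>"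
    using one_closed i n unfolding carrier_G h_def by (auto simp: PiE_iff extensional_def one_Zn_power)
  have "block h [i] = replicate (n - 1) i" by (simp add: block_def h_def)
  moreover have "(\<lambda>j\<in>{1..m}. if j \<in> set [i] then h j else 0) = h"
    using i by (auto simp: h_def one_Zn_power)
  ultimately have "word_fun (replicate (n - 1) i) = basis_fun h"
    using word_fun_block[of "[i]" h] i h(1) by simp
  moreover have "replicate n i = i # replicate (n - 1) i" using n by (cases n) simp_all
  ultimately have "word_fun (replicate n i) = M (basis_fun (gen i)) (basis_fun h)" by simp
  also have "\<dots> = (\<lambda>k. q i * basis_fun \<one>\<^bsub>G\<^esub> k)"
    using gen_mult_basis(2)[OF i h(1,2,3)] h(4) by simp
  finally show ?thesis .
qed

lemma relators_ker: "p \<in> relators \<Longrightarrow> gca_eval p = (\<lambda>_. 0)"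
proof -
  assume "p \<in> relators"
  then consider i where "i \<in> I" "p = word [i] ^ n - const (q i)"
    | i j where "i \<in> I" "j \<in> I" "j < i" "p = word [i] * word [j] - const \<omega> * (word [j] * word [i])"
    unfolding relators_def by blast
  then show ?thesis
  proof cases
    case 1
    then have "i \<in> {1..m}" using I by blast
    with 1 show ?thesis
      by (simp add: word_power const_eq gca_eval_diff gca_eval_word gca_eval_pm_scale gca_eval_one
          word_fun_replicate_n)
  next
    case 2
    then have ij: "i \<in> {1..m}" "j \<in> {1..m}" using I by blast+
    \<comment> \<open>As \<open>j < i\<close>, the pairing of the two generators is 1 in one order
      and 0 in the other.\<close>
    have "R_GCA \<omega> m (gen i) (gen j) = \<omega>"
      using pairing_gen[OF ij] pairing_gen[OF ij(2,1)] 2 by (simp add: R_GCA_eq)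
    then have "\<sigma> (gen i) (gen j) = \<omega> * \<sigma> (gen j) (gen i)"
      using cocycle_swap[of "gen i" "gen j"] by simp
    moreover have "gca_eval (word [i]) = basis_fun (gen i)" for i
      unfolding gca_eval_word word_fun.simps
      by (rule twisted_mult_one) (use gen_closed in \<open>auto simp: basis_fun_def\<close>)
    ultimately show ?thesis
      unfolding 2 const_mult gca_eval_diff gca_eval_pm_scale gca_eval_mult
      by (simp add: twisted_mult_basis gen_closed m_comm[OF gen_closed gen_closed] mult.assoc)
  qed
qed

lemma J_ker: "p \<in> J \<Longrightarrow> gca_eval p = (\<lambda>_. 0)"
proof -
  have "Idl\<^bsub>F\<^esub> relators \<subseteq> {p \<in> carrier F. gca_eval p = (\<lambda>_. 0)}"
    using relators_closed relators_ker by (intro F.genideal_minimal[OF ker_ideal]) blast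
  then show "p \<in> J \<Longrightarrow> gca_eval p = (\<lambda>_. 0)" unfolding J_eq by blast
qed

text \<open>Every exchange with a smaller letter costs one factor \<open>\<omega>\<close>. The
  scalar is left existential, because the reduction to ordered monomials only has to show that they
  span.\<close>

lemma move_letter:
  assumes i: "i \<in> I" and u: "set u \<subseteq> I" "\<And>j. j \<in> set u \<Longrightarrow> j < i"
  shows "\<exists>c. word (i # u) - pm_scale c (word (u @ [i])) \<in> J"
  using u
proof (induction u)
  case Nil
  show ?case by (rule exI[of _ 1]) (simp add: J_zero)
next
  case (Cons j u)
  then obtain c where c: "word (i # u) - pm_scale c (word (u @ [i])) \<in> J" by auto
  have j: "j \<in> I" "j < i" using Cons.prems by auto
  have "word [i] * word [j] - const \<omega> * (word [j] * word [i]) \<in> J"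
    using relators_J i j unfolding relators_def by blast
  then have "(word [i] * word [j] - const \<omega> * (word [j] * word [i])) * word u \<in> J"
    using Cons.prems by (intro J_mult word_closed) auto
  also have "(word [i] * word [j] - const \<omega> * (word [j] * word [i])) * word u =
      word (i # j # u) - pm_scale \<omega> (word (j # i # u))"
    unfolding word_Cons[of i "j # u"] word_Cons[of j u] word_Cons[of j "i # u"] word_Cons[of i u]
    by (simp add: const_mult left_diff_distrib pm_scale_mult_left mult.assoc)
  finally have 1: "word (i # j # u) - pm_scale \<omega> (word (j # i # u)) \<in> J" .
  have "pm_scale \<omega> (word [j] * (word (i # u) - pm_scale c (word (u @ [i])))) \<in> J"
    using c j by (intro J_pm_scale J_mult word_closed) auto
  also have "pm_scale \<omega> (word [j] * (word (i # u) - pm_scale c (word (u @ [i])))) =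
      pm_scale \<omega> (word (j # i # u)) - pm_scale (\<omega> * c) (word ((j # u) @ [i]))"
    unfolding append_Cons word_Cons[of j "i # u"] word_Cons[of j "u @ [i]"]
    by (simp add: right_diff_distrib pm_scale_mult_right pm.scale_right_diff_distrib)
  finally show ?case using J_trans[OF 1] by blast
qed

text \<open>In the sorted list of \<open>I\<close> the letters before \<open>i\<close> are smaller:
  the new letter moves past their block and joins the existing power of \<open>i\<close>. If that
  power becomes the \<open>n\<close>-th, it is replaced by \<open>q i\<close>.\<close>

lemma insert_letter:
  assumes i: "i \<in> I" and g: "g \<in> supp_group I"
  shows "\<exists>c. \<exists>g'\<in>supp_group I. word [i] * mono g - pm_scale c (mono g') \<in> J"
proof -
  have im: "i \<in> {1..m}" using i I by blast
  have gG: "g \<in> carrier G" using g by (simp add: supp_group_def)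
  obtain xs ys where split: "sorted_list_of_set I = xs @ i # ys"
    using split_list[of i "sorted_list_of_set I"] i finite_I by auto
  have sorted: "sorted (xs @ i # ys)" "distinct (xs @ i # ys)" and set: "set (xs @ i # ys) = I"
    unfolding split[symmetric] using finite_I by simp_all
  have xs: "j < i" if "j \<in> set xs" for j
    using sorted that by (auto simp: sorted_append order.strict_iff_order)
  have notin: "i \<notin> set xs" "i \<notin> set ys" using sorted by auto
  define k where "k = nat (g i)"
  have k: "int k = g i" "k < n" using G_range[OF gG im] by (auto simp: k_def)
  have block_upd: "block (g(i := a)) xs = block g xs" "block (g(i := a)) ys = block g ys" for a
    using notin by (auto simp: block_def intro!: arg_cong[where f = concat] map_cong)
  have mono_upd: "mono (g(i := int a)) = word (block g xs @ replicate a i @ block g ys)" for a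
  proof -
    have "block (g(i := int a)) (xs @ i # ys) =
        block (g(i := int a)) xs @ replicate a i @ block (g(i := int a)) ys"
      by (simp add: block_def)
    then show ?thesis unfolding ordered_monomial_eq split block_upd by simp
  qed
  have mono_g: "mono g = word (block g xs @ replicate k i @ block g ys)"
    using mono_upd[of k] by (simp add: k)
  have sub: "set (block g xs) \<subseteq> I" "set (block g ys) \<subseteq> I"
    using set_block[of g xs] set_block[of g ys] set by auto
  obtain c where "word (i # block g xs) - pm_scale c (word (block g xs @ [i])) \<in> J"
    using move_letter[OF i sub(1)] xs set_block[of g xs] by blast
  then have "(word (i # block g xs) - pm_scale c (word (block g xs @ [i]))) *
      word (replicate k i @ block g ys) \<in> J"
    using i sub by (intro J_mult word_closed) auto
  also have "(word (i # block g xs) - pm_scale c (word (block g xs @ [i]))) *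
      word (replicate k i @ block g ys) =
    word [i] * mono g - pm_scale c (mono (g(i := int (Suc k))))"
    unfolding mono_g mono_upd left_diff_distrib pm_scale_mult_left
      word_append[symmetric] append_assoc append_Cons append_Nil replicate_Suc ..
  finally have 1: "word [i] * mono g - pm_scale c (mono (g(i := int (Suc k)))) \<in> J" .
  have supp: "g(i := a) \<in> supp_group I" if "0 \<le> a" "a < int n" for a
    using g i im that unfolding supp_group_def carrier_G
    by (auto simp: PiE_iff extensional_def)
  show ?thesis
  proof (cases "Suc k < n")
    case True
    then have "g(i := int (Suc k)) \<in> supp_group I" by (intro supp) auto
    with 1 show ?thesis by blast
  next
    case False
    then have Suc_k: "Suc k = n" using k by simp
    \<comment> \<open>With exponent \<open>n\<close> the word behind \<open>mono\<close> is no
      longer in normal form, although \<open>mono\<close> is defined there. The relator for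
      \<open>i\<close>, placed between the two outer blocks, trades that power for
      \<open>q i\<close> and resets the exponent to 0.\<close>
    have "word [i] ^ n - const (q i) \<in> J" using relators_J i unfolding relators_def by blast
    then have "pm_scale c (word (block g xs) * ((word [i] ^ n - const (q i)) * word (block g ys))) \<in> J"
      using sub by (intro J_pm_scale J_mult word_closed)
    also have "pm_scale c (word (block g xs) * ((word [i] ^ n - const (q i)) * word (block g ys))) =
        pm_scale c (mono (g(i := int (Suc k)))) - pm_scale (c * q i) (mono (g(i := int 0)))"
      unfolding mono_upd word_append Suc_k word_power
      by (simp add: left_diff_distrib right_diff_distrib const_mult pm_scale_mult_right
          pm.scale_right_diff_distrib word_Nil)
    finally have "word [i] * mono g - pm_scale (c * q i) (mono (g(i := int 0))) \<in> J"
      using J_trans[OF 1] by blast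
    moreover have "g(i := int 0) \<in> supp_group I" using n by (intro supp) auto
    ultimately show ?thesis by blast
  qed
qed

text \<open>Letters are absorbed from the right end, each one multiplying an ordered monomial from
  the left. A word stays a multiple of one monomial because every relator equates two such
  multiples.\<close>

lemma word_normal_form:
  "set w \<subseteq> I \<Longrightarrow> \<exists>c. \<exists>g\<in>supp_group I. word w - pm_scale c (mono g) \<in> J"
proof (induction w)
  case Nil
  have "\<one>\<^bsub>G\<^esub> \<in> supp_group I" by (rule subgroup.one_closed[OF subgroup_supp_group])
  moreover have "block \<one>\<^bsub>G\<^esub> zs = []" if "set zs \<subseteq> {1..m}" for zs
    using that by (auto simp: block_def one_Zn_power)
  then have "mono \<one>\<^bsub>G\<^esub> = word []" using I finite_I by (simp add: ordered_monomial_eq)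
  ultimately show ?case
    using J_zero by (intro exI[of _ 1] bexI[of _ "\<one>\<^bsub>G\<^esub>"]) simp_all
next
  case (Cons i w)
  then obtain c g where g: "g \<in> supp_group I" "word w - pm_scale c (mono g) \<in> J" by auto
  obtain c' g' where g': "g' \<in> supp_group I" "word [i] * mono g - pm_scale c' (mono g') \<in> J"
    using insert_letter[OF _ g(1), of i] Cons.prems by auto
  have "word [i] * (word w - pm_scale c (mono g)) \<in> J"
    using g(2) Cons.prems by (intro J_mult word_closed) auto
  then have "word (i # w) - pm_scale c (word [i] * mono g) \<in> J"
    by (simp add: word_Cons[of i w] right_diff_distrib pm_scale_mult_right)
  moreover have "pm_scale c (word [i] * mono g) - pm_scale (c * c') (mono g') \<in> J"
    using J_pm_scale[OF g'(2), of c] by (simp add: pm.scale_right_diff_distrib)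
  ultimately show ?case using J_trans g'(1) by blast
qed

lemma finite_supp_group: "finite (supp_group I)"
  using finite_carrier by (rule rev_finite_subset) (auto simp: supp_group_def)

lemma normal_form:
  assumes p: "p \<in> carrier F"
  shows "\<exists>d. p - (\<Sum>g\<in>supp_group I. pm_scale (d g) (mono g)) \<in> J"
proof -
  let ?K = "Poly_Mapping.keys p" and ?c = "Poly_Mapping.lookup p"
  have "\<exists>d. word (letters w) - (\<Sum>g\<in>supp_group I. pm_scale (d g) (mono g)) \<in> J" if "w \<in> ?K" for w
  proof -
    have w: "set (letters w) \<subseteq> I" using p that by simp
    obtain c g where g: "g \<in> supp_group I" "word (letters w) - pm_scale c (mono g) \<in> J"
      using word_normal_form[OF w] by blast
    \<comment> \<open>A single monomial is written as a sum over the whole group, so that the normal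
      forms of different words can be added.\<close>
    have "(\<Sum>h\<in>supp_group I. pm_scale (if h = g then c else 0) (mono h)) =
        (\<Sum>h\<in>supp_group I. if h = g then pm_scale c (mono g) else 0)"
      by (intro sum.cong refl) simp
    also have "\<dots> = pm_scale c (mono g)" using g(1) finite_supp_group by simp
    finally show ?thesis using g(2) by (intro exI[of _ "\<lambda>h. if h = g then c else 0"]) simp
  qed
  then obtain d where
    d: "\<And>w. w \<in> ?K \<Longrightarrow> word (letters w) - (\<Sum>g\<in>supp_group I. pm_scale (d w g) (mono g)) \<in> J"
    by metis
  have "(\<Sum>w\<in>?K. pm_scale (?c w) (word (letters w) - (\<Sum>g\<in>supp_group I. pm_scale (d w g) (mono g)))) \<in> J"
    using d by (intro J_sum J_pm_scale)
  also have "(\<Sum>w\<in>?K. pm_scale (?c w) (word (letters w) - (\<Sum>g\<in>supp_group I. pm_scale (d w g) (mono g)))) =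
      p - (\<Sum>w\<in>?K. \<Sum>g\<in>supp_group I. pm_scale (?c w * d w g) (mono g))"
    using poly_mapping_expansion_pm_scale[of p]
    by (simp add: pm.scale_right_diff_distrib sum_subtractf pm.scale_sum_right word_def)
  also have "(\<Sum>w\<in>?K. \<Sum>g\<in>supp_group I. pm_scale (?c w * d w g) (mono g)) =
      (\<Sum>g\<in>supp_group I. pm_scale (\<Sum>w\<in>?K. ?c w * d w g) (mono g))"
    by (subst sum.swap) (simp add: pm.scale_sum_left)
  finally show ?thesis by (rule exI[where x = "\<lambda>g. \<Sum>w\<in>?K. ?c w * d w g"])
qed

lemma gca_eval_lincomb:
  "gca_eval (\<Sum>g\<in>supp_group I. pm_scale (d g) (mono g)) = (\<lambda>k. if k \<in> supp_group I then d k else 0)"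
proof
  fix k
  have "gca_eval (\<Sum>g\<in>supp_group I. pm_scale (d g) (mono g)) k =
      (\<Sum>g\<in>supp_group I. of_bool (k = g) * d g)"
    unfolding gca_eval_sum gca_eval_pm_scale
    by (intro sum.cong refl) (simp add: gca_eval_ordered_monomial[OF I] basis_fun_def)
  also have "\<dots> = (if k \<in> supp_group I then d k else 0)"
    using finite_supp_group by (auto simp: sum_of_bool_eq intro!: sum.neutral)
  finally show "gca_eval (\<Sum>g\<in>supp_group I. pm_scale (d g) (mono g)) k =
      (if k \<in> supp_group I then d k else 0)" .
qed

text \<open>Distinct ordered monomials evaluate to distinct basis functions, so the coefficients of
  a normal form are the values of its evaluation. If the evaluation is zero, the normal form is
  literally zero and \<open>p\<close> is its own difference from it.\<close>

lemma ker_J: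
  assumes p: "p \<in> carrier F" and 0: "gca_eval p = (\<lambda>_. 0)"
  shows "p \<in> J"
proof -
  obtain d where d: "p - (\<Sum>g\<in>supp_group I. pm_scale (d g) (mono g)) \<in> J"
    using normal_form[OF p] by blast
  have "d g = 0" if "g \<in> supp_group I" for g
    using fun_cong[OF J_ker[OF d], of g] that 0 by (simp add: gca_eval_diff gca_eval_lincomb)
  then have "(\<Sum>g\<in>supp_group I. pm_scale (d g) (mono g)) = 0" by (intro sum.neutral) simp
  with d show ?thesis by simp
qed

section \<open>The quotient by the relations as a graded algebra\<close>

abbreviation cls where "cls \<equiv> gca_class n \<omega> q I"

lemma gca_class_eq:
  assumes p: "p \<in> carrier F"
  shows "cls p = {r \<in> carrier F. gca_eval r = gca_eval p}"
proof (intro equalityI subsetI)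
  fix r assume "r \<in> cls p"
  then obtain h where h: "h \<in> J" "r = h + p" by (auto simp: gca_class_def a_r_coset_def')
  then show "r \<in> {r \<in> carrier F. gca_eval r = gca_eval p}"
    using free_algebra_closed(5)[OF J_subset[OF h(1)] p] J_ker[OF h(1)] by (simp add: gca_eval_add)
next
  fix r assume r: "r \<in> {r \<in> carrier F. gca_eval r = gca_eval p}"
  then have "r - p \<in> J"
    using p by (intro ker_J free_algebra_closed) (simp_all add: gca_eval_diff)
  then show "r \<in> cls p"
    unfolding gca_class_def a_r_coset_def' by (intro UN_I[of "r - p"]) simp_all
qed

lemma gca_class_eq_iff:
  assumes "p \<in> carrier F" "r \<in> carrier F"
  shows "cls p = cls r \<longleftrightarrow> gca_eval p = gca_eval r"
proof
  assume "cls p = cls r"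
  moreover have "p \<in> cls p" using gca_class_eq[OF assms(1)] assms(1) by blast
  ultimately show "gca_eval p = gca_eval r" using gca_class_eq[OF assms(2)] by blast
qed (simp only: gca_class_eq assms)

lemma mono_closed: "mono g \<in> carrier F"
  unfolding ordered_monomial_eq
  using set_block[of g "sorted_list_of_set I"] finite_I by (intro word_closed) simp

abbreviation A where "A \<equiv> gca n \<omega> m q I"

lemma gca_simps:
  shows gca_carrier: "carrier A = cls ` carrier F"
    and gca_zero: "\<zero>\<^bsub>A\<^esub> = cls 0" and gca_one: "\<one>\<^bsub>A\<^esub> = cls 1"
    and gca_add: "p \<in> carrier F \<Longrightarrow> r \<in> carrier F \<Longrightarrow> cls p \<oplus>\<^bsub>A\<^esub> cls r = cls (p + r)"
    and gca_mult: "p \<in> carrier F \<Longrightarrow> r \<in> carrier F \<Longrightarrow> cls p \<otimes>\<^bsub>A\<^esub> cls r = cls (p * r)"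
    and gca_smult: "p \<in> carrier F \<Longrightarrow> c \<odot>\<^bsub>A\<^esub> cls p = cls (pm_scale c p)"
    and gca_homog: "homog A g = (if \<forall>i\<in>{1..m} - I. g i = 0
      then {cls (pm_scale c (mono g)) | c. True} else {cls 0})"
proof -
  show "carrier A = cls ` carrier F"
    by (auto simp: gca_def Let_def FactRing_def A_RCOSETS_def' gca_class_def simp del: free_algebra_simps(1))
  \<comment> \<open>The zero of the quotient ring is the ideal itself, which has to be recognised as
    the class of 0.\<close>
  have "J +>\<^bsub>F\<^esub> 0 = J" using F.a_coset_add_zero[OF J.a_subset] by simp
  then show "\<zero>\<^bsub>A\<^esub> = cls 0" by (simp add: gca_def Let_def FactRing_def gca_class_def)
  show "\<one>\<^bsub>A\<^esub> = cls 1" by (simp add: gca_def Let_def FactRing_def gca_class_def)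
  show "cls p \<oplus>\<^bsub>A\<^esub> cls r = cls (p + r)" if "p \<in> carrier F" "r \<in> carrier F" for p r
    using J.a_rcos_sum[OF that] by (simp add: gca_def Let_def FactRing_def gca_class_def)
  show mult: "cls p \<otimes>\<^bsub>A\<^esub> cls r = cls (p * r)" if "p \<in> carrier F" "r \<in> carrier F" for p r
    using J.rcoset_mult_add[OF that] by (simp add: gca_def Let_def FactRing_def gca_class_def)
  show "c \<odot>\<^bsub>A\<^esub> cls p = cls (pm_scale c p)" if "p \<in> carrier F" for p
  proof -
    have "const c \<in> carrier F" unfolding const_eq by (intro free_algebra_closed)
    then have "cls (const c) \<otimes>\<^bsub>A\<^esub> cls p = cls (pm_scale c p)"
      using mult[of "const c" p] that by (simp add: const_mult del: free_algebra_simps(1))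
    then show ?thesis by (simp add: gca_def Let_def)
  qed
  show "homog A g = (if \<forall>i\<in>{1..m} - I. g i = 0
      then {cls (pm_scale c (mono g)) | c. True} else {cls 0})"
    by (simp add: gca_def Let_def const_mult)
qed

lemma gca_eval_surj: "gca_eval ` carrier F = carrier (model I)"
proof (intro equalityI subsetI)
  fix f assume f: "f \<in> carrier (model I)"
  define p where "p = (\<Sum>g\<in>supp_group I. pm_scale (f g) (mono g))"
  have "p \<in> carrier F" unfolding p_def
    by (intro free_algebra_sum free_algebra_closed mono_closed)
  moreover have "gca_eval p = f" unfolding p_def gca_eval_lincomb using f by auto
  ultimately show "f \<in> gca_eval ` carrier F" by blast
qed (use gca_eval_closed in blast)

theorem gca_iso_model: "graded_alg_iso G A (model I)"
proof (rule graded_alg_iso_quotient[where cls = cls and P = "carrier F" and F = gca_eval])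
  show "graded_algebra G (model I)" by (rule graded_algebra_twisted[OF subgroup_supp_group])
  show "\<exists>r\<in>carrier F. \<zero>\<^bsub>A\<^esub> = cls r \<and> gca_eval r = \<zero>\<^bsub>model I\<^esub>"
    by (rule bexI[of _ 0]) (simp_all add: gca_zero gca_eval_zero)
  show "\<exists>r\<in>carrier F. \<one>\<^bsub>A\<^esub> = cls r \<and> gca_eval r = \<one>\<^bsub>model I\<^esub>"
    by (rule bexI[OF _ free_algebra_closed(2)]) (simp add: gca_one gca_eval_one)
next
  fix p r assume pr: "p \<in> carrier F" "r \<in> carrier F"
  show "\<exists>s\<in>carrier F. cls p \<oplus>\<^bsub>A\<^esub> cls r = cls s \<and> gca_eval s = gca_eval p \<oplus>\<^bsub>model I\<^esub> gca_eval r"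
    by (rule bexI[OF _ free_algebra_closed(5)[OF pr]]) (simp add: gca_add[OF pr] gca_eval_add)
  show "\<exists>s\<in>carrier F. cls p \<otimes>\<^bsub>A\<^esub> cls r = cls s \<and> gca_eval s = gca_eval p \<otimes>\<^bsub>model I\<^esub> gca_eval r"
    by (rule bexI[OF _ free_algebra_closed(7)[OF pr]]) (simp add: gca_mult[OF pr] gca_eval_mult)
next
  fix c p assume p: "p \<in> carrier F"
  show "\<exists>s\<in>carrier F. c \<odot>\<^bsub>A\<^esub> cls p = cls s \<and> gca_eval s = c \<odot>\<^bsub>model I\<^esub> gca_eval p"
    by (rule bexI[OF _ free_algebra_closed(3)[OF p]]) (simp add: gca_smult[OF p] gca_eval_pm_scale)
next
  fix g assume g: "g \<in> carrier G"
  show "\<exists>H\<subseteq>carrier F. homog A g = cls ` H \<and> gca_eval ` H = homog (model I) g"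
  proof (cases "\<forall>i\<in>{1..m} - I. g i = 0")
    case True
    then have gI: "g \<in> supp_group I" using g by (simp add: supp_group_def)
    let ?H = "range (\<lambda>c. pm_scale c (mono g))"
    have "?H \<subseteq> carrier F" using mono_closed by (blast intro: free_algebra_closed)
    moreover have "homog A g = cls ` ?H" unfolding gca_homog using True by auto
    moreover have "gca_eval ` ?H = homog (model I) g"
    proof -
      have "gca_eval ` ?H = range (\<lambda>c k. c * basis_fun g k)"
        by (simp add: image_image gca_eval_pm_scale gca_eval_ordered_monomial[OF I gI])
      also have "\<dots> = homog (model I) g"
      proof (intro equalityI subsetI)
        fix f assume f: "f \<in> homog (model I) g"
        then have "f = (\<lambda>k. f g * basis_fun g k)" by (auto simp: basis_fun_def)
        then show "f \<in> range (\<lambda>c k. c * basis_fun g k)" by (rule image_eqI) simp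
      qed (use gI in \<open>auto simp: basis_fun_def\<close>)
      finally show ?thesis .
    qed
    ultimately show ?thesis by (intro exI[of _ ?H] conjI)
  next
    \<comment> \<open>A degree not supported on \<open>I\<close>: the component is the zero class by
      definition of \<open>gca\<close>, and in the model no nonzero function is concentrated
      there.\<close>
    case False
    then have "g \<notin> supp_group I" by (auto simp: supp_group_def)
    then have "f h = 0" if "f \<in> homog (model I) g" for f h
      using that by (cases "h = g") auto
    then have "homog (model I) g = {\<lambda>_. 0}" by fastforce
    then show ?thesis
      unfolding gca_homog if_not_P[OF False] by (intro exI[of _ "{0}"]) (simp add: gca_eval_zero)
  qed
qed (simp_all only: gca_carrier gca_eval_surj gca_class_eq_iff is_monoid)

end

section \<open>Two-factor and iterated braided products\<close>

context clifford_params begin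

lemma gca_iso:
  assumes "I \<subseteq> {1..m}"
  shows "graded_alg_iso G (gca n \<omega> m q I) (model I)"
proof -
  interpret clifford_subset n m \<omega> q I by unfold_locales (rule assms)
  show ?thesis by (rule gca_iso_model)
qed

lemma gca_tensor_iso:
  assumes "I \<inter> J = {}" "I \<union> J \<subseteq> {1..m}"
    and "graded_alg_iso G A (model I)" "graded_alg_iso G B (model J)"
  shows "graded_alg_iso G (gca n \<omega> m q (I \<union> J)) (braided_tensor G (R_GCA \<omega> m) A B)"
  using gca_iso[OF assms(2)] graded_alg_iso_sym[OF is_monoid braided_tensor_model[OF assms(1,3,4)]]
  by (rule graded_alg_iso_trans)

text \<open>Stated for intervals of indices, since a bracketing may cut the list at any point
  \<open>c\<close>. The model of the interval does not depend on the cuts, so all bracketings lead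
  to isomorphic algebras.\<close>

lemma iterated_tensor_iso:
  assumes "is_iterated_tensor G (R_GCA \<omega> m) As T"
    and "As = map (\<lambda>i. gca n \<omega> m q {i}) [a..<b]" "1 \<le> a" "a \<le> b" "b \<le> m + 1"
  shows "a < b \<and> graded_alg_iso G T (model {a..<b})"
  using assms
proof (induction arbitrary: a b rule: is_iterated_tensor.induct)
  case (single A)
  have b: "b = Suc a" using arg_cong[OF single(1), of length] by simp
  then have "A = gca n \<omega> m q {a}" using single(1) by simp
  moreover have "{a..<b} = {a}" using b by auto
  ultimately show ?case using gca_iso[of "{a}"] single b by simp
next
  case (product As S Bs T U)
  define c where "c = a + length As"
  have len: "length As + length Bs = b - a" using arg_cong[OF product.prems(1), of length] by simp
  have As: "As = map (\<lambda>i. gca n \<omega> m q {i}) [a..<c]"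
  proof -
    have "As = take (length As) (map (\<lambda>i. gca n \<omega> m q {i}) [a..<b])"
      using product.prems(1) by (metis append_eq_conv_conj)
    then show ?thesis using len product.prems(3) by (simp add: take_map c_def)
  qed
  have Bs: "Bs = map (\<lambda>i. gca n \<omega> m q {i}) [c..<b]"
  proof -
    have "Bs = drop (length As) (map (\<lambda>i. gca n \<omega> m q {i}) [a..<b])"
      using product.prems(1) by (metis append_eq_conv_conj)
    then show ?thesis by (simp add: drop_map c_def)
  qed
  have S: "a < c \<and> graded_alg_iso G S (model {a..<c})"
    using len product.prems(2-4) by (intro product.IH(1) As) (auto simp: c_def)
  have T: "c < b \<and> graded_alg_iso G T (model {c..<b})"
    using len product.prems(2-4) by (intro product.IH(2) Bs) (auto simp: c_def)
  have "graded_alg_iso G (braided_tensor G (R_GCA \<omega> m) S T) (model ({a..<c} \<union> {c..<b}))"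
    using S T by (intro braided_tensor_model) auto
  moreover have "{a..<c} \<union> {c..<b} = {a..<b}" using S T by auto
  ultimately have "graded_alg_iso G U (model {a..<b})"
    using graded_alg_iso_trans[OF graded_alg_iso_sym[OF is_monoid product.hyps(3)]] by simp
  then show ?case using S T by simp
qed

text \<open>The brackets are nested to the left. The generalized Clifford algebra on
  \<open>{a..<b}\<close> already has the required element type, so it can represent every
  intermediate product.\<close>

lemma iterated_tensor_exists:
  assumes "1 \<le> a" "a < b" "b \<le> m + 1"
  shows "is_iterated_tensor G (R_GCA \<omega> m) (map (\<lambda>i. gca n \<omega> m q {i}) [a..<b]) (gca n \<omega> m q {a..<b})"
  using assms(2,3)
proof (induction b)
  case (Suc b)
  show ?case
  proof (cases "a = b")
    case True
    then have "{a..<Suc b} = {a}" by auto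
    with True show ?thesis by (simp add: is_iterated_tensor.single)
  next
    case False
    let ?A = "gca n \<omega> m q {a..<b}" and ?B = "gca n \<omega> m q {b}"
    have "graded_alg_iso G (gca n \<omega> m q ({a..<b} \<union> {b})) (braided_tensor G (R_GCA \<omega> m) ?A ?B)"
      using assms(1) Suc.prems by (intro gca_tensor_iso gca_iso) auto
    moreover have "{a..<b} \<union> {b} = {a..<Suc b}" using Suc.prems by auto
    ultimately have calc: "graded_alg_iso G (braided_tensor G (R_GCA \<omega> m) ?A ?B) (gca n \<omega> m q {a..<Suc b})"
      using graded_alg_iso_sym[OF is_monoid] by simp
    have IH: "is_iterated_tensor G (R_GCA \<omega> m) (map (\<lambda>i. gca n \<omega> m q {i}) [a..<b]) ?A"
      using False Suc.prems by (intro Suc.IH) auto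
    from calc have "is_iterated_tensor G (R_GCA \<omega> m)
        (map (\<lambda>i. gca n \<omega> m q {i}) [a..<b] @ [?B]) (gca n \<omega> m q {a..<Suc b})"
      by (intro is_iterated_tensor.product[OF IH is_iterated_tensor.single])
    then show ?thesis using Suc.prems by simp
  qed
qed simp

end

text \<open>An iterated product is determined only up to isomorphism, so the second isomorphism is
  asserted for every such \<open>T\<close>, whatever its bracketing; the existence clause keeps this
  from being vacuous.\<close>

theorem proposition3p2:
  fixes n m l :: nat and \<omega> :: "'k::field" and q :: "nat \<Rightarrow> 'k"
  assumes "n \<ge> 2" and "\<not> CHAR('k) dvd n" and "primitive_root n \<omega>"
    and "m \<ge> 2" and "\<forall>i\<in>{1..m}. q i \<noteq> 0" and "1 \<le> l" and "l < m"
  defines "G \<equiv> Zn_power n m" and "R \<equiv> R_GCA \<omega> m" and "C \<equiv> gca n \<omega> m q"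
  shows "graded_alg_iso G (C {1..m}) (braided_tensor G R (C {1..l}) (C {l+1..m})) \<and>
    (\<exists>T. is_iterated_tensor G R (map (\<lambda>i. C {i}) [1..<m+1]) T) \<and>
    (\<forall>T. is_iterated_tensor G R (map (\<lambda>i. C {i}) [1..<m+1]) T \<longrightarrow>
       graded_alg_iso G (braided_tensor G R (C {1..l}) (C {l+1..m})) T)"
proof -
  interpret clifford_params n m \<omega> q
    using assms(1,3,5) by unfold_locales (auto simp: primitive_root_def)
  have split: "{1..l} \<union> {l+1..m} = {1..m}" using assms by auto
  have factors: "graded_alg_iso G (C {1..l}) (model {1..l})" "graded_alg_iso G (C {l+1..m}) (model {l+1..m})"
    unfolding G_def C_def using assms by (auto intro!: gca_iso)
  have 1: "graded_alg_iso G (C {1..m}) (braided_tensor G R (C {1..l}) (C {l+1..m}))"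
    using gca_tensor_iso[of "{1..l}" "{l+1..m}"] factors
    unfolding G_def R_def C_def split by auto
  have 2: "is_iterated_tensor G R (map (\<lambda>i. C {i}) [1..<m+1]) (C {1..<m+1})"
    unfolding G_def R_def C_def using assms by (intro iterated_tensor_exists) auto
  have 3: "graded_alg_iso G (braided_tensor G R (C {1..l}) (C {l+1..m})) T"
    if "is_iterated_tensor G R (map (\<lambda>i. C {i}) [1..<m+1]) T" for T
  proof -
    \<comment> \<open>Both \<open>T\<close> and the two-factor product are compared with the model
      on all generators.\<close>
    have "graded_alg_iso G T (model {1..<m+1})"
      using iterated_tensor_iso[of _ T 1 "m+1"] that unfolding G_def R_def C_def by auto
    moreover have "graded_alg_iso G (braided_tensor G R (C {1..l}) (C {l+1..m})) (model ({1..l} \<union> {l+1..m}))"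
      using factors unfolding G_def R_def C_def by (intro braided_tensor_model) auto
    moreover have "{1..<m+1} = {1..m}" by auto
    ultimately show ?thesis
      using graded_alg_iso_trans graded_alg_iso_sym[OF is_monoid] unfolding G_def split by metis
  qed
  from 1 2 3 show ?thesis by blast
qed

end
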